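(* Let $n,p\ge 1$, let $I$ be a left ideal of $\mathcal{D}_{n+p}$ and let $M=\mathcal{D}_{n+p}/I$. For any cone $\sigma$ of the $V$-Gröbner fan $\mathcal{E}_V=\mathcal{E}_V(h(I))$ and any $w\in\mathbb{Z}^p$, $${}^{\sigma}V_w(M)=\bigcap_{L\in\mathcal{L}(\sigma)}V^L_{L(w)}(M).$$
   Context: Ideal means left ideal. $\mathcal{D}_{n+p}$ is the ring of differential operators with coefficients in $\mathbb{C}\{x,t\}$ (convergent power series), $x=(x_1,\dots,x_n)$, $t=(t_1,\dots,t_p)$. $\mathcal{D}_{n+p}\langle z\rangle$ is the $\mathbb{C}\{x,t\}$-algebra generated by the $\partial_{x_i},\partial_{t_j},z$ whose only nontrivial commutation relations are $[\partial_y,c]=\frac{\partial c}{\partial y}z$ for $y$ one of the variables $x_i,t_j$ and $c\in\mathbb{C}\{x,t\}$. It is graded by the total degree in $\partial_x,\partial_t,z$. For $P=\sum_{\beta,\nu}c_{\beta,\nu}(x,t)\,\partial_x^\beta\partial_t^\nu\in\mathcal{D}_{n+p}$ of total degree $d$ in the $\partial$'s, its homogenization is $h(P)=\sum c_{\beta,\nu}\,\partial_x^\beta\partial_t^\nu z^{d-|\beta|-|\nu|}$; $h(I)$ is the ideal of $\mathcal{D}_{n+p}\langle z\rangle$ generated by the $h(P)$, $P\in I$. Writing $P\in\mathcal{D}_{n+p}\langle z\rangle$ (or $P\in\mathcal D_{n+p}$, with $k=0$ only) as $P=\sum a_{\alpha,\mu,\beta,\nu,k}\,x^\alpha t^\mu\partial_x^\beta\partial_t^\nu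 z^k$, its Newton diagram $\mathcal{N}(P)$ is the set of exponents $(\alpha,\mu,\beta,\nu,k)$ with nonzero coefficient. Let $V_j(\alpha,\mu,\beta,\nu,k)=\nu_j-\mu_j$ for $j=1,\dots,p$, and $\mathcal{U}_V=\{l_1V_1+\cdots+l_pV_p:\ l_j\ge0\}$, identified with $(\mathbb{R}_{\ge0})^p$. For $L\in\mathcal{U}_V$: $\mathrm{ord}^L(P)=\max L(\mathcal{N}(P))$ (with $\mathrm{ord}^L(0)=-\infty$), and $\sigma^L(P)$, the $L$-principal symbol, is the sum of the terms of $P$ on which $L$ equals $\mathrm{ord}^L(P)$. The graded ring $\mathrm{gr}^L(\mathcal{D}_{n+p}\langle z\rangle)$ of the filtration by $\mathrm{ord}^L$ is identified with the subring of $\mathcal{D}_{n+p}\langle z\rangle$ of operators that are polynomial in the variables $t_j$ with $l_j>0$; $\mathrm{gr}^L(h(I))$ is its ideal generated by the $\sigma^L(P)$, $P\in h(I)$. Gröbner fan: for $L,L'\in\mathcal{U}_V$ put $L\sim L'$ iff $\mathrm{gr}^L(\mathcal{D}_{n+p}\langle z\rangle)=\mathrm{gr}^{L'}(\mathcal{D}_{n+p}\langle z\rangle)$ (i.e. $L,L'$ have the same set of indices $j$ with $l_j>0$) and $\mathrm{gr}^L(h(I))=\mathrm{gr}^{L'}(h(I))$. The partition of $\mathcal{U}_V$ into equivalence classes consists of convex rational polyhedral cones (not necessarily open or closed; this is a known theorem of Assi, Castro Jiménez and Granger); it is the $V$-Gröbner fan $\mathcal{E}_V=\mathcal{E}_V(h(I))$.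 For $\sigma\in\mathcal{E}_V$, $\mathcal{L}(\sigma)$ is the minimal set $\{L_1,\dots,L_q\}$ of primitive elements (integral coefficients without common factor $\neq 1$) such that the closure is $\bar\sigma=\{r_1L_1+\cdots+r_qL_q:\ r_i\ge0\}$, i.e. the primitive generators of the $1$-skeleton of $\bar\sigma$ (for $\sigma=\{0\}$ it is empty, and the empty intersection is $M$). Filtrations: for $w\in\mathbb{Z}^p$, $V_w(\mathcal{D}_{n+p})=\{P:\ \mathrm{ord}^{V_j}(P)\le w_j,\ j=1,\dots,p\}$, and $V_w(M)$ is its image in $M$. For $L=l_1V_1+\cdots+l_pV_p$ write $L(w)=l_1w_1+\cdots+l_pw_p$. $V^L_k(M)$ is the image in $M$ of $\{P\in\mathcal{D}_{n+p}:\ \mathrm{ord}^L(P)\le k\}$; for integral $L$ and $k \in \mathbb{Z}$ it equals $\sum_{\{w\in\mathbb{Z}^p:\,L(w)\le k\}}V_w(M)$. Finally $${}^{\sigma}V_w(M)=\sum_{\{w'\in\mathbb{Z}^p:\ L(w')\le L(w)\ \forall L\in\mathcal{L}(\sigma)\}}V_{w'}(M).$$ *)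

theory Defs
  imports "HOL-Analysis.Analysis" "HOL-Library.Function_Algebras" "HOL-Library.Poly_Mapping"
    "HOL-Computational_Algebra.Polynomial"
begin

section \<open>Convergent power series\<close>

text \<open>
  \<open>'v\<close> indexes the variables, a power series is its coefficient function on multi-indices, and
  convergent means absolutely convergent at some point with positive coordinates.
\<close>

definition conv_series :: "(('v::finite \<Rightarrow> nat) \<Rightarrow> complex) \<Rightarrow> bool" where
  "conv_series f \<longleftrightarrow>
     (\<exists>\<rho>. (\<forall>i. 0 < \<rho> i) \<and> (\<lambda>a. norm (f a) * (\<Prod>i\<in>UNIV. \<rho> i ^ a i)) summable_on UNIV)"

lemma conv_seriesE:
  assumes "conv_series (f :: ('v::finite \<Rightarrow> nat) \<Rightarrow> complex)"
  obtains \<rho> :: "'v::finite \<Rightarrow> real" where "\<And>i. 0 < \<rho> i"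
    "(\<lambda>a. norm (f a) * (\<Prod>i\<in>UNIV. \<rho> i ^ a i)) summable_on UNIV"
  using assms unfolding conv_series_def by blast

lemma conv_series_bound:
  assumes "\<And>i. 0 < \<rho> i" "g summable_on UNIV"
    and "\<And>a. norm (f a) * (\<Prod>i\<in>UNIV. \<rho> i ^ a i) \<le> g a"
  shows "conv_series f"
  unfolding conv_series_def
proof (intro exI[of _ \<rho>] conjI allI)
  show "0 < \<rho> i" for i by (rule assms(1))
  show "(\<lambda>a. norm (f a) * (\<Prod>i\<in>UNIV. \<rho> i ^ a i)) summable_on UNIV"
  proof (rule summable_on_comparison_test[OF assms(2)])
    show "norm (f a) * (\<Prod>i\<in>UNIV. \<rho> i ^ a i) \<le> g a" for a by (rule assms(3))
    show "0 \<le> norm (f a) * (\<Prod>i\<in>UNIV. \<rho> i ^ a i)" for a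
      by (intro mult_nonneg_nonneg prod_nonneg) (auto intro!: zero_le_power less_imp_le[OF assms(1)])
  qed
qed

lemma conv_series_shrink:
  fixes \<rho> \<rho>' :: "'v::finite \<Rightarrow> real"
  assumes "(\<lambda>a. norm (f a) * (\<Prod>i\<in>UNIV. \<rho> i ^ a i)) summable_on UNIV"
    and "\<And>i. 0 < \<rho>' i" "\<And>i. \<rho>' i \<le> \<rho> i"
  shows "(\<lambda>a. norm (f a :: complex) * (\<Prod>i\<in>UNIV. \<rho>' i ^ a i)) summable_on UNIV"
proof (rule summable_on_comparison_test[OF assms(1)])
  show "norm (f a) * (\<Prod>i\<in>UNIV. \<rho>' i ^ a i) \<le> norm (f a) * (\<Prod>i\<in>UNIV. \<rho> i ^ a i)" for a
    by (intro mult_left_mono prod_mono conjI power_mono) (auto intro!: zero_le_power assms less_imp_le[OF assms(2)])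
  show "0 \<le> norm (f a) * (\<Prod>i\<in>UNIV. \<rho>' i ^ a i)" for a
    by (intro mult_nonneg_nonneg prod_nonneg) (auto intro!: zero_le_power less_imp_le[OF assms(2)])
qed

lemma conv_series_pairE:
  assumes "conv_series (f :: ('v::finite \<Rightarrow> nat) \<Rightarrow> complex)" "conv_series g"
  obtains \<rho> :: "'v::finite \<Rightarrow> real" where "\<And>i. 0 < \<rho> i"
    "(\<lambda>a. norm (f a) * (\<Prod>i\<in>UNIV. \<rho> i ^ a i)) summable_on UNIV"
    "(\<lambda>a. norm (g a) * (\<Prod>i\<in>UNIV. \<rho> i ^ a i)) summable_on UNIV"
proof -
  obtain \<rho> :: "'v \<Rightarrow> real" where r: "\<And>i. 0 < \<rho> i"
    "(\<lambda>a. norm (f a) * (\<Prod>i\<in>UNIV. \<rho> i ^ a i)) summable_on UNIV"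
    using assms(1) by (rule conv_seriesE) blast
  obtain \<rho>' :: "'v \<Rightarrow> real" where r': "\<And>i. 0 < \<rho>' i"
    "(\<lambda>a. norm (g a) * (\<Prod>i\<in>UNIV. \<rho>' i ^ a i)) summable_on UNIV"
    using assms(2) by (rule conv_seriesE) blast
  show ?thesis
    by (rule that[of "\<lambda>i. min (\<rho> i) (\<rho>' i)"])
       (use r r' in \<open>auto intro: conv_series_shrink[OF r(2)] conv_series_shrink[OF r'(2)]\<close>)
qed

lemma conv_series_mono:
  assumes "conv_series f" "\<And>a. norm (g a) \<le> norm (f a)"
  shows "conv_series g"
proof -
  obtain \<rho> where r: "\<And>i. 0 < \<rho> i"
    "(\<lambda>a. norm (f a) * (\<Prod>i\<in>UNIV. \<rho> i ^ a i)) summable_on UNIV"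
    using assms(1) by (rule conv_seriesE) blast
  show ?thesis
  proof (rule conv_series_bound[OF r])
    show "norm (g a) * (\<Prod>i\<in>UNIV. \<rho> i ^ a i) \<le> norm (f a) * (\<Prod>i\<in>UNIV. \<rho> i ^ a i)" for a
      by (intro mult_right_mono assms(2) prod_nonneg) (auto intro!: zero_le_power less_imp_le[OF r(1)])
  qed
qed

lemma conv_series_restrict:
  "conv_series f \<Longrightarrow> conv_series (\<lambda>a. if a \<in> A then f a else 0)"
  by (erule conv_series_mono) auto

lemma conv_series_single: "conv_series (\<lambda>a. if a = b then c else 0)"
proof -
  have "(\<lambda>a. norm (if a = b then c else 0) * (\<Prod>i\<in>UNIV. 1 ^ a i)) summable_on {b}"
    by simp
  then have "(\<lambda>a. norm (if a = b then c else 0) * (\<Prod>i\<in>UNIV. (1::real) ^ a i)) summable_on UNIV"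
    by (rule summable_on_cong_neutral[THEN iffD1, rotated -1]) auto
  then show ?thesis
    unfolding conv_series_def by (intro exI[of _ "\<lambda>_. 1"]) auto
qed

lemma conv_series_add:
  assumes "conv_series f" "conv_series g"
  shows "conv_series (\<lambda>a. f a + g a)"
proof -
  obtain \<rho> where r: "\<And>i. 0 < \<rho> i"
    "(\<lambda>a. norm (f a) * (\<Prod>i\<in>UNIV. \<rho> i ^ a i)) summable_on UNIV"
    "(\<lambda>a. norm (g a) * (\<Prod>i\<in>UNIV. \<rho> i ^ a i)) summable_on UNIV"
    using assms by (rule conv_series_pairE) blast
  show ?thesis
  proof (rule conv_series_bound[OF r(1) summable_on_add[OF r(2,3)]])
    fix a
    have "0 \<le> (\<Prod>i\<in>UNIV. \<rho> i ^ a i)"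
      by (intro prod_nonneg) (auto intro!: zero_le_power less_imp_le[OF r(1)])
    then show "norm (f a + g a) * (\<Prod>i\<in>UNIV. \<rho> i ^ a i)
        \<le> norm (f a) * (\<Prod>i\<in>UNIV. \<rho> i ^ a i) + norm (g a) * (\<Prod>i\<in>UNIV. \<rho> i ^ a i)"
      using mult_right_mono[OF norm_triangle_ineq] by (metis distrib_right)
  qed
qed

lemma finite_multi_le: "finite {b :: 'v::finite \<Rightarrow> nat. b \<le> a}"
proof (rule finite_subset)
  show "{b. b \<le> a} \<subseteq> (\<Pi>\<^sub>E i\<in>UNIV. {..a i})"
    by (auto simp: le_fun_def)
qed (simp add: finite_PiE)

lemma finite_multi_add: "finite {(b, c). b + c = (a :: 'v::finite \<Rightarrow> nat)}"
proof (rule finite_subset)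
  show "{(b, c). b + c = a} \<subseteq> {b. b \<le> a} \<times> {b. b \<le> a}"
    by (auto simp: le_fun_def)
qed (simp add: finite_multi_le)

lemma conv_series_mult:
  fixes f g :: "('v::finite \<Rightarrow> nat) \<Rightarrow> complex"
  assumes "conv_series f" "conv_series g"
  shows "conv_series (\<lambda>a. \<Sum>(b, c) | b + c = a. f b * g c)"
proof -
  obtain \<rho> where r: "\<And>i. 0 < \<rho> i"
    "(\<lambda>a. norm (f a) * (\<Prod>i\<in>UNIV. \<rho> i ^ a i)) summable_on UNIV"
    "(\<lambda>a. norm (g a) * (\<Prod>i\<in>UNIV. \<rho> i ^ a i)) summable_on UNIV"
    using assms by (rule conv_series_pairE) blast
  define F where "F a = norm (f a) * (\<Prod>i\<in>UNIV. \<rho> i ^ a i)" for a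
  define G where "G a = norm (g a) * (\<Prod>i\<in>UNIV. \<rho> i ^ a i)" for a
  have nn: "0 \<le> (\<Prod>i\<in>UNIV. \<rho> i ^ a i)" for a
    by (intro prod_nonneg) (auto intro!: zero_le_power less_imp_le[OF r(1)])
  have FG0: "0 \<le> F a" "0 \<le> G a" for a by (auto simp: F_def G_def nn)
  have F: "F summable_on UNIV" and G: "G summable_on UNIV"
    using r(2,3) by (auto simp: F_def[abs_def] G_def[abs_def])
  have prodsum: "(\<lambda>(b, c). F b * G c) summable_on UNIV \<times> UNIV"
  proof (rule summable_on_SigmaI[where g = "\<lambda>b. F b * infsum G UNIV"])
    show "((\<lambda>c. case (b, c) of (b, c) \<Rightarrow> F b * G c) has_sum F b * infsum G UNIV) UNIV" for b
      using has_sum_cmult_right[OF has_sum_infsum[OF G], of "F b"] by simp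
    show "(\<lambda>b. F b * infsum G UNIV) summable_on UNIV"
      by (rule summable_on_cmult_left[OF F])
  qed (auto simp: FG0)
  have bij: "bij_betw (\<lambda>(a, b, c). (b, c)) (SIGMA a:UNIV. {(b, c). b + c = a})
      (UNIV \<times> UNIV :: (('v \<Rightarrow> nat) \<times> ('v \<Rightarrow> nat)) set)"
    by (rule bij_betwI[where g = "\<lambda>(b, c). (b + c, b, c)"]) auto
  have "(\<lambda>(a, b, c). F b * G c) summable_on (SIGMA a:UNIV. {(b, c). b + c = a})"
    using summable_on_reindex_bij_betw[OF bij, of "\<lambda>(b, c). F b * G c"] prodsum
    by (simp add: case_prod_unfold)
  then have "(\<lambda>(a, bc). F (fst bc) * G (snd bc)) summable_on (SIGMA a:UNIV. {(b, c). b + c = a})"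
    by (simp add: case_prod_unfold)
  moreover have fin: "finite {p. fst p + snd p = a}" for a :: "'v \<Rightarrow> nat"
    using finite_multi_add[of a] by (simp add: case_prod_unfold)
  ultimately have S: "(\<lambda>a. \<Sum>(b, c) | b + c = a. F b * G c) summable_on UNIV"
    using summable_on_Sigma_banach[of "\<lambda>a bc. F (fst bc) * G (snd bc)" UNIV "\<lambda>a. {(b, c). b + c = a}"]
    by (simp add: case_prod_unfold)
  show ?thesis
  proof (rule conv_series_bound[OF r(1) S])
    fix a
    have "norm (\<Sum>(b, c) | b + c = a. f b * g c) * (\<Prod>i\<in>UNIV. \<rho> i ^ a i)
        \<le> (\<Sum>(b, c) | b + c = a. norm (f b) * norm (g c)) * (\<Prod>i\<in>UNIV. \<rho> i ^ a i)"
      by (intro mult_right_mono nn order.trans[OF norm_sum] sum_mono)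
         (auto simp: norm_mult)
    also have "\<dots> = (\<Sum>(b, c) | b + c = a. F b * G c)"
      unfolding sum_distrib_right
    proof (intro sum.cong refl, clarsimp)
      fix b c assume "a = b + c"
      show "norm (f b) * norm (g c) * (\<Prod>i\<in>UNIV. \<rho> i ^ (b i + c i)) = F b * G c"
        by (simp add: F_def G_def power_add prod.distrib mult_ac)
    qed
    finally show "norm (\<Sum>(b, c) | b + c = a. f b * g c) * (\<Prod>i\<in>UNIV. \<rho> i ^ a i)
        \<le> (\<Sum>(b, c) | b + c = a. F b * G c)" .
  qed
qed

lemma conv_series_pd:
  fixes f :: "('v::finite \<Rightarrow> nat) \<Rightarrow> complex"
  assumes "conv_series f"
  shows "conv_series (\<lambda>a. of_nat (Suc (a j)) * f (a(j := Suc (a j))))"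
proof -
  obtain \<rho> where r: "\<And>i. 0 < \<rho> i"
    "(\<lambda>a. norm (f a) * (\<Prod>i\<in>UNIV. \<rho> i ^ a i)) summable_on UNIV"
    using assms by (rule conv_seriesE) blast
  have nn: "0 \<le> (\<Prod>i\<in>UNIV. \<rho> i ^ a i)" for a
    by (intro prod_nonneg) (auto intro!: zero_le_power less_imp_le[OF r(1)])
  have inj: "inj (\<lambda>a :: 'v \<Rightarrow> nat. a(j := Suc (a j)))"
  proof (rule injI, rule ext)
    fix a b :: "'v \<Rightarrow> nat" and i assume e: "a(j := Suc (a j)) = b(j := Suc (b j))"
    show "a i = b i" using fun_cong[OF e, of i] by (cases "i = j") auto
  qed
  have "(\<lambda>a. norm (f a) * (\<Prod>i\<in>UNIV. \<rho> i ^ a i)) summable_on (range (\<lambda>a. a(j := Suc (a j))))"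
    by (rule summable_on_subset_banach[OF r(2)]) simp
  then have "(\<lambda>a. norm (f (a(j := Suc (a j)))) * (\<Prod>i\<in>UNIV. \<rho> i ^ (a(j := Suc (a j))) i)) summable_on UNIV"
    unfolding summable_on_reindex[OF inj] by (simp add: o_def)
  then have S: "(\<lambda>a. norm (f (a(j := Suc (a j)))) * (\<Prod>i\<in>UNIV. \<rho> i ^ (a(j := Suc (a j))) i) * (1 / \<rho> j)) summable_on UNIV"
    by (rule summable_on_cmult_left)
  show ?thesis
  proof (rule conv_series_bound[OF _ S])
    show "0 < (if i = j then \<rho> i / 2 else \<rho> i)" for i using r(1)[of i] by auto
    fix a :: "'v \<Rightarrow> nat"
    have p1: "(\<Prod>i\<in>UNIV. (if i = j then \<rho> i / 2 else \<rho> i) ^ a i) = (\<Prod>i\<in>UNIV. \<rho> i ^ a i) / 2 ^ a j"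
      by (subst (1 2) prod.remove[of UNIV j]) (auto simp: power_divide)
    have p2: "(\<Prod>i\<in>UNIV. \<rho> i ^ (a(j := Suc (a j))) i) = (\<Prod>i\<in>UNIV. \<rho> i ^ a i) * \<rho> j"
      by (subst (1 2) prod.remove[of UNIV j]) auto
    have "Suc (a j) \<le> 2 ^ a j" by (rule Suc_leI, rule less_exp)
    then have "real (Suc (a j)) \<le> 2 ^ a j"
      by (metis of_nat_le_iff of_nat_numeral of_nat_power)
    then have le1: "real (Suc (a j)) / 2 ^ a j \<le> 1" by simp
    have "norm (of_nat (Suc (a j)) * f (a(j := Suc (a j)))) * (\<Prod>i\<in>UNIV. (if i = j then \<rho> i / 2 else \<rho> i) ^ a i)
      = (real (Suc (a j)) / 2 ^ a j) * (norm (f (a(j := Suc (a j)))) * (\<Prod>i\<in>UNIV. \<rho> i ^ a i))"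
      unfolding p1 norm_mult norm_of_nat by (simp add: field_simps)
    also have "\<dots> \<le> 1 * (norm (f (a(j := Suc (a j)))) * (\<Prod>i\<in>UNIV. \<rho> i ^ a i))"
      by (intro mult_right_mono le1 mult_nonneg_nonneg nn) simp
    also have "\<dots> = norm (f (a(j := Suc (a j)))) * (\<Prod>i\<in>UNIV. \<rho> i ^ (a(j := Suc (a j))) i) * (1 / \<rho> j)"
      unfolding p2 using r(1)[of j] by simp
    finally show "norm (of_nat (Suc (a j)) * f (a(j := Suc (a j)))) * (\<Prod>i\<in>UNIV. (if i = j then \<rho> i / 2 else \<rho> i) ^ a i)
      \<le> norm (f (a(j := Suc (a j)))) * (\<Prod>i\<in>UNIV. \<rho> i ^ (a(j := Suc (a j))) i) * (1 / \<rho> j)" .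
  qed
qed

typedef 'v cps = "{f :: ('v::finite \<Rightarrow> nat) \<Rightarrow> complex. conv_series f}"
  morphisms cps_nth Abs_cps
  using conv_series_single by blast

setup_lifting type_definition_cps

lemma cps_eqI: "(\<And>a. cps_nth f a = cps_nth g a) \<Longrightarrow> f = g"
  by (rule cps_nth_inject[THEN iffD1]) (rule ext)

instantiation cps :: (finite) comm_ring_1
begin

lift_definition zero_cps :: "'a cps" is "\<lambda>a. 0"
  using conv_series_single[of _ 0] by simp

lift_definition one_cps :: "'a cps" is "\<lambda>a. if a = 0 then 1 else 0"
  by (rule conv_series_single)

lift_definition plus_cps :: "'a cps \<Rightarrow> 'a cps \<Rightarrow> 'a cps" is "\<lambda>f g a. f a + g a"
  by (rule conv_series_add)

lift_definition uminus_cps :: "'a cps \<Rightarrow> 'a cps" is "\<lambda>f a. - f a"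
  by (erule conv_series_mono) simp

definition minus_cps :: "'a cps \<Rightarrow> 'a cps \<Rightarrow> 'a cps" where "minus_cps f g = f + - g"

lift_definition times_cps :: "'a cps \<Rightarrow> 'a cps \<Rightarrow> 'a cps" is
  "\<lambda>f g a. \<Sum>(b, c) | b + c = a. f b * g c"
  by (rule conv_series_mult)

instance
proof
  fix f g h :: "'a cps"
  show "f + g + h = f + (g + h)" by transfer (simp add: add_ac)
  show "f + g = g + f" by transfer (simp add: add_ac)
  show "0 + f = f" by transfer simp
  show "- f + f = 0" by transfer simp
  show "f - g = f + - g" by (rule minus_cps_def)
  show "(0::'a cps) \<noteq> 1" by transfer (auto dest: fun_cong[of _ _ 0])
  show "(f + g) * h = f * h + g * h"
    by transfer (simp add: case_prod_unfold distrib_right sum.distrib)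
  show "f * g = g * f"
  proof (transfer, rule ext)
    fix f g :: "('a \<Rightarrow> nat) \<Rightarrow> complex" and a
    show "(\<Sum>(b, c) | b + c = a. f b * g c) = (\<Sum>(b, c) | b + c = a. g b * f c)"
      by (rule sum.reindex_bij_witness[where i = prod.swap and j = prod.swap])
         (auto simp: add.commute)
  qed
  show "1 * f = f"
  proof (transfer, rule ext)
    fix f :: "('a \<Rightarrow> nat) \<Rightarrow> complex" and a
    have "(\<Sum>(b, c) | b + c = a. (if b = 0 then 1 else 0) * f c)
        = (\<Sum>(b, c)\<in>{(0 :: 'a \<Rightarrow> nat, a)}. (if b = 0 then 1 else 0) * f c)"
      by (rule sum.mono_neutral_right[OF finite_multi_add]) (auto split: if_splits)
    then show "(\<Sum>(b, c) | b + c = a. (if b = 0 then 1 else 0) * f c) = f a" by simp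
  qed
  show "f * g * h = f * (g * h)"
  proof (transfer, rule ext)
    fix f g h :: "('a \<Rightarrow> nat) \<Rightarrow> complex" and a
    have "(\<Sum>(b, c) | b + c = a. (\<Sum>(d, e) | d + e = b. f d * g e) * h c)
       = (\<Sum>p | fst p + snd p = a. \<Sum>q | fst q + snd q = fst p. f (fst q) * g (snd q) * h (snd p))"
      by (simp add: case_prod_unfold sum_distrib_right)
    also have "\<dots> = (\<Sum>(p, q)\<in>(SIGMA p:{p. fst p + snd p = a}. {q. fst q + snd q = fst p}).
        f (fst q) * g (snd q) * h (snd p))"
      by (rule sum.Sigma) (use finite_multi_add in \<open>auto simp: case_prod_unfold\<close>)
    also have "\<dots> = (\<Sum>(p, q)\<in>(SIGMA p:{p. fst p + snd p = a}. {q. fst q + snd q = snd p}).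
        f (fst p) * (g (fst q) * h (snd q)))"
      by (rule sum.reindex_bij_witness
            [where j = "\<lambda>((b, c), (d, e)). ((d, e + c), (e, c))"
               and i = "\<lambda>((d, x), (e, c)). ((d + e, c), (d, e))"])
         (auto simp: add.assoc)
    also have "\<dots> = (\<Sum>p | fst p + snd p = a. \<Sum>q | fst q + snd q = snd p. f (fst p) * (g (fst q) * h (snd q)))"
      by (rule sum.Sigma[symmetric]) (use finite_multi_add in \<open>auto simp: case_prod_unfold\<close>)
    also have "\<dots> = (\<Sum>(b, c) | b + c = a. f b * (\<Sum>(d, e) | d + e = c. g d * h e))"
      by (simp add: case_prod_unfold sum_distrib_left)
    finally show "(\<Sum>(b, c) | b + c = a. (\<Sum>(d, e) | d + e = b. f d * g e) * h c)
       = (\<Sum>(b, c) | b + c = a. f b * (\<Sum>(d, e) | d + e = c. g d * h e))" .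
  qed
qed

end

lift_definition cps_pd :: "'v::finite \<Rightarrow> 'v cps \<Rightarrow> 'v cps" is
  "\<lambda>i f a. of_nat (Suc (a i)) * f (a(i := Suc (a i)))"
  by (rule conv_series_pd)

lift_definition cps_restrict :: "('v::finite \<Rightarrow> nat) set \<Rightarrow> 'v cps \<Rightarrow> 'v cps" is
  "\<lambda>A f a. if a \<in> A then f a else 0"
  by (rule conv_series_restrict)

lemma cps_pd_add: "cps_pd i (f + g) = cps_pd i f + cps_pd i g"
  by transfer (simp add: algebra_simps)

lemma cps_pd_commute: "cps_pd i (cps_pd j f) = cps_pd j (cps_pd i f)"
  by transfer (auto simp: fun_eq_iff fun_upd_twist mult_ac)

lemma cps_pd_mult: "cps_pd i (f * g) = cps_pd i f * g + f * cps_pd i g"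
proof (transfer, rule ext)
  fix i and f g :: "('a \<Rightarrow> nat) \<Rightarrow> complex" and a
  define u where "u b = b(i := Suc (b i))" for b :: "'a \<Rightarrow> nat"
  have left: "(\<Sum>(b, c) | b + c = u a. of_nat (b i) * f b * g c)
      = (\<Sum>(b, c) | b + c = a. of_nat (Suc (b i)) * f (u b) * g c)" for f g
  proof -
    have "(\<Sum>(b, c) | b + c = u a. of_nat (b i) * f b * g c)
        = (\<Sum>(b, c) \<in> {(b, c). b + c = u a \<and> b i \<noteq> 0}. of_nat (b i) * f b * g c)"
      by (rule sum.mono_neutral_right[OF finite_multi_add]) (auto intro!: gr0I)
    also have "\<dots> = (\<Sum>(b, c) | b + c = a. of_nat (Suc (b i)) * f (u b) * g c)"
      by (rule sum.reindex_bij_witness[where i = "\<lambda>(b, c). (u b, c)"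
            and j = "\<lambda>(b, c). (b(i := b i - 1), c)"])
         (auto simp: u_def fun_eq_iff simp del: of_nat_Suc split: if_splits)
    finally show ?thesis .
  qed
  have right: "(\<Sum>(b, c) | b + c = u a. of_nat (c i) * f b * g c)
      = (\<Sum>(b, c) | b + c = a. f b * (of_nat (Suc (c i)) * g (u c)))"
  proof -
    have "(\<Sum>(b, c) | b + c = u a. of_nat (c i) * f b * g c)
      = (\<Sum>(b, c) | b + c = u a. of_nat (b i) * g b * f c)"
      by (rule sum.reindex_bij_witness[where i = prod.swap and j = prod.swap])
         (auto simp: add.commute)
    also have "\<dots> = (\<Sum>(b, c) | b + c = a. of_nat (Suc (b i)) * g (u b) * f c)"
      by (rule left)
    also have "\<dots> = (\<Sum>(b, c) | b + c = a. f b * (of_nat (Suc (c i)) * g (u c)))"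
      by (rule sum.reindex_bij_witness[where i = prod.swap and j = prod.swap])
         (auto simp: add.commute)
    finally show ?thesis .
  qed
  have "of_nat (Suc (a i)) * (\<Sum>(b, c) | b + c = u a. f b * g c)
      = (\<Sum>(b, c) | b + c = u a. of_nat (b i) * f b * g c + of_nat (c i) * f b * g c)"
    unfolding sum_distrib_left
  proof (intro sum.cong refl, clarify)
    fix b c assume "b + c = u a"
    then have "Suc (a i) = b i + c i" by (metis fun_upd_same plus_fun_apply u_def)
    then have "of_nat (Suc (a i)) = (of_nat (b i) + of_nat (c i) :: complex)" by (metis of_nat_add)
    then show "of_nat (Suc (a i)) * (f b * g c) = of_nat (b i) * f b * g c + of_nat (c i) * f b * g c"
      by (simp add: algebra_simps)
  qed
  also have "\<dots> = (\<Sum>(b, c) | b + c = u a. of_nat (b i) * f b * g c)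
      + (\<Sum>(b, c) | b + c = u a. of_nat (c i) * f b * g c)"
    by (simp add: case_prod_unfold sum.distrib)
  finally show "of_nat (Suc (a i)) * (\<Sum>(b, c) | b + c = a(i := Suc (a i)). f b * g c) =
       (\<Sum>(b, c) | b + c = a. of_nat (Suc (b i)) * f (b(i := Suc (b i))) * g c) +
       (\<Sum>(b, c) | b + c = a. f b * (of_nat (Suc (c i)) * g (c(i := Suc (c i)))))"
    unfolding left right by (simp add: u_def)
qed

section \<open>Rings of differential operators\<close>

text \<open>
  For commuting derivations \<open>\<delta>\<^sub>i\<close> of a commutative ring \<open>R\<close>, the finitely supported function \<open>Q\<close>
  stands for the operator \<open>\<Sum>\<^sub>\<beta> Q\<^sub>\<beta> \<partial>\<^sup>\<beta>\<close> with coefficients on the left, and \<open>\<partial>\<^sub>i c = c \<partial>\<^sub>i + \<delta>\<^sub>i c\<close>.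
  So \<open>ore_left \<delta> i\<close> is left multiplication by \<open>\<partial>\<^sub>i\<close>, \<open>ore_left_pow \<delta> \<beta>\<close> is left multiplication by
  \<open>\<partial>\<^sup>\<beta>\<close> (the factors commute, see \<open>left_commute\<close> below), and \<open>ore_scale c\<close> is left multiplication
  by \<open>c \<in> R\<close>.  The product \<open>ore_mult\<close> is not the convolution product of \<open>Poly_Mapping\<close>.
\<close>

definition ore_scale :: "'r::comm_ring_1 \<Rightarrow> (('v \<Rightarrow> nat) \<Rightarrow>\<^sub>0 'r) \<Rightarrow> (('v \<Rightarrow> nat) \<Rightarrow>\<^sub>0 'r)" where
  "ore_scale c Q = (\<Sum>\<beta>\<in>Poly_Mapping.keys Q. Poly_Mapping.single \<beta> (c * Poly_Mapping.lookup Q \<beta>))"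

definition ore_left ::
    "('v \<Rightarrow> 'r::comm_ring_1 \<Rightarrow> 'r) \<Rightarrow> 'v \<Rightarrow> (('v \<Rightarrow> nat) \<Rightarrow>\<^sub>0 'r) \<Rightarrow> (('v \<Rightarrow> nat) \<Rightarrow>\<^sub>0 'r)" where
  "ore_left \<delta> i Q = (\<Sum>\<beta>\<in>Poly_Mapping.keys Q.
     Poly_Mapping.single (\<beta>(i := Suc (\<beta> i))) (Poly_Mapping.lookup Q \<beta>) +
     Poly_Mapping.single \<beta> (\<delta> i (Poly_Mapping.lookup Q \<beta>)))"

definition ore_left_pow ::
    "('v::finite \<Rightarrow> 'r::comm_ring_1 \<Rightarrow> 'r) \<Rightarrow> ('v \<Rightarrow> nat) \<Rightarrow> (('v \<Rightarrow> nat) \<Rightarrow>\<^sub>0 'r) \<Rightarrow> (('v \<Rightarrow> nat) \<Rightarrow>\<^sub>0 'r)" where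
  "ore_left_pow \<delta> \<beta> = Finite_Set.fold (\<lambda>i. (\<circ>) (ore_left \<delta> i ^^ \<beta> i)) id UNIV"

definition ore_mult ::
    "('v::finite \<Rightarrow> 'r::comm_ring_1 \<Rightarrow> 'r) \<Rightarrow> (('v \<Rightarrow> nat) \<Rightarrow>\<^sub>0 'r) \<Rightarrow> (('v \<Rightarrow> nat) \<Rightarrow>\<^sub>0 'r) \<Rightarrow> (('v \<Rightarrow> nat) \<Rightarrow>\<^sub>0 'r)" where
  "ore_mult \<delta> P Q = (\<Sum>\<beta>\<in>Poly_Mapping.keys P. ore_scale (Poly_Mapping.lookup P \<beta>) (ore_left_pow \<delta> \<beta> Q))"

lemma additive_sum:
  fixes F :: "'a::ab_group_add \<Rightarrow> 'b::ab_group_add"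
  assumes "\<And>x y. F (x + y) = F x + F y"
  shows "F 0 = 0" "F (\<Sum>x\<in>A. g x) = (\<Sum>x\<in>A. F (g x))"
proof -
  show z: "F 0 = 0" using assms[of 0 0] by simp
  show "F (\<Sum>x\<in>A. g x) = (\<Sum>x\<in>A. F (g x))"
    by (induction A rule: infinite_finite_induct) (auto simp: z assms)
qed

lemma poly_mapping_expand:
  "(Q :: 'a \<Rightarrow>\<^sub>0 'b::comm_monoid_add) =
     (\<Sum>\<beta>\<in>Poly_Mapping.keys Q. Poly_Mapping.single \<beta> (Poly_Mapping.lookup Q \<beta>))"
proof (rule poly_mapping_eqI)
  fix k
  show "Poly_Mapping.lookup Q k = Poly_Mapping.lookup
      (\<Sum>\<beta>\<in>Poly_Mapping.keys Q. Poly_Mapping.single \<beta> (Poly_Mapping.lookup Q \<beta>)) k"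
    by (simp add: lookup_sum lookup_single when_def in_keys_iff)
qed

lemma additive_eqI:
  fixes F G :: "('a \<Rightarrow>\<^sub>0 'b::ab_group_add) \<Rightarrow> 'c::ab_group_add"
  assumes "\<And>x y. F (x + y) = F x + F y" "\<And>x y. G (x + y) = G x + G y"
    and "\<And>\<beta> c. F (Poly_Mapping.single \<beta> c) = G (Poly_Mapping.single \<beta> c)"
  shows "F Q = G Q"
proof -
  have "F (\<Sum>\<beta>\<in>Poly_Mapping.keys Q. Poly_Mapping.single \<beta> (Poly_Mapping.lookup Q \<beta>))
      = G (\<Sum>\<beta>\<in>Poly_Mapping.keys Q. Poly_Mapping.single \<beta> (Poly_Mapping.lookup Q \<beta>))"
    unfolding additive_sum(2)[of F, OF assms(1)] additive_sum(2)[of G, OF assms(2)]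
    by (simp add: assms(3))
  then show ?thesis by (simp flip: poly_mapping_expand)
qed

lemma ore_scale_single: "ore_scale c (Poly_Mapping.single \<beta> d) = Poly_Mapping.single \<beta> (c * d)"
  by (cases "d = 0") (simp_all add: ore_scale_def)

lemma ore_scale_add_right: "ore_scale c (P + Q) = ore_scale c P + ore_scale c Q"
  unfolding ore_scale_def
  by (rule setsum_keys_plus_distrib) (simp_all add: distrib_left single_add)

lemma ore_scale_add_left: "ore_scale (c + d) Q = ore_scale c Q + ore_scale d Q"
  by (simp add: ore_scale_def distrib_right single_add sum.distrib)

lemma ore_scale_scale: "ore_scale c (ore_scale d Q) = ore_scale (c * d) Q"
  by (rule additive_eqI) (simp_all add: ore_scale_add_right ore_scale_single mult.assoc)

lemma ore_scale_one: "ore_scale 1 Q = Q"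
  by (simp add: ore_scale_def flip: poly_mapping_expand)

lemma ore_scale_0_left: "ore_scale 0 Q = 0"
  by (simp add: ore_scale_def)

locale commuting_derivations =
  fixes \<delta> :: "'v::finite \<Rightarrow> 'r::comm_ring_1 \<Rightarrow> 'r"
  assumes \<delta>_add: "\<delta> i (x + y) = \<delta> i x + \<delta> i y"
    and \<delta>_mult: "\<delta> i (x * y) = \<delta> i x * y + x * \<delta> i y"
    and \<delta>_commute: "\<delta> i (\<delta> j x) = \<delta> j (\<delta> i x)"
begin

lemma \<delta>_0: "\<delta> i 0 = 0"
  by (rule additive_sum(1)) (rule \<delta>_add)

lemma \<delta>_1: "\<delta> i 1 = 0"
  using \<delta>_mult[of i 1 1] by simp

lemma left_add: "ore_left \<delta> i (P + Q) = ore_left \<delta> i P + ore_left \<delta> i Q"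
  unfolding ore_left_def
  by (rule setsum_keys_plus_distrib) (simp_all add: \<delta>_add \<delta>_0 single_add)

lemma left_single: "ore_left \<delta> i (Poly_Mapping.single \<beta> c) =
    Poly_Mapping.single (\<beta>(i := Suc (\<beta> i))) c + Poly_Mapping.single \<beta> (\<delta> i c)"
  by (cases "c = 0") (simp_all add: ore_left_def \<delta>_0)

lemma left_scale:
  "ore_left \<delta> i (ore_scale c Q) = ore_scale c (ore_left \<delta> i Q) + ore_scale (\<delta> i c) Q"
  by (rule additive_eqI)
     (simp_all add: left_add ore_scale_add_right ore_scale_single left_single \<delta>_mult single_add add_ac)

lemma left_commute: "ore_left \<delta> i (ore_left \<delta> j Q) = ore_left \<delta> j (ore_left \<delta> i Q)"
  by (rule additive_eqI)
     (auto simp add: left_add left_single \<delta>_commute[of i j] fun_upd_twist add_ac)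

lemma funpow_left_commute1:
  "(ore_left \<delta> i ^^ m) (ore_left \<delta> j Q) = ore_left \<delta> j ((ore_left \<delta> i ^^ m) Q)"
  by (induction m) (auto simp: left_commute[of i j])

lemma funpow_left_commute:
  "(ore_left \<delta> i ^^ m) ((ore_left \<delta> j ^^ n) Q) = (ore_left \<delta> j ^^ n) ((ore_left \<delta> i ^^ m) Q)"
  by (induction n) (auto simp: funpow_left_commute1)

lemma fold_commute: "comp_fun_commute (\<lambda>i. (\<circ>) (ore_left \<delta> i ^^ \<beta> i))"
  by standard (auto simp: fun_eq_iff funpow_left_commute)

definition left_pow_on :: "('v \<Rightarrow> nat) \<Rightarrow> 'v set \<Rightarrow> (('v \<Rightarrow> nat) \<Rightarrow>\<^sub>0 'r) \<Rightarrow> (('v \<Rightarrow> nat) \<Rightarrow>\<^sub>0 'r)" where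
  "left_pow_on \<beta> A = Finite_Set.fold (\<lambda>i. (\<circ>) (ore_left \<delta> i ^^ \<beta> i)) id A"

lemma left_pow_on_empty: "left_pow_on \<beta> {} Q = Q"
  by (simp add: left_pow_on_def)

lemma left_pow_on_insert:
  assumes "i \<notin> A"
  shows "left_pow_on \<beta> (insert i A) Q = (ore_left \<delta> i ^^ \<beta> i) (left_pow_on \<beta> A Q)"
  unfolding left_pow_on_def
  by (subst comp_fun_commute_on.fold_insert[OF fold_commute[unfolded comp_fun_commute_def'] _ _ assms]) auto

lemma left_pow_on_upd:
  assumes "i \<notin> A"
  shows "left_pow_on (\<beta>(i := m)) A Q = left_pow_on \<beta> A Q"
  using finite[of A] assms
  by (induction A rule: finite_induct) (auto simp: left_pow_on_empty left_pow_on_insert)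

lemma left_pow_UNIV: "ore_left_pow \<delta> \<beta> Q = left_pow_on \<beta> UNIV Q"
  by (simp add: left_pow_on_def ore_left_pow_def)

lemma left_pow_Suc: "ore_left_pow \<delta> (\<beta>(i := Suc (\<beta> i))) Q = ore_left \<delta> i (ore_left_pow \<delta> \<beta> Q)"
proof -
  have U: "UNIV = insert i (UNIV - {i})" by auto
  have "left_pow_on (\<beta>(i := Suc (\<beta> i))) (insert i (UNIV - {i})) Q
      = ore_left \<delta> i (left_pow_on \<beta> (insert i (UNIV - {i})) Q)"
    by (subst (1 2) left_pow_on_insert) (simp_all add: left_pow_on_upd)
  then show ?thesis by (simp add: left_pow_UNIV insert_absorb)
qed

lemma left_pow_0: "ore_left_pow \<delta> 0 Q = Q"
proof -
  have "left_pow_on 0 A Q = Q" for A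
    using finite[of A]
    by (induction A rule: finite_induct) (auto simp: left_pow_on_empty left_pow_on_insert)
  then show ?thesis by (simp add: left_pow_UNIV)
qed

lemma multi_index_induct [case_names zero Suc]:
  fixes \<beta> :: "'v \<Rightarrow> nat"
  assumes "P 0" "\<And>\<beta> i. P \<beta> \<Longrightarrow> P (\<beta>(i := Suc (\<beta> i)))"
  shows "P \<beta>"
proof (induction "\<Sum>i\<in>UNIV. \<beta> i" arbitrary: \<beta>)
  case 0
  then have "\<beta> = 0" by (auto simp: fun_eq_iff)
  with assms(1) show ?case by (simp only:)
next
  case (Suc n)
  then obtain i where i: "\<beta> i \<noteq> 0" by (metis Zero_not_Suc sum.neutral)
  define \<gamma> where "\<gamma> = \<beta>(i := \<beta> i - 1)"
  have \<beta>: "\<beta> = \<gamma>(i := Suc (\<gamma> i))" using i by (auto simp: \<gamma>_def)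
  have "(\<Sum>j\<in>UNIV. \<beta> j) = Suc (\<Sum>j\<in>UNIV. \<gamma> j)"
    unfolding \<beta> by (subst (1 2) sum.remove[of UNIV i]) auto
  then have "P \<gamma>" using Suc by simp
  then show ?case unfolding \<beta> by (rule assms(2))
qed

lemma left_pow_add: "ore_left_pow \<delta> \<beta> (P + Q) = ore_left_pow \<delta> \<beta> P + ore_left_pow \<delta> \<beta> Q"
  by (rule multi_index_induct) (simp_all only: left_pow_0 left_pow_Suc left_add)

lemma left_pow_one: "ore_left_pow \<delta> \<beta> (Poly_Mapping.single 0 1) = Poly_Mapping.single \<beta> 1"
  by (rule multi_index_induct)
     (simp_all only: left_pow_0 left_pow_Suc left_single \<delta>_1 single_zero add_0_right)

lemma mult_add_left: "ore_mult \<delta> (P + Q) R = ore_mult \<delta> P R + ore_mult \<delta> Q R"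
  unfolding ore_mult_def
  by (rule setsum_keys_plus_distrib) (simp_all add: ore_scale_0_left ore_scale_add_left)

lemma mult_add_right: "ore_mult \<delta> P (Q + R) = ore_mult \<delta> P Q + ore_mult \<delta> P R"
  by (simp add: ore_mult_def left_pow_add ore_scale_add_right sum.distrib)

lemma mult_single: "ore_mult \<delta> (Poly_Mapping.single \<beta> c) Q = ore_scale c (ore_left_pow \<delta> \<beta> Q)"
  by (cases "c = 0") (simp_all add: ore_mult_def ore_scale_0_left)

lemma mult_scale: "ore_mult \<delta> (ore_scale c P) Q = ore_scale c (ore_mult \<delta> P Q)"
  by (rule additive_eqI)
     (simp_all add: mult_add_left ore_scale_add_right ore_scale_single mult_single ore_scale_scale)

lemma mult_left: "ore_mult \<delta> (ore_left \<delta> i P) Q = ore_left \<delta> i (ore_mult \<delta> P Q)"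
  by (rule additive_eqI)
     (simp_all add: mult_add_left left_add left_single mult_single left_scale left_pow_Suc)

lemma mult_left_pow: "ore_mult \<delta> (ore_left_pow \<delta> \<beta> P) Q = ore_left_pow \<delta> \<beta> (ore_mult \<delta> P Q)"
  by (rule multi_index_induct) (simp_all only: left_pow_0 left_pow_Suc mult_left)

lemma mult_assoc: "ore_mult \<delta> (ore_mult \<delta> P Q) R = ore_mult \<delta> P (ore_mult \<delta> Q R)"
  by (rule additive_eqI)
     (simp_all add: mult_add_left mult_single mult_scale mult_left_pow)

lemma mult_one_left: "ore_mult \<delta> (Poly_Mapping.single 0 1) Q = Q"
  by (simp del: single_one add: mult_single left_pow_0 ore_scale_one)

lemma mult_one_right: "ore_mult \<delta> P (Poly_Mapping.single 0 1) = P"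
  by (rule additive_eqI[where G = "\<lambda>P. P"])
     (simp_all only: mult_add_left mult_single left_pow_one ore_scale_single mult_1_right)

end

interpretation cps: commuting_derivations cps_pd
  by standard (fact cps_pd_add cps_pd_mult cps_pd_commute)+

text \<open>
  In the homogenized ring the derivation is \<open>z \<partial>/\<partial>y\<close> on \<open>\<complex>{x,t}[z]\<close>, the polynomial variable
  being \<open>z\<close>.
\<close>

definition zpoly_pd :: "'v::finite \<Rightarrow> 'v cps poly \<Rightarrow> 'v cps poly" where
  "zpoly_pd i p = [:0, 1:] * map_poly (cps_pd i) p"

lemma coeff_map_cps_pd: "poly.coeff (map_poly (cps_pd i) p) k = cps_pd i (poly.coeff p k)"
  by (rule coeff_map_poly) (rule cps.\<delta>_0)

interpretation zpoly: commuting_derivations zpoly_pd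
proof
  fix i j and p q :: "'a cps poly"
  show "zpoly_pd i (p + q) = zpoly_pd i p + zpoly_pd i q"
    unfolding zpoly_pd_def distrib_left[symmetric]
    by (rule arg_cong[where f = "(*) _"], rule poly_eqI) (simp add: coeff_map_cps_pd cps_pd_add)
  have "map_poly (cps_pd i) (p * q) = map_poly (cps_pd i) p * q + p * map_poly (cps_pd i) q"
    by (rule poly_eqI)
       (simp add: coeff_map_cps_pd coeff_mult additive_sum(2)[where F = "cps_pd i", OF cps_pd_add] cps_pd_mult sum.distrib)
  then show "zpoly_pd i (p * q) = zpoly_pd i p * q + p * zpoly_pd i q"
    by (simp add: zpoly_pd_def algebra_simps)
  have z: "map_poly (cps_pd i) ([:0, 1:] * p) = [:0, 1:] * map_poly (cps_pd i) p"
    for i and p :: "'a cps poly"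
    by (rule poly_eqI) (auto simp: coeff_map_cps_pd coeff_pCons cps.\<delta>_0 split: nat.splits)
  have "map_poly (cps_pd i) (map_poly (cps_pd j) p) = map_poly (cps_pd j) (map_poly (cps_pd i) p)"
    by (rule poly_eqI) (simp add: coeff_map_cps_pd cps_pd_commute[of i j])
  then show "zpoly_pd i (zpoly_pd j p) = zpoly_pd j (zpoly_pd i p)"
    by (simp only: zpoly_pd_def z)
qed

text \<open>
  \<open>'v dop\<close> is the ring of differential operators over the convergent power series, with
  \<open>\<delta>\<^sub>y = \<partial>/\<partial>y\<close>; \<open>'v hdop\<close> is the homogenized ring, of operators \<open>\<Sum> c\<^bsub>\<beta>,k\<^esub> z\<^sup>k \<partial>\<^sup>\<beta>\<close>.  The lemmas
  \<open>dop_commutation\<close> and \<open>hdop_commutation\<close> below give the defining relations.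
\<close>

typedef 'v dop = "UNIV :: (('v::finite \<Rightarrow> nat) \<Rightarrow>\<^sub>0 'v cps) set"
  morphisms dop_expansion Abs_dop ..

typedef 'v hdop = "UNIV :: (('v::finite \<Rightarrow> nat) \<Rightarrow>\<^sub>0 'v cps poly) set"
  morphisms hdop_expansion Abs_hdop ..

setup_lifting type_definition_dop
setup_lifting type_definition_hdop

instantiation dop :: (finite) ring_1
begin
lift_definition zero_dop :: "'a dop" is 0 .
lift_definition one_dop :: "'a dop" is "Poly_Mapping.single 0 1" .
lift_definition plus_dop :: "'a dop \<Rightarrow> 'a dop \<Rightarrow> 'a dop" is "(+)" .
lift_definition uminus_dop :: "'a dop \<Rightarrow> 'a dop" is uminus .
lift_definition minus_dop :: "'a dop \<Rightarrow> 'a dop \<Rightarrow> 'a dop" is "(-)" .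
lift_definition times_dop :: "'a dop \<Rightarrow> 'a dop \<Rightarrow> 'a dop" is "ore_mult cps_pd" .
instance
proof
  show "(0 :: 'a dop) \<noteq> 1"
    by (simp add: zero_dop_def one_dop_def Abs_dop_inject)
next
  fix P Q R :: "'a dop"
  show "P + Q + R = P + (Q + R)" "P + Q = Q + P" "0 + P = P" "- P + P = 0" "P - Q = P + - Q"
    by (transfer; simp add: add_ac)+
  show "P * Q * R = P * (Q * R)" by transfer (rule cps.mult_assoc)
  show "1 * P = P" by transfer (rule cps.mult_one_left)
  show "P * 1 = P" by transfer (rule cps.mult_one_right)
  show "(P + Q) * R = P * R + Q * R" by transfer (rule cps.mult_add_left)
  show "P * (Q + R) = P * Q + P * R" by transfer (rule cps.mult_add_right)
qed
end

instantiation hdop :: (finite) ring_1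
begin
lift_definition zero_hdop :: "'a hdop" is 0 .
lift_definition one_hdop :: "'a hdop" is "Poly_Mapping.single 0 1" .
lift_definition plus_hdop :: "'a hdop \<Rightarrow> 'a hdop \<Rightarrow> 'a hdop" is "(+)" .
lift_definition uminus_hdop :: "'a hdop \<Rightarrow> 'a hdop" is uminus .
lift_definition minus_hdop :: "'a hdop \<Rightarrow> 'a hdop \<Rightarrow> 'a hdop" is "(-)" .
lift_definition times_hdop :: "'a hdop \<Rightarrow> 'a hdop \<Rightarrow> 'a hdop" is "ore_mult zpoly_pd" .
instance
proof
  show "(0 :: 'a hdop) \<noteq> 1"
    by (simp add: zero_hdop_def one_hdop_def Abs_hdop_inject)
next
  fix P Q R :: "'a hdop"
  show "P + Q + R = P + (Q + R)" "P + Q = Q + P" "0 + P = P" "- P + P = 0" "P - Q = P + - Q"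
    by (transfer; simp add: add_ac)+
  show "P * Q * R = P * (Q * R)" by transfer (rule zpoly.mult_assoc)
  show "1 * P = P" by transfer (rule zpoly.mult_one_left)
  show "P * 1 = P" by transfer (rule zpoly.mult_one_right)
  show "(P + Q) * R = P * R + Q * R" by transfer (rule zpoly.mult_add_left)
  show "P * (Q + R) = P * Q + P * R" by transfer (rule zpoly.mult_add_right)
qed
end

definition dop_const :: "'v::finite cps \<Rightarrow> 'v dop" where
  "dop_const c = Abs_dop (Poly_Mapping.single 0 c)"

definition dop_pd :: "'v::finite \<Rightarrow> 'v dop" where
  "dop_pd i = Abs_dop (Poly_Mapping.single (0(i := 1)) 1)"

definition hdop_const :: "'v::finite cps \<Rightarrow> 'v hdop" where
  "hdop_const c = Abs_hdop (Poly_Mapping.single 0 [:c:])"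

definition hdop_pd :: "'v::finite \<Rightarrow> 'v hdop" where
  "hdop_pd i = Abs_hdop (Poly_Mapping.single (0(i := 1)) 1)"

definition hdop_z :: "'v::finite hdop" where
  "hdop_z = Abs_hdop (Poly_Mapping.single 0 [:0, 1:])"

context commuting_derivations begin
lemma mult_const_left: "ore_mult \<delta> (Poly_Mapping.single 0 c) Q = ore_scale c Q"
  by (simp only: mult_single left_pow_0)

lemma mult_pd_left: "ore_mult \<delta> (Poly_Mapping.single (0(i := 1)) 1) Q = ore_left \<delta> i Q"
proof -
  have "0(i := 1) = (0 :: 'v \<Rightarrow> nat)(i := Suc ((0 :: 'v \<Rightarrow> nat) i))" by simp
  then show ?thesis by (simp only: mult_single ore_scale_one left_pow_Suc left_pow_0)
qed

lemma central_commute: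
  assumes "\<And>i. \<delta> i c = 0"
  shows "ore_mult \<delta> P (Poly_Mapping.single 0 c) = ore_mult \<delta> (Poly_Mapping.single 0 c) P"
proof (rule additive_eqI[where Q = P])
  fix \<beta> d
  have *: "ore_left_pow \<delta> \<beta> (Poly_Mapping.single 0 c) = Poly_Mapping.single \<beta> c"
    by (rule multi_index_induct)
       (simp_all only: left_pow_0 left_pow_Suc left_single assms single_zero add_0_right)
  show "ore_mult \<delta> (Poly_Mapping.single \<beta> d) (Poly_Mapping.single 0 c)
      = ore_mult \<delta> (Poly_Mapping.single 0 c) (Poly_Mapping.single \<beta> d)"
    by (simp only: mult_single left_pow_0 ore_scale_single * mult.commute[of c])
qed (simp_all only: mult_add_left mult_add_right)
end


lemma pd_swap:
  "Poly_Mapping.single ((0(j := 1 :: nat))(i := Suc ((0(j := 1)) i))) c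
    = Poly_Mapping.single ((0(i := 1))(j := Suc ((0(i := 1)) j))) c"
  by (rule arg_cong[where f = "\<lambda>\<beta>. Poly_Mapping.single \<beta> c"]) (auto simp: fun_eq_iff)

lemma dop_pd_commute: "dop_pd i * dop_pd j = dop_pd j * dop_pd i"
  unfolding dop_pd_def times_dop.abs_eq cps.mult_pd_left cps.left_single cps.\<delta>_1 single_zero add_0_right
  by (subst pd_swap) (rule refl)

lemma dop_commutation:
  "dop_pd i * dop_const c = dop_const c * dop_pd i + dop_const (cps_pd i c)"
  "dop_const (c * d) = dop_const c * dop_const d"
  "dop_const (c + d) = dop_const c + dop_const d"
  "dop_const 1 = 1"
  by (simp_all only: dop_pd_def dop_const_def times_dop.abs_eq plus_dop.abs_eq one_dop_def
      cps.mult_pd_left cps.mult_const_left cps.left_single ore_scale_single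
      cps.\<delta>_1 single_add single_zero add_0_right mult_1_right)
    (simp_all add: one_pCons)

lemma zpoly_pd_z: "zpoly_pd i [:0, 1:] = 0"
  by (rule poly_eqI) (auto simp: zpoly_pd_def coeff_map_cps_pd coeff_pCons cps.\<delta>_0 cps.\<delta>_1 split: nat.splits)

lemma zpoly_pd_const: "zpoly_pd i [:c:] = [:cps_pd i c:] * [:0, 1:]"
  by (rule poly_eqI) (auto simp: zpoly_pd_def coeff_map_cps_pd coeff_pCons cps.\<delta>_0 split: nat.splits)

lemma hdop_pd_commute: "hdop_pd i * hdop_pd j = hdop_pd j * hdop_pd i"
  unfolding hdop_pd_def times_hdop.abs_eq zpoly.mult_pd_left zpoly.left_single zpoly.\<delta>_1 single_zero add_0_right
  by (subst pd_swap) (rule refl)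

lemma hdop_commutation:
  "hdop_pd i * hdop_const c = hdop_const c * hdop_pd i + hdop_const (cps_pd i c) * hdop_z"
  "P * hdop_z = hdop_z * P"
  "hdop_const (c * d) = hdop_const c * hdop_const d"
  "hdop_const (c + d) = hdop_const c + hdop_const d"
  "hdop_const 1 = 1"
proof -
  show "P * hdop_z = hdop_z * P"
    unfolding hdop_z_def
    by (cases P) (simp only: times_hdop.abs_eq zpoly.central_commute[OF zpoly_pd_z])
  have e: "[:c * d:] = [:c:] * [:d:]" "[:c + d:] = [:c:] + [:d:]" "[:1:] = (1 :: 'a cps poly)" for c d :: "'a cps"
    by simp_all
  show
    "hdop_pd i * hdop_const c = hdop_const c * hdop_pd i + hdop_const (cps_pd i c) * hdop_z"
      "hdop_const (c * d) = hdop_const c * hdop_const d"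
    "hdop_const (c + d) = hdop_const c + hdop_const d"
    "hdop_const 1 = 1"
    by (simp_all only: hdop_pd_def hdop_const_def hdop_z_def times_hdop.abs_eq plus_hdop.abs_eq one_hdop_def
      zpoly.mult_pd_left zpoly.mult_const_left zpoly.left_single ore_scale_single zpoly_pd_const e
      zpoly.\<delta>_1 single_add single_zero add_0_right mult_1_right)
    (simp_all add: one_pCons)
qed

section \<open>Newton diagrams, orders and symbols\<close>

text \<open>
  An exponent \<open>(a, b, k)\<close> is that of \<open>y\<^sup>a \<partial>\<^sub>y\<^sup>b z\<^sup>k\<close>.  From \<open>V_form\<close> on the variables are indexed by
  \<open>'n + 'p\<close>: \<open>Inl i\<close> is \<open>x\<^sub>i\<close> and \<open>Inr j\<close> is \<open>t\<^sub>j\<close>, so \<open>a = (\<alpha>, \<mu>)\<close> and \<open>b = (\<beta>, \<nu>)\<close>.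
\<close>

type_synonym 'v expo = "('v \<Rightarrow> nat) \<times> ('v \<Rightarrow> nat) \<times> nat"

definition dop_diagram :: "'v::finite dop \<Rightarrow> 'v expo set" where
  "dop_diagram P = {(a, b, 0) |a b. cps_nth (Poly_Mapping.lookup (dop_expansion P) b) a \<noteq> 0}"

definition hdop_coeff :: "'v::finite hdop \<Rightarrow> 'v expo \<Rightarrow> complex" where
  "hdop_coeff P = (\<lambda>(a, b, k). cps_nth (poly.coeff (Poly_Mapping.lookup (hdop_expansion P) b) k) a)"

definition hdop_diagram :: "'v::finite hdop \<Rightarrow> 'v expo set" where
  "hdop_diagram P = {e. hdop_coeff P e \<noteq> 0}"

definition hdop_restrict :: "'v::finite expo set \<Rightarrow> 'v hdop \<Rightarrow> 'v hdop" where
  "hdop_restrict E P = Abs_hdop (\<Sum>b\<in>Poly_Mapping.keys (hdop_expansion P).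
     Poly_Mapping.single b (let q = Poly_Mapping.lookup (hdop_expansion P) b in
       \<Sum>k\<le>degree q. monom (cps_restrict {a. (a, b, k) \<in> E} (poly.coeff q k)) k))"

lemma cps_restrict_0: "cps_restrict A 0 = 0"
  by (rule cps_eqI) (simp add: cps_restrict.rep_eq zero_cps.rep_eq)

lemma hdop_coeff_restrict:
  "hdop_coeff (hdop_restrict E P) e = (if e \<in> E then hdop_coeff P e else 0)"
proof -
  obtain a b k where e: "e = (a, b, k)" by (cases e)
  define q where "q = Poly_Mapping.lookup (hdop_expansion P) b"
  have "Poly_Mapping.lookup (hdop_expansion (hdop_restrict E P)) b
      = (\<Sum>k\<le>degree q. monom (cps_restrict {a. (a, b, k) \<in> E} (poly.coeff q k)) k)"
    by (simp add: hdop_restrict_def Abs_hdop_inverse lookup_sum lookup_single when_def q_def[symmetric]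
        sum.delta Let_def) (auto simp: in_keys_iff q_def cps_restrict_0)
  then have "poly.coeff (Poly_Mapping.lookup (hdop_expansion (hdop_restrict E P)) b) k
      = cps_restrict {a. (a, b, k) \<in> E} (poly.coeff q k)"
    by (auto simp: coeff_sum sum.delta coeff_eq_0 cps_restrict_0)
  then show ?thesis
    by (simp add: hdop_coeff_def e cps_restrict.rep_eq q_def)
qed

definition V_form :: "'p \<Rightarrow> ('n + 'p) expo \<Rightarrow> real" where
  "V_form j = (\<lambda>(a, b, k). real (b (Inr j)) - real (a (Inr j)))"

text \<open>
  The form \<open>l\<^sub>1 V\<^sub>1 + \<dots> + l\<^sub>p V\<^sub>p\<close> is represented by its coefficient vector; \<open>V\<^sub>j\<close> is \<open>axis j 1\<close>.
\<close>

definition lin_form :: "real^'p \<Rightarrow> ('n + 'p::finite) expo \<Rightarrow> real" where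
  "lin_form L e = (\<Sum>j\<in>UNIV. L $ j * V_form j e)"

definition U_V :: "(real^'p) set" where
  "U_V = {L. \<forall>j. 0 \<le> L $ j}"

text \<open>
  The supremum is \<open>-\<infinity>\<close> for the zero operator and a maximum otherwise
  (\<open>ord_diagram_attained\<close>, \<open>finite_dop_diagram\<close>, \<open>finite_hdop_diagram\<close>).
\<close>

definition ord_diagram :: "real^'p \<Rightarrow> ('n + 'p::finite) expo set \<Rightarrow> ereal" where
  "ord_diagram L N = (SUP e\<in>N. ereal (lin_form L e))"

definition dop_ord :: "real^'p \<Rightarrow> ('n::finite + 'p::finite) dop \<Rightarrow> ereal" where
  "dop_ord L P = ord_diagram L (dop_diagram P)"

definition hdop_ord :: "real^'p \<Rightarrow> ('n::finite + 'p::finite) hdop \<Rightarrow> ereal" where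
  "hdop_ord L P = ord_diagram L (hdop_diagram P)"

lemma ord_diagram_attained:
  fixes N :: "('n + 'p::finite) expo set"
  assumes L: "L \<in> U_V" and "N \<noteq> {}" and fin: "finite ((\<lambda>(a, b, k). b) ` N)"
  shows "\<exists>e\<in>N. ord_diagram L N = ereal (lin_form L e)"
proof -
  have L0: "0 \<le> L $ j" for j using L by (simp add: U_V_def)
  obtain e0 where e0: "e0 \<in> N" using \<open>N \<noteq> {}\<close> by blast
  define B where "B = (\<lambda>(a, b, k). b) ` N"
  define c where "c b = (\<Sum>j\<in>UNIV. L $ j * real (b (Inr j)))" for b :: "'n + 'p \<Rightarrow> nat"
  have form: "lin_form L (a, b, k) = c b - c a" for a b :: "'n + 'p \<Rightarrow> nat" and k
    by (simp add: lin_form_def V_form_def c_def right_diff_distrib sum_subtractf)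
  define K where "K = Max (c ` B) - lin_form L e0"
  have K: "c a \<le> K" if "(a, b, k) \<in> N" "lin_form L e0 \<le> lin_form L (a, b, k)" for a b k
  proof -
    have "b \<in> B" unfolding B_def by (rule image_eqI[OF _ that(1)]) simp
    then have "c b \<le> Max (c ` B)"
      using fin by (simp add: B_def)
    then show ?thesis using that(2) by (simp add: K_def form)
  qed
  define J where "J = {j. 0 < L $ j}"
  obtain m :: nat where m: "\<And>j. j \<in> J \<Longrightarrow> K / L $ j \<le> real m"
  proof -
    obtain m :: nat where m: "Max (insert 0 ((\<lambda>j. K / L $ j) ` J)) \<le> real m"
      using real_arch_simple by blast
    show ?thesis by (rule that[of m], rule order.trans[OF Max_ge m]) auto
  qed
  have cJ: "c b = (\<Sum>j\<in>J. L $ j * real (b (Inr j)))" for b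
    unfolding c_def by (rule sum.mono_neutral_right) (use L0 in \<open>auto simp: J_def less_le\<close>)
  define X where "X = {e \<in> N. lin_form L e0 \<le> lin_form L e}"
  have "lin_form L ` X \<subseteq> (\<lambda>(b, f). c b - (\<Sum>j\<in>J. L $ j * real (f j))) ` (B \<times> (\<Pi>\<^sub>E j\<in>J. {..m}))"
  proof (clarsimp simp: X_def)
    fix a b k assume N: "(a, b, k) \<in> N" and le: "lin_form L e0 \<le> lin_form L (a, b, k)"
    have am: "a (Inr j) \<le> m" if "j \<in> J" for j
    proof -
      have "L $ j * real (a (Inr j)) \<le> c a"
        unfolding cJ using that L0 by (intro member_le_sum) auto
      then have "L $ j * real (a (Inr j)) \<le> K" using K[OF N le] by linarith
      then have "real (a (Inr j)) \<le> K / L $ j"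
        using that by (simp add: J_def field_simps)
      then show ?thesis using m[OF that] by linarith
    qed
    have "b \<in> B" unfolding B_def by (rule image_eqI[OF _ N]) simp
    then show "lin_form L (a, b, k)
        \<in> (\<lambda>(b, f). c b - (\<Sum>j\<in>J. L $ j * real (f j))) ` (B \<times> (\<Pi>\<^sub>E j\<in>J. {..m}))"
      by (intro image_eqI[of _ _ "(b, restrict (\<lambda>j. a (Inr j)) J)"])
         (auto simp: form cJ[of a] am)
  qed
  then have finX: "finite (lin_form L ` X)"
    by (rule finite_subset) (use fin in \<open>simp add: B_def finite_PiE\<close>)
  have "e0 \<in> X" using e0 by (simp add: X_def)
  then have "X \<noteq> {}" by blast
  then have "Max (lin_form L ` X) \<in> lin_form L ` X" using finX by (intro Max_in) auto
  then obtain e where e: "e \<in> X" "lin_form L e = Max (lin_form L ` X)" by force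
  have "lin_form L e' \<le> lin_form L e" if "e' \<in> N" for e'
  proof (cases "lin_form L e0 \<le> lin_form L e'")
    case True
    then show ?thesis unfolding e(2) using finX that by (intro Max_ge) (auto simp: X_def)
  next
    case False
    then show ?thesis using e(1) by (simp add: X_def)
  qed
  moreover have "e \<in> N" using e(1) by (simp add: X_def)
  ultimately show ?thesis
    unfolding ord_diagram_def by (intro bexI[of _ e] antisym SUP_least SUP_upper) auto
qed

lemma finite_dop_diagram: "finite ((\<lambda>(a, b, k). b) ` dop_diagram P)"
proof (rule finite_subset)
  show "(\<lambda>(a, b, k). b) ` dop_diagram P \<subseteq> Poly_Mapping.keys (dop_expansion P)"
    by (auto simp: dop_diagram_def in_keys_iff zero_cps.rep_eq)
qed simp

lemma finite_hdop_diagram: "finite ((\<lambda>(a, b, k). b) ` hdop_diagram P)"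
proof (rule finite_subset)
  show "(\<lambda>(a, b, k). b) ` hdop_diagram P \<subseteq> Poly_Mapping.keys (hdop_expansion P)"
    by (auto simp: hdop_diagram_def hdop_coeff_def in_keys_iff zero_cps.rep_eq)
qed simp

definition hdop_symbol :: "real^'p \<Rightarrow> ('n::finite + 'p::finite) hdop \<Rightarrow> ('n + 'p) hdop" where
  "hdop_symbol L P = hdop_restrict {e. ereal (lin_form L e) = hdop_ord L P} P"

definition left_ideal :: "'a::ring_1 set \<Rightarrow> bool" where
  "left_ideal I \<longleftrightarrow> 0 \<in> I \<and> (\<forall>P\<in>I. \<forall>Q\<in>I. P + Q \<in> I) \<and> (\<forall>A. \<forall>P\<in>I. A * P \<in> I)"

text \<open>
  The left ideal generated by \<open>S\<close> in the subring \<open>R\<close>.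
\<close>

definition left_ideal_gen :: "'a::ring_1 set \<Rightarrow> 'a set \<Rightarrow> 'a set" where
  "left_ideal_gen R S = {\<Sum>P\<in>F. A P * P |F A. finite F \<and> F \<subseteq> S \<and> (\<forall>P\<in>F. A P \<in> R)}"

definition dop_degree :: "'v::finite dop \<Rightarrow> nat" where
  "dop_degree P = Max ((\<lambda>b. \<Sum>i\<in>UNIV. b i) ` Poly_Mapping.keys (dop_expansion P))"

definition homogenize :: "'v::finite dop \<Rightarrow> 'v hdop" where
  "homogenize P = Abs_hdop (\<Sum>b\<in>Poly_Mapping.keys (dop_expansion P).
     Poly_Mapping.single b
       (monom (Poly_Mapping.lookup (dop_expansion P) b) (dop_degree P - (\<Sum>i\<in>UNIV. b i))))"

definition homogenized_ideal :: "'v::finite dop set \<Rightarrow> 'v hdop set" where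
  "homogenized_ideal I = left_ideal_gen UNIV (homogenize ` I)"

text \<open>
  Operators polynomial in the \<open>t\<^sub>j\<close> with \<open>l\<^sub>j > 0\<close>.
\<close>

definition gr_ring :: "real^'p \<Rightarrow> ('n::finite + 'p::finite) hdop set" where
  "gr_ring L = {P. \<forall>j. 0 < L $ j \<longrightarrow> (\<exists>m. \<forall>(a, b, k)\<in>hdop_diagram P. a (Inr j) \<le> m)}"

definition gr_ideal :: "real^'p \<Rightarrow> ('n::finite + 'p::finite) hdop set \<Rightarrow> ('n + 'p) hdop set" where
  "gr_ideal L J = left_ideal_gen (gr_ring L) (hdop_symbol L ` J)"

definition groebner_equiv :: "('n::finite + 'p::finite) hdop set \<Rightarrow> ((real^'p) \<times> (real^'p)) set" where
  "groebner_equiv J = {(L, L'). L \<in> U_V \<and> L' \<in> U_V \<and>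
     (gr_ring L :: ('n + 'p) hdop set) = gr_ring L' \<and> gr_ideal L J = gr_ideal L' J}"

definition V_groebner_fan :: "('n::finite + 'p::finite) hdop set \<Rightarrow> (real^'p) set set" where
  "V_groebner_fan J = U_V // groebner_equiv J"

definition primitive :: "real^'p \<Rightarrow> bool" where
  "primitive L \<longleftrightarrow> (\<exists>v :: int^'p. (\<forall>j. L $ j = real_of_int (v $ j)) \<and>
     (\<forall>d. (\<forall>j. d dvd v $ j) \<longrightarrow> is_unit d))"

definition ray :: "'a::real_vector \<Rightarrow> 'a set" where
  "ray L = {r *\<^sub>R L |r. 0 \<le> r}"

text \<open>
  The primitive generators of the 1-skeleton of the closure of \<open>\<sigma>\<close>.  Every minimal finite set of
  primitive vectors generating this closure equals this set: \<open>skeleton_generators_minimal\<close>.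
\<close>

definition skeleton_generators :: "(real^'p) set \<Rightarrow> (real^'p) set" where
  "skeleton_generators \<sigma> = {L. primitive L \<and> ray L face_of closure \<sigma>}"

definition primitive_generating :: "(real^'p) set \<Rightarrow> (real^'p) set \<Rightarrow> bool" where
  "primitive_generating \<sigma> S \<longleftrightarrow> finite S \<and> (\<forall>L\<in>S. primitive L) \<and>
     closure \<sigma> = {\<Sum>L\<in>S. r L *\<^sub>R L |r. \<forall>L\<in>S. 0 \<le> r L}"

lemma primitive_proportional:
  assumes "primitive L" "primitive L'" "L' = c *\<^sub>R L" "0 \<le> c"
  shows "L' = L"
proof -
  obtain v :: "int^'a" where v: "\<And>j. L $ j = real_of_int (v $ j)" "\<And>d. (\<forall>j. d dvd v $ j) \<Longrightarrow> is_unit d"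
    using assms(1) unfolding primitive_def by blast
  obtain v' :: "int^'a" where v': "\<And>j. L' $ j = real_of_int (v' $ j)" "\<And>d. (\<forall>j. d dvd v' $ j) \<Longrightarrow> is_unit d"
    using assms(2) unfolding primitive_def by blast
  have g: "Gcd (range (($) v)) = 1" if "\<And>d. (\<forall>j. d dvd v $ j) \<Longrightarrow> is_unit d" for v :: "int^'a"
    using that[of "Gcd (range (($) v))"] by (auto simp: Gcd_dvd)
  obtain j where j: "v $ j \<noteq> 0" using v(2)[of 0] by auto
  have eq: "v' $ i * v $ j = v $ i * v' $ j" for i
  proof -
    have "real_of_int (v' $ i) = c * v $ i" for i using assms(3) v(1) v'(1) by (metis vector_scaleR_component real_scaleR_def)
    then have "real_of_int (v' $ i * v $ j) = real_of_int (v $ i * v' $ j)" by simp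
    then show ?thesis by (simp only: of_int_eq_iff)
  qed
  have "\<bar>v $ j\<bar> = \<bar>v' $ j\<bar>"
  proof -
    have "Gcd (range (\<lambda>i. v $ j * v' $ i)) = \<bar>v $ j\<bar> * Gcd (range (($) v'))"
      using Gcd_mult[of "v $ j" "range (($) v')"] by (simp add: image_image abs_mult normalize_mult)
    moreover have "Gcd (range (\<lambda>i. v' $ j * v $ i)) = \<bar>v' $ j\<bar> * Gcd (range (($) v))"
      using Gcd_mult[of "v' $ j" "range (($) v)"] by (simp add: image_image abs_mult normalize_mult)
    ultimately show ?thesis
      using eq g[OF v(2)] g[OF v'(2)] by (simp add: mult.commute)
  qed
  moreover have "real_of_int (v' $ j) = c * v $ j"
    using assms(3) v(1) v'(1) by (metis vector_scaleR_component real_scaleR_def)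
  then have "0 \<le> v' $ j \<longleftrightarrow> 0 \<le> v $ j \<or> v' $ j = 0"
    by (smt (verit) assms(4) mult_nonneg_nonneg mult_nonneg_nonpos of_int_0_le_iff of_int_le_0_iff)
  ultimately have "v $ j = v' $ j" using j by linarith
  then have "v' $ i = v $ i" for i using eq[of i] j by simp
  then show ?thesis by (simp add: vec_eq_iff v(1) v'(1))
qed

lemma primitive_nonzero: "primitive L \<Longrightarrow> L \<noteq> 0"
  unfolding primitive_def by (metis dvd_0_right of_int_eq_0_iff not_is_unit_0 zero_index)

lemma closed_U_V: "closed (U_V :: (real^'p) set)"
  unfolding U_V_def by (intro closed_Collect_all closed_Collect_le continuous_intros)

lemma skeleton_generators_minimal:
  assumes sub: "\<sigma> \<subseteq> U_V" and gen: "primitive_generating \<sigma> S"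
    and min: "\<And>T. T \<subset> S \<Longrightarrow> \<not> primitive_generating \<sigma> T"
  shows "skeleton_generators \<sigma> = S"
proof -
  define C where "C T = {\<Sum>L\<in>T. r L *\<^sub>R L |r. \<forall>L\<in>T. 0 \<le> r L}" for T :: "(real^'a) set"
  have S: "finite S" "\<And>L. L \<in> S \<Longrightarrow> primitive L" "closure \<sigma> = C S"
    using gen by (auto simp: primitive_generating_def C_def)
  have CI: "(\<Sum>L\<in>T. r L *\<^sub>R L) \<in> C T" if "\<And>L. L \<in> T \<Longrightarrow> 0 \<le> r L" for T r
    using that by (auto simp: C_def)
  have CU: "C S \<subseteq> U_V"
    using closure_minimal[OF sub closed_U_V] S(3) by simp
  have scaled: "r *\<^sub>R L \<in> C S" if "L \<in> S" "0 \<le> r" for L r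
  proof -
    have "(\<Sum>L'\<in>S. (if L' = L then r else 0) *\<^sub>R L') = (\<Sum>L'\<in>S. if L' = L then r *\<^sub>R L' else 0)"
      by (intro sum.cong) auto
    also have "\<dots> = r *\<^sub>R L" using that(1) S(1) by (simp add: sum.delta)
    finally show ?thesis using CI[of S "\<lambda>L'. if L' = L then r else 0"] that(2) by simp
  qed
  have SU: "L \<in> U_V" if "L \<in> S" for L
    using scaled[OF that, of 1] CU by auto
  have comp0: "0 \<le> L $ j" if "L \<in> S" for L j
    using SU[OF that] by (simp add: U_V_def)
  show ?thesis
  proof (intro equalityI subsetI)
    fix L assume "L \<in> skeleton_generators \<sigma>"
    then have L: "primitive L" "ray L face_of C S"
      by (auto simp: skeleton_generators_def S(3))
    have LL: "L \<in> ray L" unfolding ray_def by (auto intro: exI[of _ 1])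
    then have "L \<in> C S" using L(2) face_of_imp_subset by blast
    then obtain r where r: "L = (\<Sum>L\<in>S. r L *\<^sub>R L)" "\<And>L. L \<in> S \<Longrightarrow> 0 \<le> r L"
      by (auto simp: C_def)
    have "\<exists>L1\<in>S. r L1 \<noteq> 0"
    proof (rule ccontr)
      assume "\<not> ?thesis"
      then have "L = 0" unfolding r(1) by simp
      then show False using primitive_nonzero[OF L(1)] by simp
    qed
    then obtain L1 where L1: "L1 \<in> S" "r L1 \<noteq> 0" by blast
    then have pos: "0 < r L1" using r(2)[of L1] by linarith
    define y where "y = (\<Sum>L\<in>S - {L1}. r L *\<^sub>R L)"
    have Ly: "L = r L1 *\<^sub>R L1 + y"
      unfolding y_def r(1) using L1(1) S(1) by (subst sum.remove[of S L1]) auto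
    have y: "2 *\<^sub>R y \<in> C S"
    proof -
      have "2 *\<^sub>R y = (\<Sum>L\<in>S - {L1}. (if L = L1 then 0 else 2 * r L) *\<^sub>R L)"
        unfolding y_def scaleR_sum_right by (intro sum.cong) auto
      also have "\<dots> = (\<Sum>L\<in>S. (if L = L1 then 0 else 2 * r L) *\<^sub>R L)"
        by (rule sum.mono_neutral_left) (use S(1) in auto)
      finally show ?thesis using CI[of S "\<lambda>L. if L = L1 then 0 else 2 * r L"] r(2) by simp
    qed
    have "\<exists>c\<ge>0. L1 = c *\<^sub>R L"
    proof (cases "(2 * r L1) *\<^sub>R L1 = 2 *\<^sub>R y")
      case True
      then have "2 *\<^sub>R (r L1 *\<^sub>R L1) = 2 *\<^sub>R y" by (simp only: scaleR_scaleR)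
      then have "y = r L1 *\<^sub>R L1" by (simp only: scaleR_cancel_left) simp
      then have "L = (2 * r L1) *\<^sub>R L1"
        using Ly by (simp only: scaleR_2 scaleR_scaleR[symmetric])
      then show ?thesis using pos by (intro exI[of _ "1 / (2 * r L1)"]) simp
    next
      case False
      have "L = midpoint ((2 * r L1) *\<^sub>R L1) (2 *\<^sub>R y)"
        by (simp add: Ly midpoint_def scaleR_add_right)
      then have "L \<in> open_segment ((2 * r L1) *\<^sub>R L1) (2 *\<^sub>R y)"
        using False by simp
      then have "(2 * r L1) *\<^sub>R L1 \<in> ray L"
        using face_ofD[OF L(2)] scaled[OF L1(1), of "2 * r L1"] y LL pos by auto
      then obtain s where "0 \<le> s" "(2 * r L1) *\<^sub>R L1 = s *\<^sub>R L" by (auto simp: ray_def)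
      then have "(1 / (2 * r L1)) *\<^sub>R (2 * r L1) *\<^sub>R L1 = (1 / (2 * r L1)) *\<^sub>R s *\<^sub>R L" by simp
      then have "L1 = (s / (2 * r L1)) *\<^sub>R L" using pos by simp
      then show ?thesis using \<open>0 \<le> s\<close> pos by (intro exI[of _ "s / (2 * r L1)"]) simp
    qed
    then have "L1 = L" using primitive_proportional[OF L(1) S(2)[OF L1(1)]] by blast
    then show "L \<in> S" using L1(1) by simp
  next
    fix L assume L: "L \<in> S"
    have nz: "L' \<noteq> 0" if "L' \<in> S" for L' using primitive_nonzero[OF S(2)[OF that]] .
    have indep: "\<not> (\<exists>t. (\<forall>L'\<in>S - {L}. 0 \<le> t L') \<and> L = (\<Sum>L'\<in>S - {L}. t L' *\<^sub>R L'))"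
    proof
      assume "\<exists>t. (\<forall>L'\<in>S - {L}. 0 \<le> t L') \<and> L = (\<Sum>L'\<in>S - {L}. t L' *\<^sub>R L')"
      then obtain t where t: "\<And>L'. L' \<in> S - {L} \<Longrightarrow> 0 \<le> t L'" "L = (\<Sum>L'\<in>S - {L}. t L' *\<^sub>R L')"
        by blast
      have "C S = C (S - {L})"
      proof (intro equalityI subsetI)
        fix x assume "x \<in> C S"
        then obtain r where r: "x = (\<Sum>L\<in>S. r L *\<^sub>R L)" "\<And>L. L \<in> S \<Longrightarrow> 0 \<le> r L"
          by (auto simp: C_def)
        have "x = r L *\<^sub>R L + (\<Sum>L'\<in>S - {L}. r L' *\<^sub>R L')"
          unfolding r(1) using L S(1) by (subst sum.remove[of S L]) auto
        also have "r L *\<^sub>R L = r L *\<^sub>R (\<Sum>L'\<in>S - {L}. t L' *\<^sub>R L')" using t(2) by simp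
        also have "\<dots> + (\<Sum>L'\<in>S - {L}. r L' *\<^sub>R L') = (\<Sum>L'\<in>S - {L}. (r L * t L' + r L') *\<^sub>R L')"
          by (simp add: scaleR_sum_right scaleR_add_left sum.distrib)
        finally show "x \<in> C (S - {L})"
          using CI[of "S - {L}" "\<lambda>L'. r L * t L' + r L'"] r(2) t(1) L by auto
      next
        fix x assume "x \<in> C (S - {L})"
        then obtain r where r: "x = (\<Sum>L'\<in>S - {L}. r L' *\<^sub>R L')" "\<And>L'. L' \<in> S - {L} \<Longrightarrow> 0 \<le> r L'"
          by (auto simp: C_def)
        have "x = (\<Sum>L'\<in>S - {L}. (if L' = L then 0 else r L') *\<^sub>R L')"
          unfolding r(1) by (intro sum.cong) auto
        also have "\<dots> = (\<Sum>L'\<in>S. (if L' = L then 0 else r L') *\<^sub>R L')"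
          by (rule sum.mono_neutral_left) (use S(1) in auto)
        finally show "x \<in> C S"
          using CI[of S "\<lambda>L'. if L' = L then 0 else r L'"] r(2) by auto
      qed
      then have "primitive_generating \<sigma> (S - {L})"
        using S by (simp add: primitive_generating_def C_def)
      then show False using min[of "S - {L}"] L by blast
    qed
    have "ray L face_of C S"
      unfolding face_of_def
    proof (intro conjI ballI impI)
      show "ray L \<subseteq> C S" using scaled[OF L] by (auto simp: ray_def)
      show "convex (ray L)"
      proof (rule convexI)
        fix x y and u v :: real assume "x \<in> ray L" "y \<in> ray L" "0 \<le> u" "0 \<le> v"
        then obtain a b where "0 \<le> a" "0 \<le> b" "x = a *\<^sub>R L" "y = b *\<^sub>R L" by (auto simp: ray_def)
        then show "u *\<^sub>R x + v *\<^sub>R y \<in> ray L"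
          using \<open>0 \<le> u\<close> \<open>0 \<le> v\<close> unfolding ray_def
          by (intro CollectI exI[of _ "u * a + v * b"]) (simp add: scaleR_add_left)
      qed
      fix x y w
      assume xy: "x \<in> C S" "y \<in> C S" and w: "w \<in> ray L" "w \<in> open_segment x y"
      obtain r where r: "x = (\<Sum>L\<in>S. r L *\<^sub>R L)" "\<And>L. L \<in> S \<Longrightarrow> 0 \<le> r L"
        using xy(1) by (auto simp: C_def)
      obtain s where s: "y = (\<Sum>L\<in>S. s L *\<^sub>R L)" "\<And>L. L \<in> S \<Longrightarrow> 0 \<le> s L"
        using xy(2) by (auto simp: C_def)
      obtain c where c: "0 \<le> c" "w = c *\<^sub>R L" using w(1) by (auto simp: ray_def)
      obtain u where u: "0 < u" "u < 1" "w = (1 - u) *\<^sub>R x + u *\<^sub>R y"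
        using w(2) by (auto simp: in_segment)
      define t where "t L' = (1 - u) * r L' + u * s L'" for L'
      have t0: "0 \<le> t L'" if "L' \<in> S" for L' using u(1,2) r(2)[OF that] s(2)[OF that] by (simp add: t_def)
      have "c *\<^sub>R L = (\<Sum>L'\<in>S. t L' *\<^sub>R L')"
        using c(2) u(3) by (simp add: r(1) s(1) t_def scaleR_sum_right scaleR_add_left sum.distrib)
      also have "\<dots> = t L *\<^sub>R L + (\<Sum>L'\<in>S - {L}. t L' *\<^sub>R L')"
        using L S(1) by (subst sum.remove[of S L]) auto
      finally have eq: "(c - t L) *\<^sub>R L = (\<Sum>L'\<in>S - {L}. t L' *\<^sub>R L')"
        by (simp add: scaleR_diff_left)
      have "c \<le> t L"
      proof (rule ccontr)
        assume "\<not> c \<le> t L"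
        then have d: "0 < c - t L" by simp
        have "L = (1 / (c - t L)) *\<^sub>R ((c - t L) *\<^sub>R L)" using d by simp
        also have "\<dots> = (\<Sum>L'\<in>S - {L}. (t L' / (c - t L)) *\<^sub>R L')"
          unfolding eq scaleR_sum_right by (simp add: divide_inverse mult.commute)
        finally have "L = (\<Sum>L'\<in>S - {L}. (t L' / (c - t L)) *\<^sub>R L')" .
        moreover have "\<forall>L'\<in>S - {L}. 0 \<le> t L' / (c - t L)" using t0 d by auto
        ultimately have "\<exists>t. (\<forall>L'\<in>S - {L}. 0 \<le> t L') \<and> L = (\<Sum>L'\<in>S - {L}. t L' *\<^sub>R L')"
          by (intro exI[of _ "\<lambda>L'. t L' / (c - t L)"] conjI)
        then show False using indep by simp
      qed
      have tz: "t L' = 0" if "L' \<in> S - {L}" for L'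
      proof -
        have "L' \<noteq> 0" using nz that by blast
        then obtain j where j: "L' $ j \<noteq> 0" by (auto simp: vec_eq_iff)
        have "(\<Sum>L'\<in>S - {L}. t L' * L' $ j) = (c - t L) * L $ j"
          using arg_cong[OF eq, of "\<lambda>v. v $ j"] by simp
        also have "\<dots> \<le> 0" using \<open>c \<le> t L\<close> comp0[OF L] by (simp add: mult_nonpos_nonneg)
        finally have "(\<Sum>L'\<in>S - {L}. t L' * L' $ j) \<le> 0" .
        moreover have "t L' * L' $ j \<le> (\<Sum>L'\<in>S - {L}. t L' * L' $ j)"
          using that S(1) t0 comp0 by (intro member_le_sum) auto
        moreover have "0 \<le> t L' * L' $ j" using t0 comp0 that by simp
        ultimately have "t L' * L' $ j = 0" by linarith
        then show ?thesis using j by simp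
      qed
      have rs0: "r L' = 0" "s L' = 0" if "L' \<in> S - {L}" for L'
      proof -
        have "0 \<le> r L'" "0 \<le> s L'" using r(2) s(2) that by auto
        then have "0 \<le> (1 - u) * r L'" "0 \<le> u * s L'" using u by auto
        moreover have "(1 - u) * r L' + u * s L' = 0" using tz[OF that] by (simp only: t_def)
        ultimately have "(1 - u) * r L' = 0" "u * s L' = 0" by linarith+
        then show "r L' = 0" "s L' = 0" using u by auto
      qed
      have "x = r L *\<^sub>R L" unfolding r(1) using L S(1) rs0 by (subst sum.remove[of S L]) auto
      then show "x \<in> ray L" using r(2)[OF L] by (auto simp: ray_def)
      have "y = s L *\<^sub>R L" unfolding s(1) using L S(1) rs0 by (subst sum.remove[of S L]) auto
      then show "y \<in> ray L" using s(2)[OF L] by (auto simp: ray_def)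
    qed
    then show "L \<in> skeleton_generators \<sigma>"
      using S(2)[OF L] by (simp add: skeleton_generators_def S(3))
  qed
qed

text \<open>
  The module \<open>M = D/I\<close> and its subgroups are sets of residue classes modulo the left ideal \<open>I\<close>;
  \<open>module_sum\<close> is the sum of a possibly infinite family of subgroups \<open>N k\<close>, \<open>k \<in> K\<close>.
\<close>

definition residue_class :: "'a::ring_1 set \<Rightarrow> 'a \<Rightarrow> 'a set" where
  "residue_class I P = {P + Q |Q. Q \<in> I}"

definition quotient_module :: "'a::ring_1 set \<Rightarrow> 'a set set" where
  "quotient_module I = range (residue_class I)"

definition module_sum :: "'a::ring_1 set \<Rightarrow> 'k set \<Rightarrow> ('k \<Rightarrow> 'a set set) \<Rightarrow> 'a set set" where
  "module_sum I K N =
     {residue_class I (\<Sum>k\<in>F. P k) |F P. finite F \<and> F \<subseteq> K \<and> (\<forall>k\<in>F. residue_class I (P k) \<in> N k)}"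

definition V_filtration :: "('n::finite + 'p::finite) dop set \<Rightarrow> int^'p \<Rightarrow> ('n + 'p) dop set set" where
  "V_filtration I w = residue_class I ` {P. \<forall>j. dop_ord (axis j 1) P \<le> ereal (real_of_int (w $ j))}"

definition VL_filtration ::
    "('n::finite + 'p::finite) dop set \<Rightarrow> real^'p \<Rightarrow> real \<Rightarrow> ('n + 'p) dop set set" where
  "VL_filtration I L k = residue_class I ` {P. dop_ord L P \<le> ereal k}"

definition lin_form_at :: "real^'p \<Rightarrow> int^'p \<Rightarrow> real" where
  "lin_form_at L w = (\<Sum>j\<in>UNIV. L $ j * real_of_int (w $ j))"

definition cone_filtration ::
    "('n::finite + 'p::finite) dop set \<Rightarrow> (real^'p) set \<Rightarrow> int^'p \<Rightarrow> ('n + 'p) dop set set" where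
  "cone_filtration I \<sigma> w = module_sum I
     {w'. \<forall>L\<in>skeleton_generators \<sigma>. lin_form_at L w' \<le> lin_form_at L w} (V_filtration I)"

end

theory Submission
  imports Defs "HOL-Computational_Algebra.Primes"
begin

text \<open>
  Write \<open>J = h(I)\<close>.  In each degree, \<open>J\<close> is a submodule of a free module of finite rank over the
  convergent power series.  There Grauert's division theorem, for the order that compares the weight
  \<open>L\<close> first and then a generic linear form, splits every operator into an element of \<open>J\<close> and a
  remainder that has no exponent in the set of leading exponents of \<open>J\<close> and no larger \<open>L\<close>-order.
  The leading exponents depend only on \<open>gr\<^sup>L(J)\<close>, so they and the remainder are the same for all
  \<open>L \<in> \<sigma>\<close>, and by continuity the order bound holds on the closure of \<open>\<sigma>\<close>.  If the class of \<open>P\<close>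
  has a representative of \<open>L\<close>-order at most \<open>L(w)\<close> for each generator \<open>L\<close>, the homogenizations of
  these representatives in one large degree have a common remainder, and its dehomogenization
  satisfies all the bounds at once.  One degree suffices because there are only finitely many
  generators: reduced elements of \<open>J\<close> show that the closure of \<open>\<sigma>\<close> is a polyhedron.
\<close>

section \<open>Multi-indices\<close>

text \<open>A weight \<open>L\<close> alone does not support division: it may vanish on many
  exponents and need not have a minimum on the terms of a power series. Homogenization leaves
  finitely many exponents of \<open>\<partial>\<close> and \<open>z\<close> in each degree, and a
  linear form built from logarithms of primes separates the exponents of one degree. Comparison by
  \<open>L\<close> and then by this form is still not a weight. For finitely many divisors of one
  degree it is replaced by a small multiple of the form minus \<open>L\<close>, whose coefficients
  on the power series variables are positive; such a weight makes the reduction both recursive and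
  convergent. The weights in a cone are linked as follows. Components of elements of
  \<open>gr\<^sup>L(J)\<close> lift to \<open>J\<close>, so leading exponents can be read off from
  the graded ideal; and two remainders of one class differ by an element of \<open>J\<close> without
  leading exponents, which is zero. The cones are not assumed to be convex or polyhedral. For their
  closures this is derived from finitely many reduced elements, whose symbols decide whether two
  weights are equivalent.\<close>

lemma dickson_on:
  fixes X :: "('v \<Rightarrow> nat) set"
  assumes "finite A" and "\<And>x y i. x \<in> X \<Longrightarrow> y \<in> X \<Longrightarrow> i \<notin> A \<Longrightarrow> x i = y i"
  shows "\<exists>F. finite F \<and> F \<subseteq> X \<and> (\<forall>x\<in>X. \<exists>f\<in>F. f \<le> x)"
  using assms
\<comment> \<open>\<open>A\<close> contains the coordinates that may still vary. Fixing one of them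
  shrinks \<open>A\<close> while the index type stays the same, which a plain induction on the
  number of variables would not allow.\<close>
proof (induction "card A" arbitrary: A X rule: less_induct)
  case less
  show ?case
  proof (cases "X = {}")
    case True
    then show ?thesis by auto
  next
    case False
    then obtain x0 where x0: "x0 \<in> X" by blast
    define Y where "Y i m = {x \<in> X. x i = m}" for i m
    \<comment> \<open>an element of \<open>X\<close> not above \<open>x0\<close> lies in one of finitely many slices\<close>
    have "\<exists>F. finite F \<and> F \<subseteq> Y i m \<and> (\<forall>x\<in>Y i m. \<exists>f\<in>F. f \<le> x)" if "i \<in> A" for i m
    proof (rule less.hyps[of "A - {i}"])
      show "card (A - {i}) < card A" using less.prems(1) that by (rule card_Diff1_less)
      show "finite (A - {i})" using less.prems(1) by simp
      show "x j = y j" if "x \<in> Y i m" "y \<in> Y i m" "j \<notin> A - {i}" for x y j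
        using that less.prems(2)[of x y j] by (auto simp: Y_def)
    qed
    then obtain F where F: "\<And>i m. i \<in> A \<Longrightarrow> finite (F i m)" "\<And>i m. i \<in> A \<Longrightarrow> F i m \<subseteq> Y i m"
        "\<And>i m x. i \<in> A \<Longrightarrow> x \<in> Y i m \<Longrightarrow> \<exists>f\<in>F i m. f \<le> x"
      by metis
    define G where "G = insert x0 (\<Union>i\<in>A. \<Union>m\<in>{..<x0 i}. F i m)"
    have "finite G" using less.prems(1) F(1) by (auto simp: G_def)
    moreover have "G \<subseteq> X" using x0 F(2) by (auto simp: G_def Y_def)
    moreover have "\<exists>f\<in>G. f \<le> x" if x: "x \<in> X" for x
    proof (cases "x0 \<le> x")
      case True
      then show ?thesis by (auto simp: G_def)
    next
      case False
      then obtain i where i: "x i < x0 i" by (auto simp: le_fun_def not_le)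
      then have "i \<in> A" using less.prems(2)[OF x x0, of i] by auto
      moreover have "x \<in> Y i (x i)" using x by (simp add: Y_def)
      ultimately obtain f where "f \<in> F i (x i)" "f \<le> x" using F(3) by blast
      then show ?thesis using i \<open>i \<in> A\<close> by (auto simp: G_def)
    qed
    ultimately show ?thesis by blast
  qed
qed

lemma dickson:
  fixes X :: "('v::finite \<Rightarrow> nat) set"
  obtains F where "finite F" "F \<subseteq> X" "\<And>x. x \<in> X \<Longrightarrow> \<exists>f\<in>F. f \<le> x"
  using dickson_on[of UNIV X] by auto

section \<open>Weighted degrees of multi-indices\<close>

definition wsum :: "('v::finite \<Rightarrow> real) \<Rightarrow> ('v \<Rightarrow> nat) \<Rightarrow> real" where
  "wsum \<theta> a = (\<Sum>i\<in>UNIV. \<theta> i * real (a i))"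

lemma wsum_add: "wsum \<theta> (a + b) = wsum \<theta> a + wsum \<theta> b"
  by (simp add: wsum_def distrib_left sum.distrib)

lemma wsum_nonneg: "(\<And>i. 0 \<le> \<theta> i) \<Longrightarrow> 0 \<le> wsum \<theta> a"
  unfolding wsum_def by (intro sum_nonneg) simp

lemma finite_wsum_le:
  assumes "\<And>i. 0 < \<theta> i"
  shows "finite {a. wsum \<theta> a \<le> c}"
proof (rule finite_subset[OF _ finite_multi_le])
  show "{a. wsum \<theta> a \<le> c} \<subseteq> {a. a \<le> (\<lambda>i. nat \<lceil>c / \<theta> i\<rceil>)}"
  proof (clarsimp simp: le_fun_def)
    fix a i assume "wsum \<theta> a \<le> c"
    moreover have "\<theta> i * real (a i) \<le> wsum \<theta> a"
      unfolding wsum_def using less_imp_le[OF assms] by (intro member_le_sum) auto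
    ultimately have "real (a i) \<le> c / \<theta> i" using assms[of i] by (simp add: field_simps)
    then show "a i \<le> nat \<lceil>c / \<theta> i\<rceil>" by linarith
  qed
qed

text \<open>The right side is the monomial with exponent \<open>a\<close> at the point with
  coordinates \<open>s powr \<theta> i\<close>. As \<open>s\<close> tends to 0 this point moves to
  the origin, so the single parameter \<open>s\<close> can replace a polyradius.\<close>

lemma powr_wsum:
  assumes "0 < s"
  shows "s powr wsum \<theta> a = (\<Prod>i\<in>UNIV. (s powr \<theta> i) ^ a i)"
proof -
  have "s powr wsum \<theta> a = (\<Prod>i\<in>UNIV. s powr (\<theta> i * real (a i)))"
    unfolding wsum_def using assms by (subst powr_sum) auto
  also have "\<dots> = (\<Prod>i\<in>UNIV. (s powr \<theta> i) ^ a i)"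
    using assms by (intro prod.cong refl) (simp add: powr_powr[symmetric] powr_realpow)
  finally show ?thesis .
qed

section \<open>Convergence and weights\<close>

lemma summable_half_powers:
  "(\<lambda>a :: 'v::finite \<Rightarrow> nat. \<Prod>i\<in>UNIV. (1/2::real) ^ a i) summable_on UNIV"
proof (rule nonneg_bdd_above_summable_on)
  show "bdd_above (sum (\<lambda>a :: 'v \<Rightarrow> nat. \<Prod>i\<in>UNIV. (1/2::real) ^ a i) ` {F. F \<subseteq> UNIV \<and> finite F})"
  proof (rule bdd_aboveI2)
    fix F :: "('v \<Rightarrow> nat) set" assume "F \<in> {F. F \<subseteq> UNIV \<and> finite F}"
    then have F: "finite F" by simp
    define m where "m = Max (insert 0 (\<Union>a\<in>F. range a))"
    have m: "a i \<le> m" if "a \<in> F" for a i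
      unfolding m_def using F that by (intro Max_ge) auto
    have g: "(\<Sum>n\<le>m. (1/2::real) ^ n) \<le> 2"
    proof -
      have "(\<Sum>n\<le>m. (1/2::real) ^ n) = 2 - (1/2) ^ m" by (induction m) auto
      then show ?thesis by simp
    qed
    have "(\<Sum>a\<in>F. \<Prod>i\<in>UNIV. (1/2::real) ^ a i) \<le> (\<Sum>a\<in>(\<Pi>\<^sub>E i\<in>(UNIV :: 'v set). {..m}). \<Prod>i\<in>UNIV. (1/2::real) ^ a i)"
      using m by (intro sum_mono2) (auto simp: finite_PiE prod_nonneg)
    also have "\<dots> = (\<Prod>i\<in>(UNIV :: 'v set). \<Sum>n\<le>m. (1/2::real) ^ n)"
      by (rule prod_sum_PiE[symmetric]) auto
    also have "\<dots> \<le> (\<Prod>i\<in>(UNIV :: 'v set). 2)"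
      using g by (intro prod_mono) (auto intro!: sum_nonneg)
    finally show "(\<Sum>a\<in>F. \<Prod>i\<in>UNIV. (1/2::real) ^ a i) \<le> (\<Prod>i\<in>(UNIV :: 'v set). 2)" .
  qed
qed (auto intro!: prod_nonneg)

text \<open>Halving every coordinate of the point turns a supremum bound into summability, by
  comparison with a geometric series.\<close>

lemma conv_series_powr_bound:
  assumes s: "0 < s" and bd: "\<And>a. norm (f a) * s powr wsum \<theta> a \<le> M"
  shows "conv_series f"
proof (rule conv_series_bound)
  show "0 < s powr \<theta> i / 2" for i using s by simp
  show "(\<lambda>a :: 'a \<Rightarrow> nat. (\<Prod>i\<in>UNIV. (1/2::real) ^ a i) * M) summable_on UNIV"
    by (rule summable_on_cmult_left[OF summable_half_powers])
  show "norm (f a) * (\<Prod>i\<in>UNIV. (s powr \<theta> i / 2) ^ a i) \<le> (\<Prod>i\<in>UNIV. (1/2::real) ^ a i) * M" for a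
  proof -
    have "norm (f a) * (\<Prod>i\<in>UNIV. (s powr \<theta> i / 2) ^ a i)
        = (\<Prod>i\<in>UNIV. (1/2::real) ^ a i) * (norm (f a) * s powr wsum \<theta> a)"
      by (simp add: powr_wsum[OF s] power_divide prod_dividef)
    also have "\<dots> \<le> (\<Prod>i\<in>UNIV. (1/2::real) ^ a i) * M"
      by (intro mult_left_mono bd prod_nonneg) auto
    finally show ?thesis .
  qed
qed

text \<open>Once every \<open>s powr \<theta> i\<close> is at most the radius
  \<open>\<rho> i\<close>, the sum at the radii bounds all partial sums, uniformly in
  \<open>s\<close>.\<close>

lemma conv_series_powr_summable:
  assumes "conv_series f" and \<theta>: "\<And>i. 0 < \<theta> i"
  obtains s0 C where "0 < s0" "s0 < 1"
    "\<And>s F. 0 < s \<Longrightarrow> s \<le> s0 \<Longrightarrow> finite F \<Longrightarrow> (\<Sum>a\<in>F. norm (f a) * s powr wsum \<theta> a) \<le> C"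
proof -
  obtain \<rho> where \<rho>: "\<And>i. 0 < \<rho> i" "(\<lambda>a. norm (f a) * (\<Prod>i\<in>UNIV. \<rho> i ^ a i)) summable_on UNIV"
    using assms(1) by (rule conv_seriesE) blast
  define s0 where "s0 = Min (insert (1/2) (range (\<lambda>i. \<rho> i powr (1 / \<theta> i))))"
  have s0: "0 < s0" "s0 < 1"
  proof -
    have "\<rho> i \<noteq> 0" for i using \<rho>(1)[of i] by simp
    then show "0 < s0" unfolding s0_def by (subst Min_gr_iff) auto
    have "s0 \<le> 1/2" unfolding s0_def by (intro Min_le) auto
    then show "s0 < 1" by simp
  qed
  have le: "s powr \<theta> i \<le> \<rho> i" if "0 < s" "s \<le> s0" for s i
  proof -
    have "s \<le> \<rho> i powr (1 / \<theta> i)" using that(2) unfolding s0_def by (auto elim!: order.trans intro!: Min_le)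
    then have "s powr \<theta> i \<le> (\<rho> i powr (1 / \<theta> i)) powr \<theta> i"
      using that \<theta>[of i] by (intro powr_mono2) auto
    also have "\<dots> = \<rho> i" using \<theta>[of i] \<rho>(1)[of i] by (simp add: powr_powr)
    finally show ?thesis .
  qed
  define C where "C = infsum (\<lambda>a. norm (f a) * (\<Prod>i\<in>UNIV. \<rho> i ^ a i)) UNIV"
  show ?thesis
  proof (rule that[OF s0])
    fix s F assume s: "0 < s" "s \<le> s0" and F: "finite (F :: ('a \<Rightarrow> nat) set)"
    have "(\<Sum>a\<in>F. norm (f a) * s powr wsum \<theta> a) \<le> (\<Sum>a\<in>F. norm (f a) * (\<Prod>i\<in>UNIV. \<rho> i ^ a i))"
      unfolding powr_wsum[OF s(1)]
      by (intro sum_mono mult_left_mono prod_mono conjI power_mono le s) auto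
    also have "\<dots> \<le> C"
      unfolding C_def using \<rho> F
      by (intro finite_sum_le_infsum) (auto intro!: mult_nonneg_nonneg prod_nonneg simp: less_imp_le)
    finally show "(\<Sum>a\<in>F. norm (f a) * s powr wsum \<theta> a) \<le> C" .
  qed
qed

text \<open>Only finitely many exponents have weight at most \<open>w + 1\<close>, so the weights
  occurring in \<open>t\<close> exceed \<open>w\<close> by a fixed gap \<open>\<delta>\<close>.
  Passing from \<open>s0\<close> to \<open>s0 * \<tau>\<close> then gains the factor
  \<open>\<tau> powr \<delta>\<close> in every term. For the tail of a divisor this makes the later
  terms negligible against the leading one.\<close>

lemma tail_eventually_small:
  fixes t :: "('v::finite \<Rightarrow> nat) \<Rightarrow> complex"
  assumes t: "conv_series t" and \<theta>: "\<And>i. 0 < \<theta> i"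
    and gt: "\<And>c. t c \<noteq> 0 \<Longrightarrow> w < wsum \<theta> c" and \<eta>: "0 < \<eta>"
  shows "\<forall>\<^sub>F s in at_right 0. \<forall>F. finite F \<longrightarrow>
    (\<Sum>c\<in>F. norm (t c) * s powr (wsum \<theta> c - w)) \<le> \<eta>"
proof -
  obtain s0 C where s0: "0 < s0" "s0 < 1"
    and C: "\<And>s F. 0 < s \<Longrightarrow> s \<le> s0 \<Longrightarrow> finite F \<Longrightarrow> (\<Sum>a\<in>F. norm (t a) * s powr wsum \<theta> a) \<le> C"
    by (rule conv_series_powr_summable[of t \<theta>, OF t \<theta>]) blast
  define D where "D = {c. w < wsum \<theta> c \<and> wsum \<theta> c \<le> w + 1}"
  have finD: "finite D"
    by (rule finite_subset[OF _ finite_wsum_le[of \<theta> "w + 1"]]) (auto simp: D_def \<theta>)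
  define \<delta> where "\<delta> = Min (insert 1 ((\<lambda>c. wsum \<theta> c - w) ` D))"
  have \<delta>: "0 < \<delta>" unfolding \<delta>_def using finD by (subst Min_gr_iff) (auto simp: D_def)
  have gap: "\<delta> \<le> wsum \<theta> c - w" if "t c \<noteq> 0" for c
  proof (cases "c \<in> D")
    case True
    then show ?thesis unfolding \<delta>_def using finD by (intro Min_le) auto
  next
    case False
    then have "1 \<le> wsum \<theta> c - w" using gt[OF that] by (auto simp: D_def)
    moreover have "\<delta> \<le> 1" unfolding \<delta>_def using finD by (intro Min_le) auto
    ultimately show ?thesis by linarith
  qed
  have C0: "0 \<le> C" using C[of s0 "{}"] s0 by simp
  \<comment> \<open>The summand 1 keeps \<open>C'\<close> positive, so that it can be divided
    by.\<close>
  define C' where "C' = C * s0 powr (- w) + 1"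
  have C': "0 < C'" using C0 by (simp add: C'_def add_nonneg_pos)
  \<comment> \<open>The second entry of the minimum makes \<open>C' * \<tau> powr \<delta>\<close>
    at most \<open>\<eta>\<close>; the first keeps \<open>\<tau>\<close> at most 1, so that its
    powers decrease in the exponent.\<close>
  define s1 where "s1 = s0 * min 1 ((\<eta> / C') powr (1 / \<delta>))"
  have "0 < s1" using s0 \<eta> C' by (simp add: s1_def)
  moreover have "(\<Sum>c\<in>F. norm (t c) * s powr (wsum \<theta> c - w)) \<le> \<eta>"
    if s: "0 < s" "s < s1" and F: "finite F" for s F
  proof -
    define \<tau> where "\<tau> = s / s0"
    have "\<tau> \<le> min 1 ((\<eta> / C') powr (1 / \<delta>))" 
      using s(2) unfolding \<tau>_def s1_def pos_divide_le_eq[OF s0(1)] by (simp only: mult.commute less_imp_le)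
    then have \<tau>: "0 < \<tau>" "\<tau> \<le> 1" "\<tau> \<le> (\<eta> / C') powr (1 / \<delta>)" "s = s0 * \<tau>"
      using s(1) s0 by (auto simp: \<tau>_def)
    have "\<tau> powr \<delta> \<le> ((\<eta> / C') powr (1 / \<delta>)) powr \<delta>"
      using \<tau> \<delta> by (intro powr_mono2) auto
    also have "\<dots> = \<eta> / C'" using \<delta> \<eta> C' by (simp add: powr_powr)
    finally have \<tau>\<delta>: "\<tau> powr \<delta> \<le> \<eta> / C'" .
    have "(\<Sum>c\<in>F. norm (t c) * s powr (wsum \<theta> c - w))
        \<le> (\<Sum>c\<in>F. (norm (t c) * s0 powr wsum \<theta> c) * (s0 powr (- w) * \<tau> powr \<delta>))"
    proof (rule sum_mono)
      fix c
      show "norm (t c) * s powr (wsum \<theta> c - w) \<le> (norm (t c) * s0 powr wsum \<theta> c) * (s0 powr (- w) * \<tau> powr \<delta>)"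
      proof (cases "t c = 0")
        case False
        have "s powr (wsum \<theta> c - w) = s0 powr (wsum \<theta> c - w) * \<tau> powr (wsum \<theta> c - w)"
          using s0 \<tau> by (simp add: powr_mult)
        also have "\<dots> \<le> s0 powr (wsum \<theta> c - w) * \<tau> powr \<delta>"
          using \<tau> gap[OF False] by (intro mult_left_mono powr_mono') auto
        also have "s0 powr (wsum \<theta> c - w) = s0 powr wsum \<theta> c * s0 powr (- w)"
          using s0 by (simp flip: powr_add)
        finally have "s powr (wsum \<theta> c - w) \<le> s0 powr wsum \<theta> c * s0 powr (- w) * \<tau> powr \<delta>" .
        then have "norm (t c) * s powr (wsum \<theta> c - w)
            \<le> norm (t c) * (s0 powr wsum \<theta> c * s0 powr (- w) * \<tau> powr \<delta>)"
          by (rule mult_left_mono) simp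
        then show ?thesis by (simp add: mult_ac)
      qed simp
    qed
    also have "\<dots> = (\<Sum>c\<in>F. norm (t c) * s0 powr wsum \<theta> c) * (s0 powr (- w) * \<tau> powr \<delta>)"
      by (simp add: sum_distrib_right)
    also have "\<dots> \<le> C * (s0 powr (- w) * \<tau> powr \<delta>)"
      using s0 F by (intro mult_right_mono C) auto
    also have "\<dots> = (C * s0 powr (- w)) * \<tau> powr \<delta>" by simp
    also have "\<dots> \<le> C' * (\<eta> / C')"
      using \<tau>\<delta> C' C0 by (intro mult_mono) (auto simp: C'_def)
    also have "\<dots> = \<eta>" using C' by simp
    finally show ?thesis .
  qed
  ultimately show ?thesis
    unfolding eventually_at_right_field by blast
qed

lemma measure_fixpoint:
  fixes rank :: "'e \<Rightarrow> nat"
  assumes "\<And>h h' x. (\<And>y. rank y < rank x \<Longrightarrow> h y = h' y) \<Longrightarrow> F h x = F h' x"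
  obtains h where "\<And>x. h x = F h x"
proof (rule that)
  fix x
  have "wfrec (Wellfounded.measure rank) F x = F (cut (wfrec (Wellfounded.measure rank) F) (Wellfounded.measure rank) x) x"
    by (rule wfrec) simp
  also have "\<dots> = F (wfrec (Wellfounded.measure rank) F) x"
    by (rule assms) (simp add: cut_def)
  finally show "wfrec (Wellfounded.measure rank) F x = F (wfrec (Wellfounded.measure rank) F) x" .
qed

section \<open>Division with remainder\<close>

text \<open>The strict inequality in \<open>lead\<close> serves twice: it makes the reduction
  recursive in the weight, and near the origin it makes the tails contract, which gives convergence.
  \<open>X\<close> is any set of exponents that no reduction step leaves; choosing the exponents of
  bounded \<open>L\<close>-order yields the order bounds for quotients and remainder from the same
  construction.\<close>

theorem cps_division:
  fixes g :: "'i \<Rightarrow> 'b \<Rightarrow> 'v::finite cps" and f :: "'b \<Rightarrow> 'v cps" and \<theta> :: "'v \<Rightarrow> real"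
    and a0 :: "'i \<Rightarrow> 'v \<Rightarrow> nat"
  assumes B: "finite B" and K: "finite K" and \<theta>: "\<And>i. 0 < \<theta> i"
    and b0: "\<And>i. i \<in> K \<Longrightarrow> b0 i \<in> B"
    and lc: "\<And>i. i \<in> K \<Longrightarrow> cps_nth (g i (b0 i)) (a0 i) = 1"
    and lead: "\<And>i a b. i \<in> K \<Longrightarrow> b \<in> B \<Longrightarrow> cps_nth (g i b) a \<noteq> 0 \<Longrightarrow> (a, b) \<noteq> (a0 i, b0 i) \<Longrightarrow>
      wsum \<theta> (a0 i) + \<kappa> (b0 i) < wsum \<theta> a + \<kappa> b"
    and X: "\<And>i c a b. i \<in> K \<Longrightarrow> b \<in> B \<Longrightarrow> (c + a0 i, b0 i) \<in> X \<Longrightarrow> cps_nth (g i b) a \<noteq> 0 \<Longrightarrow> (c + a, b) \<in> X"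
    and f: "\<And>a b. b \<in> B \<Longrightarrow> cps_nth (f b) a \<noteq> 0 \<Longrightarrow> (a, b) \<in> X"
  obtains q :: "'i \<Rightarrow> 'v cps" and r :: "'b \<Rightarrow> 'v cps" where
    "\<And>b. b \<in> B \<Longrightarrow> f b = (\<Sum>i\<in>K. q i * g i b) + r b"
    "\<And>i a b. i \<in> K \<Longrightarrow> cps_nth (r b) a \<noteq> 0 \<Longrightarrow> \<not> (b0 i = b \<and> a0 i \<le> a)"
    "\<And>a b. cps_nth (r b) a \<noteq> 0 \<Longrightarrow> (a, b) \<in> X"
    "\<And>i c. i \<in> K \<Longrightarrow> cps_nth (q i) c \<noteq> 0 \<Longrightarrow> (c + a0 i, b0 i) \<in> X"
proof -
  define wt where "wt = (\<lambda>(a, b). wsum \<theta> a + \<kappa> b)"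
  \<comment> \<open>Weights are real numbers. Counting the exponents of smaller weight, which are
    finitely many, turns them into ranks for a well-founded recursion.\<close>
  define rank where "rank x = card {y. snd y \<in> B \<and> wt y < wt x}" for x
  have fin: "finite {y. snd y \<in> B \<and> wt y < c}" for c
  proof (rule finite_subset)
    show "{y. snd y \<in> B \<and> wt y < c} \<subseteq> (\<lambda>(b, a). (a, b)) ` (SIGMA b:B. {a. wsum \<theta> a \<le> c - \<kappa> b})"
      by (auto simp: wt_def)
  qed (use B \<theta> in \<open>auto intro!: finite_wsum_le\<close>)
  have rank: "rank y < rank x" if "snd y \<in> B" "wt y < wt x" for x y
    unfolding rank_def using that by (intro psubset_card_mono fin) auto
  define tl where "tl i b c = (if (c, b) = (a0 i, b0 i) then 0 else cps_nth (g i b) c)" for i b c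
  have tl_gt: "wt (a0 i, b0 i) < wt (c, b)" if "i \<in> K" "b \<in> B" "tl i b c \<noteq> 0" for i b c
    using lead[OF that(1,2)] that(3) by (auto simp: tl_def wt_def split: if_splits)
  have tl_conv: "conv_series (tl i b)" for i b
  proof (rule conv_series_mono)
    show "conv_series (cps_nth (g i b))" using cps_nth by blast
    show "norm (tl i b a) \<le> norm (cps_nth (g i b) a)" for a by (simp add: tl_def)
  qed
  \<comment> \<open>junk where no leading exponent divides \<open>x\<close>\<close>
  define ch where "ch x = (SOME i. i \<in> K \<and> b0 i = snd x \<and> a0 i \<le> fst x)" for x
  have ch: "ch (a, b) \<in> K \<and> b0 (ch (a, b)) = b \<and> a0 (ch (a, b)) \<le> a"
    if "i \<in> K" "b0 i = b" "a0 i \<le> a" for i a b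
    unfolding ch_def by (rule someI2[of _ i]) (use that in auto)
  \<comment> \<open>The input at a reducible exponent is charged to the chosen divisor only, so that
    the quotients account for it exactly once.\<close>
  define Q where "Q h i c = (if ch (c + a0 i, b0 i) = i then h (c + a0 i, b0 i) else 0)"
    for h :: "('v \<Rightarrow> nat) \<times> 'b \<Rightarrow> complex" and i c
  \<comment> \<open>
    A fixed point \<open>h\<close> is the total input of the infinite reduction process.  It exists by recursion on
    the weight, and \<open>h_bound\<close> bounds it in a weighted supremum norm, which gives convergence.\<close>
  define step where "step h x = (if snd x \<in> B then cps_nth (f (snd x)) (fst x) -
      (\<Sum>i\<in>K. \<Sum>(c, c') | c + c' = fst x. Q h i c * tl i (snd x) c') else 0)" for h x
  have shift: "wt (c + a0 i, b0 i) < wt (c + c', b)" if "i \<in> K" "b \<in> B" "tl i b c' \<noteq> 0" for i b c c'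
    using tl_gt[OF that] by (simp add: wt_def wsum_add)
  obtain h where h: "\<And>x. h x = step h x"
  proof (rule measure_fixpoint[of rank step])
    fix h h' :: "('v \<Rightarrow> nat) \<times> 'b \<Rightarrow> complex" and x
    assume eq: "h y = h' y" if "rank y < rank x" for y
    have "Q h i c * tl i b c' = Q h' i c * tl i b c'"
      if "i \<in> K" "b \<in> B" "x = (c + c', b)" for i b c c'
    proof (cases "tl i b c' = 0")
      case False
      then have "rank (c + a0 i, b0 i) < rank x"
        using shift[OF that(1,2)] b0[OF that(1)] that(3) by (intro rank) auto
      then show ?thesis by (simp add: Q_def eq)
    qed simp
    then show "step h x = step h' x"
      unfolding step_def
      by (intro if_cong arg_cong2[where f = "(-)"] sum.cong refl) (auto simp: prod_eq_iff)
  qed blast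
  have h_B: "h (a, b) = cps_nth (f b) a - (\<Sum>i\<in>K. \<Sum>(c, c') | c + c' = a. Q h i c * tl i b c')"
    if "b \<in> B" for a b
    using h[of "(a, b)"] that by (simp add: step_def)
  have h_nB: "h (a, b) = 0" if "b \<notin> B" for a b
    using h[of "(a, b)"] that by (simp add: step_def)
  have h_X: "(a, b) \<in> X" if "h (a, b) \<noteq> 0" for a b
    using that
  proof (induction "rank (a, b)" arbitrary: a b rule: less_induct)
    case less
    have bB: "b \<in> B" using less.prems h_nB by blast
    show ?case
    proof (rule ccontr)
      assume nX: "(a, b) \<notin> X"
      have "Q h i c * tl i b c' = 0" if "i \<in> K" "c + c' = a" for i c c'
      proof (rule ccontr)
        assume *: "Q h i c * tl i b c' \<noteq> 0"
        then have "h (c + a0 i, b0 i) \<noteq> 0" by (auto simp: Q_def split: if_splits)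
        moreover have "rank (c + a0 i, b0 i) < rank (a, b)"
          using shift[OF that(1) bB, of c' c] * b0[OF that(1)] that(2) by (intro rank) auto
        ultimately have "(c + a0 i, b0 i) \<in> X" using less.hyps by blast
        then have "(c + c', b) \<in> X"
          by (rule X[OF that(1) bB]) (use * in \<open>auto simp: tl_def split: if_splits\<close>)
        then show False using nX that(2) by simp
      qed
      then have "h (a, b) = cps_nth (f b) a"
        unfolding h_B[OF bB] by (subst sum.neutral) (auto intro!: sum.neutral)
      then show False using f[OF bB, of a] nX less.prems by auto
    qed
  qed
  \<comment> \<open>The exponent of \<open>s\<close> below is the excess in weight of a tail term
    over the leading term. With \<open>1 / (2 * k)\<close> per divisor, all tails together add at
    most \<open>M\<close> to the bound \<open>M\<close> for \<open>f\<close>, so the bound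
    \<open>2 * M\<close> in \<open>h_bound\<close> reproduces itself. The summand 1 covers an empty
    \<open>K\<close>.\<close>
  define k where "k = real (card K) + 1"
  have "\<forall>\<^sub>F s in at_right 0. \<forall>i\<in>K. \<forall>b\<in>B. \<forall>F. finite F \<longrightarrow>
      (\<Sum>c\<in>F. norm (tl i b c) * s powr (wsum \<theta> c - (wt (a0 i, b0 i) - \<kappa> b))) \<le> 1 / (2 * k)"
  proof (intro eventually_ball_finite K B ballI)
    fix i b assume ib: "i \<in> K" "b \<in> B"
    show "\<forall>\<^sub>F s in at_right 0. \<forall>F. finite F \<longrightarrow>
        (\<Sum>c\<in>F. norm (tl i b c) * s powr (wsum \<theta> c - (wt (a0 i, b0 i) - \<kappa> b))) \<le> 1 / (2 * k)"
    proof (rule tail_eventually_small[OF tl_conv \<theta>])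
      show "wt (a0 i, b0 i) - \<kappa> b < wsum \<theta> c" if "tl i b c \<noteq> 0" for c
        using tl_gt[OF ib that] by (simp add: wt_def)
      show "0 < 1 / (2 * k)" by (simp add: k_def)
    qed
  qed
  moreover have "\<forall>\<^sub>F s in at_right 0. \<forall>b\<in>B. \<exists>M. \<forall>a. norm (cps_nth (f b) a) * s powr wsum \<theta> a \<le> M"
  proof (intro eventually_ball_finite B ballI)
    fix b
    have "conv_series (cps_nth (f b))" using cps_nth by blast
    then obtain s0 C where s0: "0 < s0" "s0 < 1"
      and C: "\<And>s F. 0 < s \<Longrightarrow> s \<le> s0 \<Longrightarrow> finite F \<Longrightarrow> (\<Sum>a\<in>F. norm (cps_nth (f b) a) * s powr wsum \<theta> a) \<le> C"
      by (rule conv_series_powr_summable[of "cps_nth (f b)" \<theta>, OF _ \<theta>]) blast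
    have "\<exists>M. \<forall>a. norm (cps_nth (f b) a) * s powr wsum \<theta> a \<le> M" if "0 < s" "s < s0" for s
      using C[of s "{a}" for a] that by auto
    then show "\<forall>\<^sub>F s in at_right 0. \<exists>M. \<forall>a. norm (cps_nth (f b) a) * s powr wsum \<theta> a \<le> M"
      unfolding eventually_at_right_field using s0(1) by blast
  qed
  moreover have "\<forall>\<^sub>F s in at_right (0::real). 0 < s"
    unfolding eventually_at_right_field by (rule exI[of _ 1]) auto
  ultimately have ev: "\<forall>\<^sub>F s in at_right 0. 0 < s \<and>
      (\<forall>b\<in>B. \<exists>M. \<forall>a. norm (cps_nth (f b) a) * s powr wsum \<theta> a \<le> M) \<and>
      (\<forall>i\<in>K. \<forall>b\<in>B. \<forall>F. finite F \<longrightarrow>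
      (\<Sum>c\<in>F. norm (tl i b c) * s powr (wsum \<theta> c - (wt (a0 i, b0 i) - \<kappa> b))) \<le> 1 / (2 * k))"
    by eventually_elim blast
  then obtain s where s: "0 < s"
    and fM: "\<forall>b\<in>B. \<exists>M. \<forall>a. norm (cps_nth (f b) a) * s powr wsum \<theta> a \<le> M"
    and tl: "\<And>i b F. i \<in> K \<Longrightarrow> b \<in> B \<Longrightarrow> finite F \<Longrightarrow>
      (\<Sum>c\<in>F. norm (tl i b c) * s powr (wsum \<theta> c - (wt (a0 i, b0 i) - \<kappa> b))) \<le> 1 / (2 * k)"
    using eventually_happens'[OF trivial_limit_at_right_real ev] by auto
  obtain M0 where M0: "\<And>b a. b \<in> B \<Longrightarrow> norm (cps_nth (f b) a) * s powr wsum \<theta> a \<le> M0 b"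
    using fM by metis
  define M where "M = Max (insert 0 ((\<lambda>b. M0 b * s powr \<kappa> b) ` B))"
  have M: "norm (cps_nth (f b) a) * s powr wt (a, b) \<le> M" if "b \<in> B" for a b
  proof -
    have "norm (cps_nth (f b) a) * s powr wt (a, b) = norm (cps_nth (f b) a) * s powr wsum \<theta> a * s powr \<kappa> b"
      by (simp add: wt_def powr_add)
    also have "\<dots> \<le> M0 b * s powr \<kappa> b" by (intro mult_right_mono M0 that) simp
    also have "\<dots> \<le> M" unfolding M_def using B that by (intro Max_ge) auto
    finally show ?thesis .
  qed
  have M_nonneg: "0 \<le> M" unfolding M_def using B by (intro Max_ge) auto
  have h_bound: "norm (h (a, b)) * s powr wt (a, b) \<le> 2 * M" if "b \<in> B" for a b
    using that
  proof (induction "rank (a, b)" arbitrary: a b rule: less_induct)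
    case less
    have term_le: "norm (Q h i c * tl i b c') * s powr wt (c + c', b)
        \<le> 2 * M * (norm (tl i b c') * s powr (wsum \<theta> c' - (wt (a0 i, b0 i) - \<kappa> b)))"
      if i: "i \<in> K" and c: "c + c' = a" for i c c'
    proof (cases "tl i b c' = 0")
      case False
      have "rank (c + a0 i, b0 i) < rank (a, b)"
        using shift[OF i less.prems False] c b0[OF i] by (intro rank) auto
      then have "norm (h (c + a0 i, b0 i)) * s powr wt (c + a0 i, b0 i) \<le> 2 * M"
        using less.hyps b0[OF i] by blast
      then have *: "norm (Q h i c) * s powr wt (c + a0 i, b0 i) \<le> 2 * M"
        using M_nonneg by (auto simp: Q_def)
      have "wt (c + c', b) = wt (c + a0 i, b0 i) + (wsum \<theta> c' - (wt (a0 i, b0 i) - \<kappa> b))"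
        by (simp add: wt_def wsum_add)
      then have "norm (Q h i c * tl i b c') * s powr wt (c + c', b)
          = (norm (Q h i c) * s powr wt (c + a0 i, b0 i)) * (norm (tl i b c') * s powr (wsum \<theta> c' - (wt (a0 i, b0 i) - \<kappa> b)))"
        by (simp only: norm_mult powr_add mult_ac)
      also have "\<dots> \<le> 2 * M * (norm (tl i b c') * s powr (wsum \<theta> c' - (wt (a0 i, b0 i) - \<kappa> b)))"
        by (intro mult_right_mono *) simp
      finally show ?thesis .
    qed simp
    have inner: "(\<Sum>(c, c') | c + c' = a. norm (Q h i c * tl i b c')) * s powr wt (a, b) \<le> 2 * M * (1 / (2 * k))"
      if i: "i \<in> K" for i
    proof -
      have "(\<Sum>(c, c') | c + c' = a. norm (Q h i c * tl i b c')) * s powr wt (a, b)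
          = (\<Sum>p | fst p + snd p = a. norm (Q h i (fst p) * tl i b (snd p)) * s powr wt (fst p + snd p, b))"
        by (simp add: sum_distrib_right case_prod_unfold)
      also have "\<dots> \<le> (\<Sum>p | fst p + snd p = a. 2 * M *
          (norm (tl i b (snd p)) * s powr (wsum \<theta> (snd p) - (wt (a0 i, b0 i) - \<kappa> b))))"
        by (intro sum_mono term_le i) simp
      also have "\<dots> = 2 * M * (\<Sum>p | fst p + snd p = a.
          norm (tl i b (snd p)) * s powr (wsum \<theta> (snd p) - (wt (a0 i, b0 i) - \<kappa> b)))"
        by (simp add: sum_distrib_left)
      also have "(\<Sum>p | fst p + snd p = a.
          norm (tl i b (snd p)) * s powr (wsum \<theta> (snd p) - (wt (a0 i, b0 i) - \<kappa> b)))
        = (\<Sum>c\<in>snd ` {p. fst p + snd p = a}. norm (tl i b c) * s powr (wsum \<theta> c - (wt (a0 i, b0 i) - \<kappa> b)))"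
        by (subst sum.reindex) (auto simp: inj_on_def prod_eq_iff)
      also have "2 * M * \<dots> \<le> 2 * M * (1 / (2 * k))"
        using M_nonneg finite_multi_add[of a]
        by (intro mult_left_mono tl i less.prems finite_imageI) (auto simp: case_prod_unfold)
      finally show ?thesis .
    qed
    have "norm (h (a, b)) * s powr wt (a, b)
        \<le> (norm (cps_nth (f b) a) + (\<Sum>i\<in>K. \<Sum>(c, c') | c + c' = a. norm (Q h i c * tl i b c'))) * s powr wt (a, b)"
    proof (rule mult_right_mono)
      have "norm (\<Sum>i\<in>K. \<Sum>(c, c') | c + c' = a. Q h i c * tl i b c')
          \<le> (\<Sum>i\<in>K. \<Sum>(c, c') | c + c' = a. norm (Q h i c * tl i b c'))"
        unfolding case_prod_unfold by (intro order.trans[OF norm_sum] sum_mono norm_sum)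
      then show "norm (h (a, b)) \<le> norm (cps_nth (f b) a) + (\<Sum>i\<in>K. \<Sum>(c, c') | c + c' = a. norm (Q h i c * tl i b c'))"
        unfolding h_B[OF less.prems] using norm_triangle_ineq4 by (meson add_left_mono order.trans)
    qed simp
    also have "\<dots> = norm (cps_nth (f b) a) * s powr wt (a, b)
        + (\<Sum>i\<in>K. (\<Sum>(c, c') | c + c' = a. norm (Q h i c * tl i b c')) * s powr wt (a, b))"
      by (simp add: distrib_right sum_distrib_right)
    also have "\<dots> \<le> M + (\<Sum>i\<in>K. 2 * M * (1 / (2 * k)))"
      by (intro add_mono sum_mono M inner less.prems)
    also have "\<dots> \<le> 2 * M"
      using M_nonneg by (simp add: k_def field_simps)
    finally show ?case .
  qed
  \<comment> \<open>The shift \<open>a\<close> makes this cover the quotients, with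
    \<open>a0 i\<close>, as well as the remainder, with 0.\<close>
  have conv_h: "conv_series (\<lambda>c. if c \<in> A then h (c + a, b) else 0)" for A a b
  proof (rule conv_series_restrict, rule conv_series_powr_bound[OF s])
    fix c
    show "norm (h (c + a, b)) * s powr wsum \<theta> c \<le> 2 * M * s powr (- wsum \<theta> a - \<kappa> b)"
    proof (cases "b \<in> B")
      case True
      have "norm (h (c + a, b)) * s powr wsum \<theta> c
          = (norm (h (c + a, b)) * s powr wt (c + a, b)) * s powr (- wsum \<theta> a - \<kappa> b)"
        using s by (simp add: wt_def wsum_add flip: powr_add)
      also have "\<dots> \<le> 2 * M * s powr (- wsum \<theta> a - \<kappa> b)"
        by (intro mult_right_mono h_bound True) simp
      finally show ?thesis .
    qed (use M_nonneg in \<open>simp add: h_nB\<close>)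
  qed
  define q where "q i = Abs_cps (Q h i)" for i
  have q: "cps_nth (q i) = Q h i" for i
  proof -
    have "Q h i = (\<lambda>c. if c \<in> {c. ch (c + a0 i, b0 i) = i} then h (c + a0 i, b0 i) else 0)"
      by (auto simp: Q_def)
    then have "conv_series (Q h i)" by (simp only: conv_h)
    then show ?thesis by (simp add: q_def Abs_cps_inverse)
  qed
  define E where "E = {(a, b). \<exists>i\<in>K. b0 i = b \<and> a0 i \<le> a}"
  define r where "r b = Abs_cps (\<lambda>a. if a \<in> {a. (a, b) \<notin> E} then h (a, b) else 0)" for b
  have r: "cps_nth (r b) a = (if (a, b) \<in> E then 0 else h (a, b))" for a b
    using conv_h[of "{a. (a, b) \<notin> E}" 0 b, unfolded add_0_right] by (simp add: r_def Abs_cps_inverse)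
  show ?thesis
  proof (rule that[of q r])
    fix b assume bB: "b \<in> B"
    show "f b = (\<Sum>i\<in>K. q i * g i b) + r b"
    proof (rule cps_eqI)
      fix a
      have nth_sum: "cps_nth (sum F A) a = (\<Sum>i\<in>A. cps_nth (F i) a)" for F :: "'i \<Rightarrow> 'v cps" and A
        by (induction A rule: infinite_finite_induct) (simp_all add: zero_cps.rep_eq plus_cps.rep_eq)
      \<comment> \<open>The share of the leading term of \<open>g i\<close> in the coefficient at
        \<open>a\<close>. On \<open>E\<close> only the chosen divisor contributes, and it
        contributes all of \<open>h (a, b)\<close>.\<close>
      define u where "u i = (if b0 i = b \<and> a0 i \<le> a then Q h i (a - a0 i) else 0)" for i
      have prod: "cps_nth (q i * g i b) a = (\<Sum>(c, c') | c + c' = a. Q h i c * tl i b c') + u i"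
        if i: "i \<in> K" for i
      proof -
        have split: "Q h i c * cps_nth (g i b) c' = Q h i c * tl i b c'
            + (if c' = a0 i \<and> b = b0 i then Q h i c else 0)" for c c'
          using lc[OF i] by (simp add: tl_def)
        have "(\<Sum>(c, c') | c + c' = a. if c' = a0 i \<and> b = b0 i then Q h i c else 0) = u i"
        proof (cases "b0 i = b \<and> a0 i \<le> a")
          case True
          have "(\<Sum>(c, c') | c + c' = a. if c' = a0 i \<and> b = b0 i then Q h i c else 0)
              = (\<Sum>(c, c')\<in>{(a - a0 i, a0 i)}. if c' = a0 i \<and> b = b0 i then Q h i c else 0)"
          proof (rule sum.mono_neutral_right[OF finite_multi_add])
            show "{(a - a0 i, a0 i)} \<subseteq> {(c, c'). c + c' = a}"
              using True by (auto simp: fun_eq_iff le_fun_def)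
            have "c = a - a0 i" if "c + a0 i = a" for c
              using that add_diff_cancel_right' by metis
            then show "\<forall>p\<in>{(c, c'). c + c' = a} - {(a - a0 i, a0 i)}.
                (case p of (c, c') \<Rightarrow> if c' = a0 i \<and> b = b0 i then Q h i c else 0) = 0"
              by (auto split: if_splits)
          qed
          then show ?thesis using True by (simp add: u_def)
        next
          case False
          then show ?thesis by (auto simp: u_def le_fun_def intro!: sum.neutral)
        qed
        then show ?thesis
          by (simp add: times_cps.rep_eq q split sum.distrib case_prod_unfold)
      qed
      have "(\<Sum>i\<in>K. u i) + cps_nth (r b) a = h (a, b)"
      proof (cases "(a, b) \<in> E")
        case True
        then obtain i where "i \<in> K" "b0 i = b" "a0 i \<le> a" by (auto simp: E_def)
        note c = ch[OF this]
        have cancel: "(a - a0 i) + a0 i = a" if "a0 i \<le> a" for i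
          using that by (auto simp: fun_eq_iff le_fun_def)
        have "u i = (if i = ch (a, b) then h (a, b) else 0)" for i
          using c cancel by (auto simp: u_def Q_def)
        then show ?thesis using c K True by (simp add: r)
      next
        case False
        then have "u i = 0" if "i \<in> K" for i using that by (auto simp: u_def E_def)
        then show ?thesis using False by (simp add: r)
      qed
      then show "cps_nth (f b) a = cps_nth ((\<Sum>i\<in>K. q i * g i b) + r b) a"
        using h_B[OF bB, of a] by (simp add: plus_cps.rep_eq nth_sum prod sum.distrib add.assoc)
    qed
  next
    show "\<not> (b0 i = b \<and> a0 i \<le> a)" if "i \<in> K" "cps_nth (r b) a \<noteq> 0" for i a b
      using that by (auto simp: r E_def split: if_splits)
    show "(a, b) \<in> X" if "cps_nth (r b) a \<noteq> 0" for a b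
      using that h_X by (auto simp: r split: if_splits)
    show "(c + a0 i, b0 i) \<in> X" if "i \<in> K" "cps_nth (q i) c \<noteq> 0" for i c
      using that h_X by (auto simp: q Q_def split: if_splits)
  qed
qed

section \<open>Coefficients and products in the homogenized ring\<close>

lemma lookup_ore_scale: "Poly_Mapping.lookup (ore_scale c Q) b = c * Poly_Mapping.lookup Q b"
  by (rule additive_eqI[where F = "\<lambda>Q. Poly_Mapping.lookup (ore_scale c Q) b"])
     (auto simp: ore_scale_add_right lookup_add distrib_left ore_scale_single lookup_single when_def)

lemma (in commuting_derivations) lookup_ore_left:
  "Poly_Mapping.lookup (ore_left \<delta> i Q) b =
    (if b i = 0 then 0 else Poly_Mapping.lookup Q (b(i := b i - 1))) + \<delta> i (Poly_Mapping.lookup Q b)"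
proof (rule additive_eqI[where F = "\<lambda>Q. Poly_Mapping.lookup (ore_left \<delta> i Q) b"])
  fix \<beta> c
  have "\<beta>(i := Suc (\<beta> i)) = b \<longleftrightarrow> b i \<noteq> 0 \<and> \<beta> = b(i := b i - 1)"
    by (auto simp: fun_eq_iff)
  then show "Poly_Mapping.lookup (ore_left \<delta> i (Poly_Mapping.single \<beta> c)) b =
      (if b i = 0 then 0 else Poly_Mapping.lookup (Poly_Mapping.single \<beta> c) (b(i := b i - 1)))
      + \<delta> i (Poly_Mapping.lookup (Poly_Mapping.single \<beta> c) b)"
    by (simp add: left_single lookup_add lookup_single when_def \<delta>_0)
qed (auto simp: left_add lookup_add \<delta>_add)

lemma cps_nth_0: "cps_nth 0 a = 0"
  by (simp add: zero_cps.rep_eq)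

lemma cps_nth_add: "cps_nth (f + g) a = cps_nth f a + cps_nth g a"
  by (simp add: plus_cps.rep_eq)

lemma cps_nth_uminus: "cps_nth (- f) a = - cps_nth f a"
  by (simp add: uminus_cps.rep_eq)

lemma cps_nth_diff: "cps_nth (f - g) a = cps_nth f a - cps_nth g a"
  using cps_nth_add[of f "- g" a] by (simp add: cps_nth_uminus)

lemma coeff_zpoly_pd:
  "poly.coeff (zpoly_pd i p) k = (case k of 0 \<Rightarrow> 0 | Suc k' \<Rightarrow> cps_pd i (poly.coeff p k'))"
  by (auto simp: zpoly_pd_def coeff_pCons coeff_map_cps_pd split: nat.splits)

text \<open>In one degree an operator is a vector of finitely many such power series, which is the
  form that the division theorem needs.\<close>

definition hdop_slice :: "'v::finite hdop \<Rightarrow> ('v \<Rightarrow> nat) \<times> nat \<Rightarrow> 'v cps" where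
  "hdop_slice H = (\<lambda>(b, k). poly.coeff (Poly_Mapping.lookup (hdop_expansion H) b) k)"

lemma hdop_coeff_slice: "hdop_coeff H (a, b, k) = cps_nth (hdop_slice H (b, k)) a"
  by (simp add: hdop_coeff_def hdop_slice_def)

lemma hdop_slice_eqI:
  assumes "\<And>bk. hdop_slice H bk = hdop_slice H' bk"
  shows "H = H'"
proof (rule hdop_expansion_inject[THEN iffD1], rule poly_mapping_eqI, rule poly_eqI)
  fix b k
  show "poly.coeff (Poly_Mapping.lookup (hdop_expansion H) b) k
      = poly.coeff (Poly_Mapping.lookup (hdop_expansion H') b) k"
    using assms[of "(b, k)"] by (simp add: hdop_slice_def)
qed

lemma hdop_eqI:
  assumes "\<And>e. hdop_coeff H e = hdop_coeff H' e"
  shows "H = H'"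
proof (rule hdop_slice_eqI, rule cps_eqI)
  fix bk a
  show "cps_nth (hdop_slice H bk) a = cps_nth (hdop_slice H' bk) a"
    using assms[of "(a, bk)"] by (cases bk) (simp only: hdop_coeff_slice)
qed

lemma hdop_slice_simps:
  "hdop_slice 0 bk = 0"
  "hdop_slice (H + H') bk = hdop_slice H bk + hdop_slice H' bk"
  "hdop_slice (- H) bk = - hdop_slice H bk"
  "hdop_slice (H - H') bk = hdop_slice H bk - hdop_slice H' bk"
  by (simp_all add: hdop_slice_def split_def zero_hdop.rep_eq plus_hdop.rep_eq uminus_hdop.rep_eq
      minus_hdop.rep_eq lookup_add lookup_minus)

lemma hdop_slice_sum: "hdop_slice (\<Sum>x\<in>A. F x) bk = (\<Sum>x\<in>A. hdop_slice (F x) bk)"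
  by (rule additive_sum(2)) (rule hdop_slice_simps)

lemma hdop_coeff_simps:
  "hdop_coeff 0 e = 0"
  "hdop_coeff (H + H') e = hdop_coeff H e + hdop_coeff H' e"
  "hdop_coeff (- H) e = - hdop_coeff H e"
  "hdop_coeff (H - H') e = hdop_coeff H e - hdop_coeff H' e"
  by (cases e; simp add: hdop_coeff_slice hdop_slice_simps cps_nth_0 cps_nth_add cps_nth_uminus
      cps_nth_diff)+

lemma hdop_coeff_sum: "hdop_coeff (\<Sum>x\<in>A. F x) e = (\<Sum>x\<in>A. hdop_coeff (F x) e)"
  by (rule additive_sum(2)) (rule hdop_coeff_simps)

lemma hdop_slice_const_mult: "hdop_slice (hdop_const c * H) bk = c * hdop_slice H bk"
  by (cases H) (simp add: hdop_slice_def split_def hdop_const_def times_hdop.abs_eq Abs_hdop_inverse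
      zpoly.mult_const_left lookup_ore_scale del: lookup_single)

lemma hdop_coeff_z_mult:
  "hdop_coeff (hdop_z * H) (a, b, k) = (case k of 0 \<Rightarrow> 0 | Suc k' \<Rightarrow> hdop_coeff H (a, b, k'))"
  by (cases H) (auto simp: hdop_coeff_def hdop_z_def times_hdop.abs_eq Abs_hdop_inverse
      zpoly.mult_const_left lookup_ore_scale coeff_pCons cps_nth_0 split: nat.splits)

lemma hdop_coeff_pd_mult:
  "hdop_coeff (hdop_pd i * H) (a, b, k) =
    (if b i = 0 then 0 else hdop_coeff H (a, b(i := b i - 1), k)) +
    (case k of 0 \<Rightarrow> 0 | Suc k' \<Rightarrow> of_nat (Suc (a i)) * hdop_coeff H (a(i := Suc (a i)), b, k'))"
  by (cases H) (auto simp: hdop_coeff_def hdop_pd_def times_hdop.abs_eq Abs_hdop_inverse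
      zpoly.mult_pd_left zpoly.lookup_ore_left coeff_zpoly_pd cps_nth_0 cps_nth_add cps_pd.rep_eq
      simp del: of_nat_Suc One_nat_def split: nat.splits)

definition hdop_of_slices :: "(('v::finite \<Rightarrow> nat) \<times> nat) set \<Rightarrow> (('v \<Rightarrow> nat) \<times> nat \<Rightarrow> 'v cps) \<Rightarrow> 'v hdop" where
  "hdop_of_slices B f = (\<Sum>(b, k)\<in>B. Abs_hdop (Poly_Mapping.single b (monom (f (b, k)) k)))"

lemma hdop_slice_of_slices:
  assumes "finite B"
  shows "hdop_slice (hdop_of_slices B f) bk = (if bk \<in> B then f bk else 0)"
proof -
  have "hdop_slice (hdop_of_slices B f) bk = (\<Sum>x\<in>B. if x = bk then f x else 0)"
    unfolding hdop_of_slices_def hdop_slice_sum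
    by (intro sum.cong refl) (auto simp: hdop_slice_def Abs_hdop_inverse lookup_single when_def split_def prod_eq_iff)
  then show ?thesis using assms by simp
qed

section \<open>Newton diagrams and restriction to sets of exponents\<close>

lemma diagram_iff: "e \<in> hdop_diagram H \<longleftrightarrow> hdop_coeff H e \<noteq> 0"
  by (simp add: hdop_diagram_def)

lemma diagram_eq_empty: "hdop_diagram H = {} \<longleftrightarrow> H = 0"
  by (auto simp: diagram_iff hdop_coeff_simps set_eq_iff intro!: hdop_eqI)

lemma diagram_add: "hdop_diagram (H + H') \<subseteq> hdop_diagram H \<union> hdop_diagram H'"
  by (auto simp: diagram_iff hdop_coeff_simps)

lemma diagram_diff: "hdop_diagram (H - H') \<subseteq> hdop_diagram H \<union> hdop_diagram H'"
  by (auto simp: diagram_iff hdop_coeff_simps)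

lemma diagram_sum: "hdop_diagram (\<Sum>x\<in>A. F x) \<subseteq> (\<Union>x\<in>A. hdop_diagram (F x))"
  by (auto simp: diagram_iff hdop_coeff_sum elim!: sum.not_neutral_contains_not_neutral)

lemma diagram_restrict: "hdop_diagram (hdop_restrict X H) = hdop_diagram H \<inter> X"
  by (auto simp: diagram_iff hdop_coeff_restrict split: if_splits)

lemma restrict_add: "hdop_restrict X (H + H') = hdop_restrict X H + hdop_restrict X H'"
  by (rule hdop_eqI) (simp add: hdop_coeff_restrict hdop_coeff_simps)

lemma restrict_sum: "hdop_restrict X (\<Sum>x\<in>A. F x) = (\<Sum>x\<in>A. hdop_restrict X (F x))"
  by (rule additive_sum(2)) (rule restrict_add)

lemma restrict_0: "hdop_restrict X 0 = 0"
  by (rule additive_sum(1)) (rule restrict_add)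

lemma restrict_split: "H = hdop_restrict X H + hdop_restrict (- X) H"
  by (rule hdop_eqI) (simp add: hdop_coeff_restrict hdop_coeff_simps)

lemma restrict_id: "hdop_diagram H \<subseteq> X \<Longrightarrow> hdop_restrict X H = H"
  by (rule hdop_eqI) (auto simp: hdop_coeff_restrict diagram_iff)

lemma restrict_eq_0: "hdop_diagram H \<inter> X = {} \<Longrightarrow> hdop_restrict X H = 0"
  by (rule hdop_eqI) (auto simp: hdop_coeff_restrict hdop_coeff_simps diagram_iff)

lemma restrict_restrict: "hdop_restrict X (hdop_restrict Y H) = hdop_restrict (X \<inter> Y) H"
  by (rule hdop_eqI) (simp add: hdop_coeff_restrict)

text \<open>A multigrading of the homogenized ring in which \<open>\<partial>\<^sub>i\<close> and
  \<open>y\<^sub>i\<close> have opposite weights. Every \<open>lin_form L\<close> and the degree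
  factor through it, so one statement about products serves all of them.\<close>

definition expo_sig :: "'v::finite expo \<Rightarrow> ('v \<Rightarrow> int) \<times> nat" where
  "expo_sig = (\<lambda>(a, b, k). (\<lambda>i. int (b i) - int (a i), (\<Sum>i\<in>UNIV. b i) + k))"

lemma expo_sig_add: "expo_sig (e + e') = expo_sig e + expo_sig e'"
  by (cases e; cases e') (auto simp: expo_sig_def fun_eq_iff sum.distrib)

text \<open>The relation \<open>[\<partial>\<^sub>y, y] = z\<close> is homogeneous for \<open>expo_sig\<close>.\<close>

lemma diagram_mult:
  assumes "e \<in> hdop_diagram (P * Q)"
  shows "\<exists>e1\<in>hdop_diagram P. \<exists>e2\<in>hdop_diagram Q. expo_sig e = expo_sig e1 + expo_sig e2"
proof -
  define pc where "pc Q = (\<lambda>(a, b, k). cps_nth (poly.coeff (Poly_Mapping.lookup Q b) k) a)"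
    for Q :: "('a \<Rightarrow> nat) \<Rightarrow>\<^sub>0 'a cps poly"
  have pc: "hdop_coeff P = pc (hdop_expansion P)" for P :: "'a hdop"
    by (simp add: hdop_coeff_def pc_def)
  have unit: "(\<Sum>x\<in>UNIV. if x = i then Suc 0 else (0 :: 'a \<Rightarrow> nat) x) = 1" for i
    by (subst sum.remove[of UNIV i]) auto
  \<comment> \<open>Left multiplication by \<open>\<partial>\<^sub>i\<close> either raises the power
    of \<open>\<partial>\<^sub>i\<close> or differentiates and adds a \<open>z\<close>; both change
    the signature in the same way.\<close>
  have left: "\<exists>e'. pc Q e' \<noteq> 0 \<and> expo_sig e = expo_sig e' + expo_sig (0, 0(i := 1), 0)"
    if nz: "pc (ore_left zpoly_pd i Q) e \<noteq> 0" for Q e i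
  proof -
    obtain a b k where e: "e = (a, b, k)" by (cases e)
    consider "b i \<noteq> 0" "pc Q (a, b(i := b i - 1), k) \<noteq> 0"
      | k' where "k = Suc k'" "pc Q (a(i := Suc (a i)), b, k') \<noteq> 0"
      using nz by (fastforce simp: e pc_def zpoly.lookup_ore_left coeff_zpoly_pd cps_nth_add cps_nth_0
          cps_pd.rep_eq simp del: of_nat_Suc split: if_splits nat.splits)
    then show ?thesis
    proof cases
      case 1
      have "sum b UNIV = Suc (sum (b(i := b i - 1)) UNIV)"
        using 1(1) by (subst (1 2) sum.remove[of UNIV i]) auto
      then show ?thesis using 1
        by (intro exI[of _ "(a, b(i := b i - 1), k)"]) (auto simp: e expo_sig_def fun_eq_iff unit)
    next
      case 2
      then show ?thesis
        by (intro exI[of _ "(a(i := Suc (a i)), b, k')"]) (auto simp: e expo_sig_def fun_eq_iff unit)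
    qed
  qed
  have pow: "\<exists>e'. pc Q e' \<noteq> 0 \<and> expo_sig e = expo_sig e' + expo_sig (0, \<beta>, 0)"
    if "pc (ore_left_pow zpoly_pd \<beta> Q) e \<noteq> 0" for Q e \<beta>
    using that
  proof (induction \<beta> arbitrary: e rule: zpoly.multi_index_induct)
    case zero
    then have "pc Q e \<noteq> 0 \<and> expo_sig e = expo_sig e + expo_sig (0, 0, 0)"
      by (simp only: zpoly.left_pow_0) (simp add: expo_sig_def fun_eq_iff prod_eq_iff)
    then show ?case by blast
  next
    case (Suc \<beta> i)
    obtain e1 where e1: "pc (ore_left_pow zpoly_pd \<beta> Q) e1 \<noteq> 0"
        "expo_sig e = expo_sig e1 + expo_sig (0, 0(i := 1), 0)"
      using left[OF Suc.prems[unfolded zpoly.left_pow_Suc]] by blast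
    obtain e2 where e2: "pc Q e2 \<noteq> 0" "expo_sig e1 = expo_sig e2 + expo_sig (0, \<beta>, 0)"
      using Suc.IH[OF e1(1)] by blast
    have "\<beta>(i := Suc (\<beta> i)) = \<beta> + 0(i := 1)" by (auto simp: fun_eq_iff)
    then have "expo_sig (0, \<beta>(i := Suc (\<beta> i)), 0) = expo_sig ((0, \<beta>, 0) + (0, 0(i := 1), 0))"
      by simp
    then have "expo_sig e = expo_sig e2 + expo_sig (0, \<beta>(i := Suc (\<beta> i)), 0)"
      using e1(2) e2(2) by (simp only: expo_sig_add add.assoc)
    then show ?case using e2(1) by blast
  qed
  have "pc (hdop_expansion (P * Q)) e \<noteq> 0" using assms by (simp add: diagram_iff pc)
  then have "(\<Sum>\<beta>\<in>Poly_Mapping.keys (hdop_expansion P).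
      pc (ore_scale (Poly_Mapping.lookup (hdop_expansion P) \<beta>) (ore_left_pow zpoly_pd \<beta> (hdop_expansion Q))) e) \<noteq> 0"
    unfolding times_hdop.rep_eq ore_mult_def
    by (subst additive_sum(2)[where F = "\<lambda>Q. pc Q e", symmetric])
       (auto simp: pc_def lookup_add cps_nth_add split: prod.split)
  then obtain \<beta> where "pc (ore_scale (Poly_Mapping.lookup (hdop_expansion P) \<beta>)
      (ore_left_pow zpoly_pd \<beta> (hdop_expansion Q))) e \<noteq> 0"
    by (rule sum.not_neutral_contains_not_neutral)
  moreover obtain a b k where e: "e = (a, b, k)" by (cases e)
  moreover define p where "p = Poly_Mapping.lookup (hdop_expansion P) \<beta>"
  moreover define q where "q = Poly_Mapping.lookup (ore_left_pow zpoly_pd \<beta> (hdop_expansion Q)) b"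
  ultimately have "cps_nth (\<Sum>j\<le>k. poly.coeff p j * poly.coeff q (k - j)) a \<noteq> 0"
    by (simp add: pc_def lookup_ore_scale coeff_mult)
  then have "(\<Sum>j\<le>k. cps_nth (poly.coeff p j * poly.coeff q (k - j)) a) \<noteq> 0"
    by (subst additive_sum(2)[where F = "\<lambda>f. cps_nth f a", symmetric]) (auto simp: cps_nth_add)
  then obtain j where j: "j \<le> k" "cps_nth (poly.coeff p j * poly.coeff q (k - j)) a \<noteq> 0"
    by (metis (mono_tags, lifting) atMost_iff sum.not_neutral_contains_not_neutral)
  then have "(\<Sum>(c, d) | c + d = a. cps_nth (poly.coeff p j) c * cps_nth (poly.coeff q (k - j)) d) \<noteq> 0"
    by (simp add: times_cps.rep_eq)
  then obtain cd where cd: "fst cd + snd cd = a" "cps_nth (poly.coeff p j) (fst cd) \<noteq> 0"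
      "cps_nth (poly.coeff q (k - j)) (snd cd) \<noteq> 0"
    by (rule sum.not_neutral_contains_not_neutral) auto
  obtain c d where [simp]: "cd = (c, d)" by (cases cd)
  have "pc (ore_left_pow zpoly_pd \<beta> (hdop_expansion Q)) (d, b, k - j) \<noteq> 0"
    using cd by (simp add: pc_def q_def)
  then obtain e2 where e2: "pc (hdop_expansion Q) e2 \<noteq> 0"
      "expo_sig (d, b, k - j) = expo_sig e2 + expo_sig (0, \<beta>, 0)"
    using pow by blast
  have "(c, \<beta>, j) \<in> hdop_diagram P" using cd by (simp add: diagram_iff pc pc_def p_def)
  moreover have "e2 \<in> hdop_diagram Q" using e2 by (simp add: diagram_iff pc)
  moreover have "expo_sig e = expo_sig (c, \<beta>, j) + expo_sig e2"
  proof -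
    have "e = (c, 0, j) + (d, b, k - j)" using e cd(1) j(1) by simp
    then have "expo_sig e = expo_sig ((c, 0, j) + (0, \<beta>, 0)) + expo_sig e2"
      by (simp only: expo_sig_add e2(2) add_ac)
    then show ?thesis by simp
  qed
  ultimately show ?thesis by blast
qed

definition expo_deg :: "'v::finite expo \<Rightarrow> nat" where
  "expo_deg e = snd (expo_sig e)"

lemma expo_deg_simp: "expo_deg (a, b, k) = (\<Sum>i\<in>UNIV. b i) + k"
  by (simp add: expo_deg_def expo_sig_def)

lemma expo_deg_sig: "expo_sig e = expo_sig e1 + expo_sig e2 \<Longrightarrow> expo_deg e = expo_deg e1 + expo_deg e2"
  by (simp add: expo_deg_def)

lemma lin_form_expo_sig:
  "lin_form L (e :: ('n::finite + 'p::finite) expo) = (\<Sum>j\<in>UNIV. L $ j * real_of_int (fst (expo_sig e) (Inr j)))"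
  by (cases e) (simp add: lin_form_def V_form_def expo_sig_def)

lemma lin_form_sig:
  fixes e :: "('n::finite + 'p::finite) expo"
  shows "expo_sig e = expo_sig e1 + expo_sig e2 \<Longrightarrow> lin_form L e = lin_form L e1 + lin_form L e2"
  by (simp add: lin_form_expo_sig distrib_left sum.distrib)

lemma lin_form_add:
  "lin_form L (e + e') = lin_form L e + lin_form L (e' :: ('n::finite + 'p::finite) expo)"
  by (rule lin_form_sig) (rule expo_sig_add)

text \<open>The second assumption says that no other pair of terms reaches the value
  \<open>c\<close>. This holds for the top parts of two factors, whose values are bounded, and also
  if one factor is homogeneous for \<open>\<omega>\<close>.\<close>

lemma restrict_mult:
  assumes \<omega>: "\<And>e e1 e2. expo_sig e = expo_sig e1 + expo_sig e2 \<Longrightarrow> \<omega> e = (\<omega> e1 + \<omega> e2 :: 'm::plus)"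
    and XY: "\<And>e1 e2. e1 \<in> hdop_diagram A \<Longrightarrow> e2 \<in> hdop_diagram H \<Longrightarrow> \<omega> e1 + \<omega> e2 = c \<longleftrightarrow> e1 \<in> X \<and> e2 \<in> Y"
  shows "hdop_restrict {e. \<omega> e = c} (A * H) = hdop_restrict X A * hdop_restrict Y H"
proof -
  define A1 A2 where "A1 = hdop_restrict X A" and "A2 = hdop_restrict (- X) A"
  define H1 H2 where "H1 = hdop_restrict Y H" and "H2 = hdop_restrict (- Y) H"
  have "A = A1 + A2" "H = H1 + H2"
    unfolding A1_def A2_def H1_def H2_def by (fact restrict_split)+
  then have eq: "A * H = A1 * H1 + (A1 * H2 + A2 * H)"
    by (simp add: distrib_left distrib_right add.assoc)
  have dia: "hdop_diagram A1 = hdop_diagram A \<inter> X" "hdop_diagram A2 = hdop_diagram A - X"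
      "hdop_diagram H1 = hdop_diagram H \<inter> Y" "hdop_diagram H2 = hdop_diagram H - Y"
    by (auto simp: A1_def A2_def H1_def H2_def diagram_restrict)
  have key: "\<exists>e1\<in>hdop_diagram P. \<exists>e2\<in>hdop_diagram Q. \<omega> e = c \<longleftrightarrow> e1 \<in> X \<and> e2 \<in> Y"
    if pq: "e \<in> hdop_diagram (P * Q)" "hdop_diagram P \<subseteq> hdop_diagram A" "hdop_diagram Q \<subseteq> hdop_diagram H" for e P Q
  proof -
    obtain e1 e2 where e: "e1 \<in> hdop_diagram P" "e2 \<in> hdop_diagram Q" "expo_sig e = expo_sig e1 + expo_sig e2"
      using diagram_mult[OF pq(1)] by blast
    then have "\<omega> e = c \<longleftrightarrow> e1 \<in> X \<and> e2 \<in> Y"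
      using \<omega>[OF e(3)] XY[of e1 e2] pq(2,3) by auto
    then show ?thesis using e by blast
  qed
  have "hdop_restrict {e. \<omega> e = c} (A1 * H1) = A1 * H1"
    by (rule restrict_id) (use key[of _ A1 H1] in \<open>auto simp: dia\<close>)
  moreover have "hdop_restrict {e. \<omega> e = c} (A1 * H2) = 0"
    by (rule restrict_eq_0) (use key[of _ A1 H2] in \<open>auto simp: dia\<close>)
  moreover have "hdop_restrict {e. \<omega> e = c} (A2 * H) = 0"
    by (rule restrict_eq_0) (use key[of _ A2 H] in \<open>auto simp: dia\<close>)
  ultimately show ?thesis
    unfolding eq by (simp add: restrict_add A1_def H1_def)
qed

section \<open>Generated left ideals and graded rings\<close>

lemma left_ideal_gen_add:
  assumes R: "0 \<in> R" "\<And>a b. a \<in> R \<Longrightarrow> b \<in> R \<Longrightarrow> a + b \<in> R"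
    and "x \<in> left_ideal_gen R S" "y \<in> left_ideal_gen R S"
  shows "x + y \<in> left_ideal_gen R S"
proof -
  obtain F A where F: "finite F" "F \<subseteq> S" "\<And>P. P \<in> F \<Longrightarrow> A P \<in> R" "x = (\<Sum>P\<in>F. A P * P)"
    using assms(3) by (auto simp: left_ideal_gen_def)
  obtain G B where G: "finite G" "G \<subseteq> S" "\<And>P. P \<in> G \<Longrightarrow> B P \<in> R" "y = (\<Sum>P\<in>G. B P * P)"
    using assms(4) by (auto simp: left_ideal_gen_def)
  define A' where "A' P = (if P \<in> F then A P else 0)" for P
  define B' where "B' P = (if P \<in> G then B P else 0)" for P
  have "x = (\<Sum>P\<in>F \<union> G. A' P * P)" "y = (\<Sum>P\<in>F \<union> G. B' P * P)"
    unfolding F(4) G(4) by (auto simp: A'_def B'_def F(1) G(1) intro!: sum.mono_neutral_cong_left)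
  then have "x + y = (\<Sum>P\<in>F \<union> G. (A' P + B' P) * P)"
    by (simp add: distrib_right sum.distrib)
  moreover have "A' P + B' P \<in> R" if "P \<in> F \<union> G" for P
    using that R F(3) G(3) by (auto simp: A'_def B'_def)
  ultimately show ?thesis
    unfolding left_ideal_gen_def using F(1,2) G(1,2)
    by (intro CollectI exI[of _ "F \<union> G"] exI[of _ "\<lambda>P. A' P + B' P"]) auto
qed

lemma left_ideal_gen_0: "0 \<in> left_ideal_gen R S"
  unfolding left_ideal_gen_def by (intro CollectI exI[of _ "{}"]) auto

lemma left_ideal_gen_sum:
  assumes "0 \<in> R" "\<And>a b. a \<in> R \<Longrightarrow> b \<in> R \<Longrightarrow> a + b \<in> R"
    and "\<And>i. i \<in> I \<Longrightarrow> f i \<in> left_ideal_gen R S"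
  shows "(\<Sum>i\<in>I. f i) \<in> left_ideal_gen R S"
  using assms(3)
  by (induction I rule: infinite_finite_induct) (auto intro: left_ideal_gen_0 left_ideal_gen_add[OF assms(1,2)])

lemma left_ideal_gen_mult:
  assumes "\<And>a b. a \<in> R \<Longrightarrow> b \<in> R \<Longrightarrow> a * b \<in> R" "a \<in> R" "x \<in> left_ideal_gen R S"
  shows "a * x \<in> left_ideal_gen R S"
proof -
  obtain F A where F: "finite F" "F \<subseteq> S" "\<And>P. P \<in> F \<Longrightarrow> A P \<in> R" "x = (\<Sum>P\<in>F. A P * P)"
    using assms(3) by (auto simp: left_ideal_gen_def)
  then show ?thesis
    unfolding left_ideal_gen_def using assms(1,2)
    by (intro CollectI exI[of _ F] exI[of _ "\<lambda>P. a * A P"]) (auto simp: sum_distrib_left mult.assoc)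
qed

lemma left_ideal_gen_generator: "a \<in> R \<Longrightarrow> P \<in> S \<Longrightarrow> a * P \<in> left_ideal_gen R S"
  unfolding left_ideal_gen_def by (intro CollectI exI[of _ "{P}"] exI[of _ "\<lambda>_. a"]) auto

lemma left_ideal_gen_least:
  assumes R: "0 \<in> R" "\<And>a b. a \<in> R \<Longrightarrow> b \<in> R \<Longrightarrow> a + b \<in> R" "\<And>a b. a \<in> R \<Longrightarrow> b \<in> R \<Longrightarrow> a * b \<in> R"
    and S: "S \<subseteq> left_ideal_gen R S'"
  shows "left_ideal_gen R S \<subseteq> left_ideal_gen R S'"
proof
  fix x assume "x \<in> left_ideal_gen R S"
  then obtain F A where F: "finite F" "F \<subseteq> S" "\<And>P. P \<in> F \<Longrightarrow> A P \<in> R" "x = (\<Sum>P\<in>F. A P * P)"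
    by (auto simp: left_ideal_gen_def)
  show "x \<in> left_ideal_gen R S'"
    unfolding F(4) using F(2,3) S
    by (intro left_ideal_gen_sum left_ideal_gen_mult R) auto
qed

lemma left_ideal_sum: "left_ideal J \<Longrightarrow> (\<And>i. i \<in> A \<Longrightarrow> f i \<in> J) \<Longrightarrow> (\<Sum>i\<in>A. f i) \<in> J"
  by (induction A rule: infinite_finite_induct) (auto simp: left_ideal_def)

lemma left_ideal_diff:
  assumes "left_ideal J" "P \<in> J" "Q \<in> J"
  shows "P - Q \<in> J"
proof -
  have "P + (-1) * Q \<in> J" using assms unfolding left_ideal_def by blast
  then show ?thesis by simp
qed

lemma left_ideal_gen_UNIV: "left_ideal (left_ideal_gen UNIV S)"
  unfolding left_ideal_def
  by (auto intro: left_ideal_gen_0 left_ideal_gen_add left_ideal_gen_mult)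

section \<open>Graded rings of operators polynomial in some variables\<close>

lemma finite_diagram_b: "\<exists>m. \<forall>(a, b, k)\<in>hdop_diagram P. \<forall>i. b i \<le> (m :: nat)"
proof -
  define B where "B = (\<lambda>(a, b, k). b) ` hdop_diagram P"
  have B: "finite B" unfolding B_def by (rule finite_hdop_diagram)
  define m where "m = Max (insert 0 (\<Union>b\<in>B. range b))"
  have "b i \<le> m" if "(a, b, k) \<in> hdop_diagram P" for a b k i
  proof -
    have "b \<in> B" unfolding B_def by (rule image_eqI[OF _ that]) simp
    then show ?thesis unfolding m_def using B by (intro Max_ge) auto
  qed
  then show ?thesis by blast
qed

lemma gr_ring_bound:
  "P \<in> gr_ring L \<longleftrightarrow> (\<forall>j. 0 < L $ j \<longrightarrow> (\<exists>m. \<forall>e\<in>hdop_diagram P. fst e (Inr j) \<le> m))"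
  by (fastforce simp: gr_ring_def)

lemma gr_ring_add: "P \<in> gr_ring L \<Longrightarrow> Q \<in> gr_ring L \<Longrightarrow> P + Q \<in> gr_ring L"
  unfolding gr_ring_bound
proof (intro allI impI)
  fix j assume PQ: "\<forall>j. 0 < L $ j \<longrightarrow> (\<exists>m. \<forall>e\<in>hdop_diagram P. fst e (Inr j) \<le> m)"
    "\<forall>j. 0 < L $ j \<longrightarrow> (\<exists>m. \<forall>e\<in>hdop_diagram Q. fst e (Inr j) \<le> m)" and j: "0 < L $ j"
  then obtain m m' where "\<forall>e\<in>hdop_diagram P. fst e (Inr j) \<le> m" "\<forall>e\<in>hdop_diagram Q. fst e (Inr j) \<le> m'"
    by blast
  then show "\<exists>m. \<forall>e\<in>hdop_diagram (P + Q). fst e (Inr j) \<le> m"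
    using diagram_add[of P Q] by (intro exI[of _ "max m m'"]) (fastforce simp: le_max_iff_disj)
qed

lemma gr_ring_0: "(0 :: ('n::finite + 'p::finite) hdop) \<in> gr_ring L"
  by (simp add: gr_ring_bound diagram_eq_empty[THEN iffD2])

lemma gr_ring_minus_one: "- 1 \<in> gr_ring L"
proof -
  have "hdop_coeff 1 (a, b, k) = 0" if "a \<noteq> 0" for a b :: "'a + 'b \<Rightarrow> nat" and k
    using that by (cases "k = 0")
      (auto simp: hdop_coeff_def one_hdop.rep_eq lookup_one when_def cps_nth_0 one_cps.rep_eq)
  then have "e \<in> hdop_diagram (- 1) \<Longrightarrow> fst e = 0" for e :: "('a + 'b) expo"
    by (cases e) (auto simp: diagram_iff hdop_coeff_simps)
  then show ?thesis by (auto simp: gr_ring_bound)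
qed

text \<open>Additivity of the signature bounds the exponent of \<open>t\<^sub>j\<close> in a product
  by those in the factors plus the power of the corresponding derivation, and the latter is bounded
  in every operator.\<close>

lemma gr_ring_mult:
  assumes "P \<in> gr_ring L" "Q \<in> gr_ring L"
  shows "P * Q \<in> gr_ring L"
  unfolding gr_ring_bound
proof (intro allI impI)
  fix j assume j: "0 < L $ j"
  obtain m1 where m1: "\<forall>e\<in>hdop_diagram P. fst e (Inr j) \<le> m1" using assms(1) j by (auto simp: gr_ring_bound)
  obtain m2 where m2: "\<forall>e\<in>hdop_diagram Q. fst e (Inr j) \<le> m2" using assms(2) j by (auto simp: gr_ring_bound)
  obtain m3 where m3: "\<forall>(a, b, k)\<in>hdop_diagram (P * Q). \<forall>i. b i \<le> m3" using finite_diagram_b by blast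
  show "\<exists>m. \<forall>e\<in>hdop_diagram (P * Q). fst e (Inr j) \<le> m"
  proof (intro exI[of _ "m1 + m2 + m3"] ballI)
    fix e assume e: "e \<in> hdop_diagram (P * Q)"
    then obtain e1 e2 where e12: "e1 \<in> hdop_diagram P" "e2 \<in> hdop_diagram Q" "expo_sig e = expo_sig e1 + expo_sig e2"
      using diagram_mult by blast
    obtain a b k a1 b1 k1 a2 b2 k2 where [simp]: "e = (a, b, k)" "e1 = (a1, b1, k1)" "e2 = (a2, b2, k2)"
      by (metis prod.exhaust)
    have "int (b (Inr j)) - int (a (Inr j)) = (int (b1 (Inr j)) - int (a1 (Inr j))) + (int (b2 (Inr j)) - int (a2 (Inr j)))"
      using e12(3) by (auto simp: expo_sig_def dest: fun_cong[of _ _ "Inr j"])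
    moreover have "a1 (Inr j) \<le> m1" "a2 (Inr j) \<le> m2" "b (Inr j) \<le> m3"
      using m1 m2 m3 e e12(1,2) by auto
    ultimately show "fst e (Inr j) \<le> m1 + m2 + m3" by simp
  qed
qed

text \<open>On a level set of \<open>L\<close> the \<open>L\<close>-weighted sum of the exponents of
  \<open>t\<close> is the one of the derivations minus \<open>c\<close>, and the derivations have
  bounded powers.\<close>

lemma restrict_in_gr_ring:
  assumes L: "L \<in> U_V"
  shows "hdop_restrict {e. lin_form L e = c} P \<in> gr_ring L"
  unfolding gr_ring_bound
proof (intro allI impI)
  fix j assume j: "0 < L $ j"
  have L0: "0 \<le> L $ j" for j using L by (simp add: U_V_def)
  obtain m where m: "\<forall>(a, b, k)\<in>hdop_diagram P. \<forall>i. b i \<le> m" using finite_diagram_b by blast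
  define K where "K = ((\<Sum>j\<in>UNIV. L $ j * real m) - c) / L $ j"
  show "\<exists>m. \<forall>e\<in>hdop_diagram (hdop_restrict {e. lin_form L e = c} P). fst e (Inr j) \<le> m"
  proof (intro exI[of _ "nat \<lceil>K\<rceil>"] ballI)
    fix e assume e: "e \<in> hdop_diagram (hdop_restrict {e. lin_form L e = c} P)"
    obtain a b k where [simp]: "e = (a, b, k)" by (cases e)
    have c: "(\<Sum>j\<in>UNIV. L $ j * real (b (Inr j))) - (\<Sum>j\<in>UNIV. L $ j * real (a (Inr j))) = c"
      using e by (simp add: diagram_restrict lin_form_def V_form_def right_diff_distrib sum_subtractf)
    have "L $ j * real (a (Inr j)) \<le> (\<Sum>j\<in>UNIV. L $ j * real (a (Inr j)))"
      using L0 by (intro member_le_sum) auto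
    moreover have "(\<Sum>j\<in>UNIV. L $ j * real (b (Inr j))) \<le> (\<Sum>j\<in>UNIV. L $ j * real m)"
      using L0 m e by (intro sum_mono mult_left_mono) (auto simp: diagram_restrict)
    ultimately have "L $ j * real (a (Inr j)) \<le> (\<Sum>j\<in>UNIV. L $ j * real m) - c"
      using c by linarith
    then have "real (a (Inr j)) \<le> K" using j by (simp add: K_def field_simps)
    then show "fst e (Inr j) \<le> nat \<lceil>K\<rceil>" by simp linarith
  qed
qed

lemmas gr_ring_closed = gr_ring_0 gr_ring_add gr_ring_mult

lemma gr_ideal_diff:
  assumes "P \<in> gr_ideal L J" "Q \<in> gr_ideal L J"
  shows "P - Q \<in> gr_ideal L J"
proof -
  have "P + (- 1) * Q \<in> gr_ideal L J"
    unfolding gr_ideal_def using assms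
    by (intro left_ideal_gen_add left_ideal_gen_mult gr_ring_closed gr_ring_minus_one) (auto simp: gr_ideal_def)
  then show ?thesis by simp
qed

section \<open>Leading exponents\<close>

lemma prime_power_prod_inj:
  fixes s :: "'x::finite \<Rightarrow> nat"
  assumes s: "inj s" "\<And>x. prime (s x)"
    and eq: "(\<Prod>x\<in>UNIV. s x ^ c x) = (\<Prod>x\<in>UNIV. s x ^ c' x)"
  shows "c = c'"
proof
  fix x
  have "multiplicity (s x) (\<Prod>x\<in>UNIV. s x ^ c x) = c x" for c
  proof -
    have "(\<Prod>x\<in>UNIV. s x ^ c x) = (\<Prod>y\<in>range s. y ^ c (inv s y))"
      using s(1) by (subst prod.reindex) (auto simp: o_def)
    moreover have "multiplicity (s x) (\<Prod>y\<in>range s. y ^ c (inv s y)) = c x"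
      using s by (subst multiplicity_prod_prime_powers) auto
    ultimately show ?thesis by simp
  qed
  then show "c x = c' x" using eq by metis
qed

lemma ex_prime_injection:
  obtains p :: "'x::finite \<Rightarrow> nat" where "inj p" "\<And>x. prime (p x)" "\<And>x. m < p x"
proof -
  have "infinite {p :: nat. prime p \<and> m < p}"
  proof
    assume "finite {p :: nat. prime p \<and> m < p}"
    then have "finite ({p. prime p \<and> m < p} \<union> {..m})" by simp
    moreover have "{p. prime p} \<subseteq> {p. prime p \<and> m < p} \<union> {..m}" by auto
    ultimately have "finite {p :: nat. prime p}" by (rule rev_finite_subset)
    then show False using primes_infinite by simp
  qed
  then obtain B where B: "finite B" "card B = CARD('x)" "B \<subseteq> {p :: nat. prime p \<and> m < p}"
    using infinite_arbitrarily_large by blast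
  then obtain p where "bij_betw p (UNIV :: 'x set) B"
    using finite_same_card_bij[of "UNIV :: 'x set" B] by auto
  then show ?thesis
    using B(3) by (intro that[of p]) (auto simp: bij_betw_def)
qed

text \<open>Moving the subtracted terms across turns an equality of differences into
  \<open>W a b' = W a' b\<close>, an equality of products of primes. All primes used for
  \<open>mu\<close> lie above those used for \<open>lam\<close>, which gives
  \<open>lam i < mu i\<close>.\<close>

lemma ex_tie_weights:
  obtains lam mu :: "'v::finite \<Rightarrow> real" where "\<And>i. 0 < lam i" "\<And>i. lam i < mu i"
    "\<And>a b a' b'. wsum lam a - wsum mu b = wsum lam a' - wsum mu b' \<Longrightarrow> a = a' \<and> b = b'"
proof -
  obtain p :: "'v \<Rightarrow> nat" where p: "inj p" "\<And>x. prime (p x)" "\<And>x. 1 < p x" by (rule ex_prime_injection[of 1]) blast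
  obtain q :: "'v \<Rightarrow> nat" where q: "inj q" "\<And>x. prime (q x)" "\<And>x. Max (range p) < q x" by (rule ex_prime_injection[of "Max (range p)"]) blast
  have pq: "p x < q y" for x y
    using q(3)[of y] Max_ge[of "range p" "p x"] by auto
  have pos: "0 < p x" "0 < q x" for x
    using p(3)[of x] pq[of x x] by linarith+
  \<comment> \<open>the weights are logarithms of distinct primes, generic by unique factorization\<close>
  define s where "s = case_sum p q"
  have s: "inj s" "\<And>x. prime (s x)"
    using p q pq by (auto simp: s_def inj_def split: sum.splits dest: less_imp_neq) (metis less_irrefl)+
  define W where "W a b = (\<Prod>i\<in>UNIV. p i ^ a i) * (\<Prod>i\<in>UNIV. q i ^ b i)" for a b
  have W: "W a b = (\<Prod>x\<in>UNIV. s x ^ case_sum a b x)" for a b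
    unfolding UNIV_Plus_UNIV[symmetric] by (subst prod.Plus) (simp_all add: W_def s_def)
  have lnW: "ln (real (W a b)) = wsum (\<lambda>i. ln (real (p i))) a + wsum (\<lambda>i. ln (real (q i))) b" for a b
  proof -
    have "ln (real (W a b)) = ln (\<Prod>i\<in>UNIV. real (p i) ^ a i) + ln (\<Prod>i\<in>UNIV. real (q i) ^ b i)"
      unfolding W_def of_nat_mult of_nat_prod of_nat_power using pos
      by (intro ln_mult_pos prod_pos) auto
    then show ?thesis
      using pos by (simp add: wsum_def ln_prod ln_realpow mult.commute)
  qed
  show ?thesis
  proof (rule that[of "\<lambda>i. ln (real (p i))" "\<lambda>i. ln (real (q i))"])
    show "0 < ln (real (p i))" for i using p(3)[of i] by simp
    show "ln (real (p i)) < ln (real (q i))" for i using pq[of i i] pos by simp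
    fix a b a' b'
    assume "wsum (\<lambda>i. ln (real (p i))) a - wsum (\<lambda>i. ln (real (q i))) b =
      wsum (\<lambda>i. ln (real (p i))) a' - wsum (\<lambda>i. ln (real (q i))) b'"
    then have "ln (real (W a b')) = ln (real (W a' b))" by (simp add: lnW)
    moreover have "0 < W a b'" "0 < W a' b" using pos by (auto simp: W_def intro!: prod_pos)
    ultimately have "W a b' = W a' b" by simp
    then have "case_sum a b' = case_sum a' b" unfolding W by (rule prime_power_prod_inj[OF s])
    then have "case_sum a b' (Inl x) = case_sum a' b (Inl x)" "case_sum a b' (Inr x) = case_sum a' b (Inr x)" for x
      by simp_all
    then show "a = a' \<and> b = b'" by (simp add: fun_eq_iff)
  qed
qed

section \<open>Exponents of one degree and their order\<close>

definition slices :: "nat \<Rightarrow> (('v::finite \<Rightarrow> nat) \<times> nat) set" where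
  "slices d = {(b, k). (\<Sum>i\<in>UNIV. b i) + k = d}"

lemma finite_slices: "finite (slices d :: (('v::finite \<Rightarrow> nat) \<times> nat) set)"
proof (rule finite_subset)
  show "slices d \<subseteq> {b :: 'v \<Rightarrow> nat. b \<le> (\<lambda>_. d)} \<times> {..d}"
  proof
    fix x :: "('v \<Rightarrow> nat) \<times> nat" assume "x \<in> slices d"
    then obtain b k where x: "x = (b, k)" "sum b UNIV + k = d" by (auto simp: slices_def)
    have "b i \<le> d" for i using member_le_sum[of i UNIV b] x(2) by simp
    then show "x \<in> {b. b \<le> (\<lambda>_. d)} \<times> {..d}" using x by (auto simp: le_fun_def)
  qed
qed (simp add: finite_multi_le)

lemma in_slices: "bk \<in> slices d \<longleftrightarrow> expo_deg (a, bk) = d"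
  by (cases bk) (simp add: slices_def expo_deg_simp)

text \<open>
  For a form \<open>L\<close>, exponents are compared by the largest value of \<open>L\<close> first and then by the smallest
  value of a generic linear form.  The assumption \<open>lam i < mu i\<close> makes the first term of
  \<open>\<partial>\<^sub>i y\<^sub>i = y\<^sub>i \<partial>\<^sub>i + z\<close> the leading one.
\<close>

locale tie_break =
  fixes lam mu :: "'n::finite + 'p::finite \<Rightarrow> real"
  assumes lam_pos: "0 < lam i" and lam_mu: "lam i < mu i"
    and weights_inj: "wsum lam a - wsum mu b = wsum lam a' - wsum mu b' \<Longrightarrow> a = a' \<and> b = b'"
begin

text \<open>The power of \<open>z\<close> is left out because the degree and \<open>b\<close>
  determine it.\<close>

definition tie :: "('n + 'p) expo \<Rightarrow> real" where
  "tie = (\<lambda>(a, b, k). wsum lam a - wsum mu b)"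

definition before :: "real^'p \<Rightarrow> ('n + 'p) expo \<Rightarrow> ('n + 'p) expo \<Rightarrow> bool" where
  "before L e e' \<longleftrightarrow> lin_form L e' < lin_form L e \<or> lin_form L e' = lin_form L e \<and> tie e < tie e'"

definition leads :: "real^'p \<Rightarrow> ('n + 'p) hdop \<Rightarrow> ('n + 'p) expo \<Rightarrow> bool" where
  "leads L H e \<longleftrightarrow> e \<in> hdop_diagram H \<and> (\<forall>e'\<in>hdop_diagram H. e' \<noteq> e \<longrightarrow> before L e e')"

lemma tie_add: "tie (e + e') = tie e + tie e'"
  by (cases e; cases e') (simp add: tie_def wsum_add)

lemma tie_inj: "tie e = tie e' \<Longrightarrow> expo_deg e = expo_deg e' \<Longrightarrow> e = e'"
  by (cases e; cases e') (auto simp: tie_def expo_deg_simp dest: weights_inj)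

lemma before_add: "before L (e + s) (e' + s) \<longleftrightarrow> before L e e'"
  by (simp add: before_def tie_add lin_form_add)

lemma before_trans: "before L e e' \<Longrightarrow> before L e' e'' \<Longrightarrow> before L e e''"
  by (auto simp: before_def)

text \<open>A fixed degree leaves finitely many \<open>b\<close>. Without it the set could be
  infinite, since \<open>tie\<close> is negative on the derivations.\<close>

lemma finite_tie_le: "finite {e. expo_deg e = d \<and> tie e \<le> c}"
proof (rule finite_subset)
  show "{e. expo_deg e = d \<and> tie e \<le> c}
      \<subseteq> (\<lambda>((b, k), a). (a, b, k)) ` (SIGMA bk:slices d. {a. wsum lam a \<le> c + wsum mu (fst bk)})"
    by (force simp: tie_def slices_def expo_deg_simp)
  show "finite ((\<lambda>((b, k), a). (a, b, k)) ` (SIGMA bk:slices d. {a. wsum lam a \<le> c + wsum mu (fst bk)}))"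
    by (intro finite_imageI finite_SigmaI finite_slices finite_wsum_le lam_pos)
qed

lemma ex_min_tie:
  assumes "e0 \<in> T" "\<And>e. e \<in> T \<Longrightarrow> expo_deg e = d"
  shows "\<exists>e\<in>T. \<forall>e'\<in>T. e' \<noteq> e \<longrightarrow> tie e < tie e'"
proof -
  define T' where "T' = {e \<in> T. tie e \<le> tie e0}"
  have fin: "finite T'"
    by (rule finite_subset[OF _ finite_tie_le[of d "tie e0"]]) (use assms in \<open>auto simp: T'_def\<close>)
  have "e0 \<in> T'" using assms(1) by (simp add: T'_def)
  then have "T' \<noteq> {}" by blast
  then have "\<exists>e. is_arg_min tie (\<lambda>x. x \<in> T') e" by (rule ex_is_arg_min_if_finite[OF fin])
  then obtain e where e: "e \<in> T'" "\<And>e'. e' \<in> T' \<Longrightarrow> tie e \<le> tie e'"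
    unfolding is_arg_min_linorder by blast
  have less: "tie e < tie e'" if e': "e' \<in> T" "e' \<noteq> e" for e'
  proof (rule ccontr)
    assume *: "\<not> tie e < tie e'"
    then have "e' \<in> T'" using e(1) e' by (auto simp: T'_def)
    then have "tie e = tie e'" using e(2) * by fastforce
    moreover have "e \<in> T" using e(1) by (simp add: T'_def)
    ultimately show False using tie_inj[of e e'] assms(2) e' by simp
  qed
  have "e \<in> T" using e(1) by (simp add: T'_def)
  with less show ?thesis by blast
qed

lemma ex_leads:
  assumes L: "L \<in> U_V" and H: "H \<noteq> 0" "\<And>e. e \<in> hdop_diagram H \<Longrightarrow> expo_deg e = d"
  shows "\<exists>e. leads L H e"
proof -
  have "\<exists>e\<in>hdop_diagram H. hdop_ord L H = ereal (lin_form L e)"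
    unfolding hdop_ord_def using H(1)
    by (intro ord_diagram_attained L finite_hdop_diagram) (simp add: diagram_eq_empty)
  then obtain e0 where e0: "e0 \<in> hdop_diagram H" "hdop_ord L H = ereal (lin_form L e0)" by blast
  have le: "lin_form L e \<le> lin_form L e0" if "e \<in> hdop_diagram H" for e
  proof -
    have "ereal (lin_form L e) \<le> hdop_ord L H"
      unfolding hdop_ord_def ord_diagram_def using that by (rule SUP_upper)
    then show ?thesis using e0(2) by simp
  qed
  obtain e where e: "e \<in> {e \<in> hdop_diagram H. lin_form L e = lin_form L e0}"
    "\<forall>e'\<in>{e \<in> hdop_diagram H. lin_form L e = lin_form L e0}. e' \<noteq> e \<longrightarrow> tie e < tie e'"
    using ex_min_tie[of e0 "{e \<in> hdop_diagram H. lin_form L e = lin_form L e0}" d] e0 H(2) by auto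
  have "leads L H e"
    unfolding leads_def before_def using e le by (auto simp: less_le)
  then show ?thesis by blast
qed

lemma leads_z:
  assumes "leads L H e"
  shows "leads L (hdop_z * H) (e + (0, 0, 1))" "hdop_coeff (hdop_z * H) (e + (0, 0, 1)) = hdop_coeff H e"
proof -
  have mem: "(a, b, k) \<in> hdop_diagram (hdop_z * H) \<longleftrightarrow> (\<exists>k'. k = Suc k' \<and> (a, b, k') \<in> hdop_diagram H)" for a b k
    by (auto simp: diagram_iff hdop_coeff_z_mult split: nat.splits)
  obtain a b k where e: "e = (a, b, k)" by (cases e)
  show "hdop_coeff (hdop_z * H) (e + (0, 0, 1)) = hdop_coeff H e"
    by (simp add: e hdop_coeff_z_mult)
  have "before L (e + (0, 0, 1)) x" if xz: "x \<in> hdop_diagram (hdop_z * H)" "x \<noteq> e + (0, 0, 1)" for x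
  proof -
    obtain a' b' k' where x: "x = (a', b', k') + (0, 0, 1)" "(a', b', k') \<in> hdop_diagram H"
      using xz(1) mem by (cases x) auto
    show ?thesis unfolding x(1) before_add using assms x xz(2) by (auto simp: leads_def)
  qed
  then show "leads L (hdop_z * H) (e + (0, 0, 1))"
    using assms mem by (auto simp: leads_def e)
qed

lemma leads_pd:
  assumes "leads L H e"
  shows "leads L (hdop_pd i * H) (e + (0, 0(i := 1), 0))"
    "hdop_coeff (hdop_pd i * H) (e + (0, 0(i := 1), 0)) = hdop_coeff H e"
proof -
  define u :: "('n + 'p) expo" where "u = (0, 0(i := 1), 0)"
  obtain a b k where e: "e = (a, b, k)" by (cases e)
  \<comment> \<open>the second term of \<open>\<partial>\<^sub>i c = c \<partial>\<^sub>i + (\<partial>c/\<partial>y\<^sub>i) z\<close> comes later\<close>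
  have later: "before L ((a', b', k') + u) (a'(i := a' i - 1), b', Suc k')" if "a' i \<noteq> 0" for a' b' k'
  proof -
    define v :: "('n + 'p) expo" where "v = (0(i := 1), 0, 0)"
    define y :: "('n + 'p) expo" where "y = (a'(i := a' i - 1), b', Suc k')"
    have eq: "(a', b', k') + (0, 0, 1) = y + v"
      using that by (auto simp: y_def v_def fun_eq_iff)
    have w: "wsum w (0(i := 1)) = w i" for w :: "'n + 'p \<Rightarrow> real"
      unfolding wsum_def by (subst sum.remove[of UNIV i]) auto
    have "wsum w 0 = 0" for w :: "'n + 'p \<Rightarrow> real" by (simp add: wsum_def)
    then have t: "tie u = - mu i" "tie v = lam i" "tie (0, 0, 1) = 0"
      by (simp_all add: u_def v_def tie_def w del: One_nat_def)
    have l: "lin_form L (0, 0, 1) = 0" by (simp add: lin_form_def V_form_def)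
    have "lin_form L v = - lin_form L u"
      by (simp add: lin_form_def V_form_def u_def v_def flip: sum_negf)
    then have "lin_form L ((a', b', k') + u) = lin_form L y"
      using arg_cong[OF eq, of "lin_form L"] by (simp only: lin_form_add l)
    moreover have "tie ((a', b', k') + u) < tie y"
      using arg_cong[OF eq, of tie] lam_mu[of i] by (simp only: tie_add t)
    ultimately show ?thesis unfolding before_def y_def by simp
  qed
  \<comment> \<open>The coefficient at \<open>e + u\<close> could also receive the derivative of a
    term \<open>x\<close> of \<open>H\<close>. Then \<open>e + u\<close> would come before
    \<open>x + u\<close>, because \<open>e\<close> leads, and after it, by
    \<open>later\<close>.\<close>
  have "of_nat (Suc (a i)) * hdop_coeff H (a(i := Suc (a i)), b(i := Suc (b i)), k') = 0" if "k = Suc k'" for k'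
  proof (rule ccontr)
    define x where "x = (a(i := Suc (a i)), b(i := Suc (b i)), k')"
    assume "of_nat (Suc (a i)) * hdop_coeff H (a(i := Suc (a i)), b(i := Suc (b i)), k') \<noteq> 0"
    then have "x \<in> hdop_diagram H" by (auto simp: diagram_iff x_def)
    moreover have "x \<noteq> e" by (auto simp: x_def e fun_eq_iff)
    ultimately have "before L e x" using assms by (simp add: leads_def)
    then have "before L (e + u) (x + u)" by (simp add: before_add)
    moreover have "before L (x + u) (e + u)"
    proof -
      have "e + u = (a, b(i := Suc (b i)), Suc k')" using that by (auto simp: e u_def fun_eq_iff)
      then show ?thesis
        using later[of "a(i := Suc (a i))" "b(i := Suc (b i))" k'] by (simp add: x_def)
    qed
    ultimately show False by (auto simp: before_def)
  qed
  then show c: "hdop_coeff (hdop_pd i * H) (e + (0, 0(i := 1), 0)) = hdop_coeff H e"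
  proof -
    have 1: "e + (0, 0(i := 1), 0) = (a, b(i := Suc (b i)), k)" by (auto simp: e fun_eq_iff)
    show ?thesis
      unfolding 1 hdop_coeff_pd_mult using \<open>\<And>k'. k = Suc k' \<Longrightarrow> _\<close>
      by (auto simp: e simp del: of_nat_Suc split: nat.splits)
  qed
  show "leads L (hdop_pd i * H) (e + (0, 0(i := 1), 0))"
    unfolding leads_def
  proof (intro conjI ballI impI)
    show "e + (0, 0(i := 1), 0) \<in> hdop_diagram (hdop_pd i * H)"
      using assms unfolding diagram_iff c by (simp add: leads_def diagram_iff)
    fix x assume x: "x \<in> hdop_diagram (hdop_pd i * H)" "x \<noteq> e + (0, 0(i := 1), 0)"
    obtain a' b' k' where x': "x = (a', b', k')" by (cases x)
    consider "b' i \<noteq> 0" "hdop_coeff H (a', b'(i := b' i - 1), k') \<noteq> 0"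
      | k'' where "k' = Suc k''" "hdop_coeff H (a'(i := Suc (a' i)), b', k'') \<noteq> 0"
      using x(1) by (fastforce simp: x' diagram_iff hdop_coeff_pd_mult simp del: of_nat_Suc split: if_splits nat.splits)
    then show "before L (e + (0, 0(i := 1), 0)) x"
    proof cases
      case 1
      define y where "y = (a', b'(i := b' i - 1), k')"
      have y: "x = y + u" "y \<in> hdop_diagram H"
        using 1 by (auto simp: x' y_def u_def fun_eq_iff diagram_iff)
      then have "before L e y" using assms x(2) by (auto simp: leads_def u_def)
      then show ?thesis unfolding y(1) u_def[symmetric] before_add .
    next
      case 2
      define y where "y = (a'(i := Suc (a' i)), b', k'')"
      have "y \<in> hdop_diagram H" using 2 by (simp add: y_def diagram_iff)
      then have "y = e \<or> before L (e + u) (y + u)" using assms by (auto simp: leads_def before_add)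
      moreover have "before L (y + u) x"
        using later[of "a'(i := Suc (a' i))" b' k''] 2(1) by (simp add: y_def x')
      ultimately show ?thesis unfolding u_def[symmetric] using before_trans by blast
    qed
  qed
qed

end

section \<open>Multiplication by monomials\<close>

definition cps_monom :: "('v::finite \<Rightarrow> nat) \<Rightarrow> complex \<Rightarrow> 'v cps" where
  "cps_monom m z = Abs_cps (\<lambda>a. if a = m then z else 0)"

lemma cps_nth_monom: "cps_nth (cps_monom m z) a = (if a = m then z else 0)"
  unfolding cps_monom_def by (subst Abs_cps_inverse) (simp_all add: conv_series_single)

lemma cps_nth_monom_mult:
  "cps_nth (cps_monom m z * f) a = (if m \<le> a then z * cps_nth f (a - m) else 0)"
proof -
  have "(\<Sum>(b, c) | b + c = a. (if b = m then z else 0) * cps_nth f c)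
      = (\<Sum>(b, c)\<in>{(b, c). b = m \<and> c = a - m \<and> m \<le> a}. (if b = m then z else 0) * cps_nth f c)"
  proof (rule sum.mono_neutral_right[OF finite_multi_add])
    show "{(b, c). b = m \<and> c = a - m \<and> m \<le> a} \<subseteq> {(b, c). b + c = a}"
      by (auto simp: fun_eq_iff le_fun_def)
    have "c = a - m \<and> m \<le> a" if "m + c = a" for c
      using that[symmetric] by (simp add: fun_eq_iff le_fun_def)
    then show "\<forall>p\<in>{(b, c). b + c = a} - {(b, c). b = m \<and> c = a - m \<and> m \<le> a}.
        (case p of (b, c) \<Rightarrow> (if b = m then z else 0) * cps_nth f c) = 0"
      by (auto split: if_splits)
  qed
  also have "{(b, c). b = m \<and> c = a - m \<and> m \<le> a} = (if m \<le> a then {(m, a - m)} else {})" by auto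
  also have "(\<Sum>(b, c)\<in>(if m \<le> a then {(m, a - m)} else {}). (if b = m then z else 0) * cps_nth f c)
      = (if m \<le> a then z * cps_nth f (a - m) else 0)" by simp
  finally show ?thesis by (simp only: times_cps.rep_eq cps_nth_monom)
qed

lemma hdop_coeff_slice': "hdop_coeff H (a, bk) = cps_nth (hdop_slice H bk) a"
  by (cases bk) (simp add: hdop_coeff_slice)

lemma hdop_coeff_monom_mult:
  "hdop_coeff (hdop_const (cps_monom m z) * H) (a, bk) = (if m \<le> a then z * hdop_coeff H (a - m, bk) else 0)"
  by (simp add: hdop_coeff_slice' hdop_slice_const_mult cps_nth_monom_mult)

lemma hdop_coeff_one: "hdop_coeff 1 (a, b, k) = (if a = 0 \<and> b = 0 \<and> k = 0 then 1 else 0)"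
  by (cases "k = 0") (auto simp: hdop_coeff_def one_hdop.rep_eq lookup_one when_def cps_nth_0 one_cps.rep_eq)

lemma dickson_expo:
  fixes X :: "'v::finite expo set"
  obtains F where "finite F" "F \<subseteq> X" "\<And>x. x \<in> X \<Longrightarrow> \<exists>f\<in>F. \<exists>s. x = f + s"
proof -
  define enc :: "'v expo \<Rightarrow> ('v + 'v) + unit \<Rightarrow> nat" where
    "enc = (\<lambda>(a, b, k). case_sum (case_sum a b) (\<lambda>_. k))"
  define dec :: "(('v + 'v) + unit \<Rightarrow> nat) \<Rightarrow> 'v expo" where
    "dec f = (\<lambda>i. f (Inl (Inl i)), \<lambda>i. f (Inl (Inr i)), f (Inr ()))" for f
  have dec: "dec (enc e) = e" for e by (cases e) (simp add: enc_def dec_def)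
  have dec_add: "dec (f + g) = dec f + dec g" for f g by (simp add: dec_def plus_fun_def)
  obtain F where F: "finite F" "F \<subseteq> enc ` X" "\<And>x. x \<in> enc ` X \<Longrightarrow> \<exists>f\<in>F. f \<le> x"
    using dickson[of "enc ` X"] by metis
  show ?thesis
  proof (rule that[of "dec ` F"])
    show "finite (dec ` F)" using F(1) by simp
    show "dec ` F \<subseteq> X" using F(2) dec by (force simp: image_iff)
    fix x assume "x \<in> X"
    then obtain f where f: "f \<in> F" "f \<le> enc x" using F(3) by blast
    have "enc x = f + (enc x - f)" using f(2) by (auto simp: fun_eq_iff le_fun_def)
    then have "x = dec f + dec (enc x - f)" using dec dec_add by metis
    then show "\<exists>f\<in>dec ` F. \<exists>s. x = f + s" using f(1) by blast
  qed
qed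

definition homogeneous :: "nat \<Rightarrow> 'v::finite hdop \<Rightarrow> bool" where
  "homogeneous d H \<longleftrightarrow> (\<forall>e\<in>hdop_diagram H. expo_deg e = d)"

lemma homogeneous_diff: "homogeneous d H \<Longrightarrow> homogeneous d H' \<Longrightarrow> homogeneous d (H - H')"
  using diagram_diff[of H H'] by (auto simp: homogeneous_def)

lemma homogeneous_mult: "homogeneous d A \<Longrightarrow> homogeneous d' H \<Longrightarrow> homogeneous (d + d') (A * H)"
  unfolding homogeneous_def using diagram_mult expo_deg_sig by metis

context tie_break begin

text \<open>Used with \<open>m = 0\<close> to make leading coefficients 1, and with
  \<open>z = 1\<close> to shift by a power of the variables.\<close>

lemma leads_monom:
  assumes "leads L H e" "z \<noteq> 0"
  shows "leads L (hdop_const (cps_monom m z) * H) (e + (m, 0, 0))"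
    "hdop_coeff (hdop_const (cps_monom m z) * H) (e + (m, 0, 0)) = z * hdop_coeff H e"
proof -
  have mem: "x \<in> hdop_diagram (hdop_const (cps_monom m z) * H) \<longleftrightarrow> (\<exists>y\<in>hdop_diagram H. x = y + (m, 0, 0))" for x
  proof -
    obtain a bk where x: "x = (a, bk)" by (cases x)
    have 1: "x \<in> hdop_diagram (hdop_const (cps_monom m z) * H) \<longleftrightarrow> m \<le> a \<and> (a - m, bk) \<in> hdop_diagram H"
      using assms(2) by (simp add: x diagram_iff hdop_coeff_monom_mult)
    have 2: "m \<le> a \<Longrightarrow> x = (a - m, bk) + (m, 0, 0)"
      by (cases bk) (auto simp: x fun_eq_iff le_fun_def)
    have 3: "m \<le> a \<and> (a - m, bk) = y" if "x = y + (m, 0, 0)" for y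
      using that by (cases y) (auto simp: x fun_eq_iff le_fun_def)
    show ?thesis unfolding 1 using 2 3 by blast
  qed
  obtain a b k where e: "e = (a, b, k)" by (cases e)
  have "m \<le> a + m" by (simp add: le_fun_def)
  moreover have "a + m - m = a" by (simp add: fun_eq_iff)
  ultimately show "hdop_coeff (hdop_const (cps_monom m z) * H) (e + (m, 0, 0)) = z * hdop_coeff H e"
    by (simp add: e hdop_coeff_monom_mult)
  show "leads L (hdop_const (cps_monom m z) * H) (e + (m, 0, 0))"
    unfolding leads_def
  proof (intro conjI ballI impI)
    show "e + (m, 0, 0) \<in> hdop_diagram (hdop_const (cps_monom m z) * H)"
      using assms(1) unfolding mem leads_def by blast
    fix x assume x: "x \<in> hdop_diagram (hdop_const (cps_monom m z) * H)" "x \<noteq> e + (m, 0, 0)"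
    then obtain y where y: "y \<in> hdop_diagram H" "x = y + (m, 0, 0)" unfolding mem by blast
    moreover have "y \<noteq> e" using x(2) y(2) by auto
    ultimately have "before L e y" using assms(1) unfolding leads_def by blast
    then show "before L (e + (m, 0, 0)) x" unfolding y(2) before_add .
  qed
qed

text \<open>A substitute for the monomial with exponent \<open>s\<close> in a noncommutative ring.
  Of its own terms only the signature matters, as this fixes the degree and the value of every
  \<open>L\<close>.\<close>

definition shifter :: "('n + 'p) expo \<Rightarrow> ('n + 'p) hdop \<Rightarrow> bool" where
  "shifter s A \<longleftrightarrow> (\<forall>x\<in>hdop_diagram A. expo_sig x = expo_sig s) \<and>
     (\<forall>L H e. leads L H e \<longrightarrow> leads L (A * H) (e + s) \<and> hdop_coeff (A * H) (e + s) = hdop_coeff H e)"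

lemma shifter_add:
  assumes "shifter s A" "shifter s' A'"
  shows "shifter (s + s') (A' * A)"
proof -
  have "expo_sig x = expo_sig (s + s')" if "x \<in> hdop_diagram (A' * A)" for x
    using diagram_mult[OF that] assms unfolding expo_sig_add shifter_def by (metis add.commute)
  moreover have "leads L (A' * A * H) (e + (s + s')) \<and> hdop_coeff (A' * A * H) (e + (s + s')) = hdop_coeff H e"
    if "leads L H e" for L H e
  proof -
    have 1: "leads L (A * H) (e + s)" "hdop_coeff (A * H) (e + s) = hdop_coeff H e"
      using assms(1) that unfolding shifter_def by blast+
    have "leads L (A' * (A * H)) (e + s + s')" "hdop_coeff (A' * (A * H)) (e + s + s') = hdop_coeff (A * H) (e + s)"
      using assms(2) 1(1) unfolding shifter_def by blast+
    then show ?thesis using 1(2) by (simp only: mult.assoc add.assoc)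
  qed
  ultimately show ?thesis unfolding shifter_def by blast
qed

lemma shifter_0: "shifter (0, 0, 0) 1"
proof -
  have "e + (0, 0, 0) = e" for e :: "('n + 'p) expo" by (cases e) simp
  then show ?thesis by (auto simp: shifter_def diagram_iff hdop_coeff_one split: if_splits)
qed

lemma ex_shifter: "\<exists>A. shifter s A"
proof -
  obtain c \<beta> k where s: "s = (c, \<beta>, k)" by (cases s)
  \<comment> \<open>The factor \<open>1\<close> makes the coefficient rules for left multiplication
    applicable to the operator itself; the same holds for \<open>hdop_pd i * 1\<close> and
    \<open>hdop_z * 1\<close> below.\<close>
  have 1: "shifter (c, 0, 0) (hdop_const (cps_monom c 1) * 1)"
  proof -
    have "x = (c, 0, 0)" if "x \<in> hdop_diagram (hdop_const (cps_monom c 1) * 1)" for x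
    proof -
      obtain a b k where x: "x = (a, b, k)" by (cases x)
      have "c \<le> a" "a - c = 0" "b = 0" "k = 0"
        using that unfolding x diagram_iff hdop_coeff_monom_mult
        by (auto simp: hdop_coeff_one split: if_splits)
      then have "a = c" by (auto simp: fun_eq_iff le_fun_def intro: le_antisym)
      then show ?thesis using x \<open>b = 0\<close> \<open>k = 0\<close> by simp
    qed
    then show ?thesis using leads_monom[of _ _ _ 1 c] by (auto simp: shifter_def)
  qed
  have "\<exists>A. shifter (0, \<beta>, 0) A"
  proof (induction \<beta> rule: zpoly.multi_index_induct)
    case zero
    then show ?case using shifter_0 by blast
  next
    case (Suc \<beta> i)
    then obtain A where A: "shifter (0, \<beta>, 0) A" by blast
    have "x = (0, 0(i := 1), 0)" if "x \<in> hdop_diagram (hdop_pd i * 1)" for x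
      using that by (cases x) (auto simp: diagram_iff hdop_coeff_pd_mult hdop_coeff_one fun_eq_iff
          simp del: mult_1_right of_nat_Suc split: if_splits nat.splits)
    then have "shifter (0, 0(i := 1), 0) (hdop_pd i * 1)"
      using leads_pd[of _ _ _ i] by (auto simp: shifter_def)
    moreover have "(0, \<beta>(i := Suc (\<beta> i)), 0) = (0, \<beta>, 0) + ((0, 0(i := 1), 0) :: ('n + 'p) expo)"
      by (auto simp: fun_eq_iff)
    ultimately show ?case using shifter_add[OF A] by metis
  qed
  moreover have "\<exists>A. shifter (0, 0, k) A"
  proof (induction k)
    case 0
    then show ?case using shifter_0 by blast
  next
    case (Suc k)
    then obtain A where A: "shifter (0, 0, k) A" by blast
    have "x = (0, 0, 1)" if "x \<in> hdop_diagram (hdop_z * 1)" for x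
      using that by (cases x) (auto simp: diagram_iff hdop_coeff_z_mult hdop_coeff_one
          simp del: mult_1_right split: if_splits nat.splits)
    then have "shifter (0, 0, 1) (hdop_z * 1)"
      using leads_z by (auto simp: shifter_def)
    moreover have "(0, 0, Suc k) = (0, 0, k) + ((0, 0, 1) :: ('n + 'p) expo)" by simp
    ultimately show ?case using shifter_add[OF A] by metis
  qed
  moreover have "s = (c, 0, 0) + (0, \<beta>, 0) + (0, 0, k)" by (simp add: s)
  ultimately show ?thesis using shifter_add 1 by metis
qed

text \<open>The weight \<open>\<epsilon> * tie - lin_form L\<close> puts the leading exponent of
  each divisor first if \<open>\<epsilon>\<close> is small. A later term either has larger
  \<open>tie\<close> and no larger \<open>L\<close>-value, or it is one of the finitely many terms
  in \<open>bad\<close>, where \<open>L\<close> is smaller by a positive margin.\<close>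

lemma hdop_division:
  fixes u :: "'i \<Rightarrow> ('n + 'p) hdop"
  assumes L: "L \<in> U_V" and K: "finite K"
    and u: "\<And>\<kappa>. \<kappa> \<in> K \<Longrightarrow> homogeneous d (u \<kappa>)" "\<And>\<kappa>. \<kappa> \<in> K \<Longrightarrow> leads L (u \<kappa>) (e \<kappa>)"
      "\<And>\<kappa>. \<kappa> \<in> K \<Longrightarrow> hdop_coeff (u \<kappa>) (e \<kappa>) = 1"
    and H: "homogeneous d H" "\<And>x. x \<in> hdop_diagram H \<Longrightarrow> lin_form L x \<le> c"
  obtains q :: "'i \<Rightarrow> ('n + 'p) cps" and R where
    "H = (\<Sum>\<kappa>\<in>K. hdop_const (q \<kappa>) * u \<kappa>) + R" "homogeneous d R"
    "\<And>x. x \<in> hdop_diagram R \<Longrightarrow> lin_form L x \<le> c"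
    "\<And>\<kappa> a. \<kappa> \<in> K \<Longrightarrow> e \<kappa> + (a, 0, 0) \<notin> hdop_diagram R"
    "\<And>\<kappa> a. \<kappa> \<in> K \<Longrightarrow> cps_nth (q \<kappa>) a \<noteq> 0 \<Longrightarrow> lin_form L (e \<kappa> + (a, 0, 0)) \<le> c"
proof -
  have L0: "0 \<le> L $ j" for j using L by (simp add: U_V_def)
  define bad where "bad \<kappa> = {x \<in> hdop_diagram (u \<kappa>). x \<noteq> e \<kappa> \<and> tie x \<le> tie (e \<kappa>)}" for \<kappa>
  have bad: "finite (bad \<kappa>)" if "\<kappa> \<in> K" for \<kappa>
    by (rule finite_subset[OF _ finite_tie_le[of d "tie (e \<kappa>)"]])
       (use u(1)[OF that] in \<open>auto simp: bad_def homogeneous_def\<close>)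
  have "\<forall>\<^sub>F \<epsilon> in at_right (0::real). \<forall>\<kappa>\<in>K. \<forall>x\<in>bad \<kappa>. \<epsilon> * (tie (e \<kappa>) - tie x) < lin_form L (e \<kappa>) - lin_form L x"
  proof (intro eventually_ball_finite K bad ballI)
    fix \<kappa> x assume \<kappa>: "\<kappa> \<in> K" and x: "x \<in> bad \<kappa>"
    define t \<delta> where "t = tie (e \<kappa>) - tie x" and "\<delta> = lin_form L (e \<kappa>) - lin_form L x"
    have t: "0 \<le> t" using x by (simp add: t_def bad_def)
    have "before L (e \<kappa>) x" using u(2)[OF \<kappa>] x by (auto simp: bad_def leads_def)
    then have \<delta>: "0 < \<delta>" using x by (auto simp: \<delta>_def bad_def before_def)
    have "\<epsilon> * t < \<delta>" if "0 < \<epsilon>" "\<epsilon> < \<delta> / (t + 1)" for \<epsilon>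
    proof -
      have "\<epsilon> * (t + 1) < \<delta>" using that t by (simp add: field_simps)
      then show ?thesis using that by (simp add: distrib_left)
    qed
    then show "\<forall>\<^sub>F \<epsilon> in at_right 0. \<epsilon> * (tie (e \<kappa>) - tie x) < lin_form L (e \<kappa>) - lin_form L x"
      unfolding eventually_at_right_field t_def[symmetric] \<delta>_def[symmetric]
      using \<delta> t by (intro exI[of _ "\<delta> / (t + 1)"]) auto
  qed
  moreover have "\<forall>\<^sub>F \<epsilon> in at_right (0::real). 0 < \<epsilon>"
    unfolding eventually_at_right_field by (rule exI[of _ 1]) auto
  ultimately have ev: "\<forall>\<^sub>F \<epsilon> in at_right (0::real). 0 < \<epsilon> \<and>
      (\<forall>\<kappa>\<in>K. \<forall>x\<in>bad \<kappa>. \<epsilon> * (tie (e \<kappa>) - tie x) < lin_form L (e \<kappa>) - lin_form L x)"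
    by eventually_elim blast
  obtain \<epsilon> :: real where \<epsilon>: "0 < \<epsilon>"
    and sep: "\<And>\<kappa> x. \<kappa> \<in> K \<Longrightarrow> x \<in> bad \<kappa> \<Longrightarrow> \<epsilon> * (tie (e \<kappa>) - tie x) < lin_form L (e \<kappa>) - lin_form L x"
    using eventually_happens'[OF trivial_limit_at_right_real ev] by auto
  \<comment> \<open>These split the weight \<open>\<epsilon> * tie - lin_form L\<close> into a part
    linear in \<open>a\<close> and a constant for each slice. Since \<open>L\<close> counts powers
    of \<open>t\<close> negatively, the coefficients in \<open>\<theta>\<close> are
    positive.\<close>
  define \<theta> where "\<theta> = (\<lambda>i. \<epsilon> * lam i + (case i of Inl _ \<Rightarrow> 0 | Inr j \<Rightarrow> L $ j))"
  define w where "w = (\<lambda>(b, k :: nat). - (\<Sum>j\<in>UNIV. L $ j * real (b (Inr j))) - \<epsilon> * wsum mu b)"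
  have \<theta>: "0 < \<theta> i" for i
    using \<epsilon> lam_pos[of i] L0 by (auto simp: \<theta>_def intro!: add_pos_nonneg split: sum.split)
  have wt: "wsum \<theta> (fst x) + w (snd x) = \<epsilon> * tie x - lin_form L x" for x
  proof -
    obtain a b k where x: "x = (a, b, k)" by (cases x)
    have "wsum \<theta> a = \<epsilon> * wsum lam a + (\<Sum>i\<in>UNIV. (case i of Inl _ \<Rightarrow> 0 | Inr j \<Rightarrow> L $ j) * real (a i))"
      by (simp add: wsum_def \<theta>_def distrib_right sum.distrib sum_distrib_left mult.assoc)
    also have "(\<Sum>i\<in>UNIV. (case i of Inl _ \<Rightarrow> 0 | Inr j \<Rightarrow> L $ j) * real (a i)) = (\<Sum>j\<in>UNIV. L $ j * real (a (Inr j)))"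
      unfolding UNIV_Plus_UNIV[symmetric] by (subst sum.Plus) simp_all
    finally show ?thesis
      by (simp add: x w_def tie_def lin_form_def V_form_def algebra_simps sum_subtractf)
  qed
  have lin_a: "lin_form L (a + a', bk) = lin_form L (a, 0, 0) + lin_form L (a', bk)" for a a' :: "'n + 'p \<Rightarrow> nat" and bk
    using lin_form_add[of L "(a, 0, 0)" "(a', bk)"] by (cases bk) simp
  have mem: "cps_nth (hdop_slice (u \<kappa>) bk) a \<noteq> 0 \<longleftrightarrow> (a, bk) \<in> hdop_diagram (u \<kappa>)" for \<kappa> a bk
    by (simp add: diagram_iff hdop_coeff_slice')
  have lead_le: "lin_form L x \<le> lin_form L (e \<kappa>)" if "\<kappa> \<in> K" "x \<in> hdop_diagram (u \<kappa>)" for \<kappa> x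
    using u(2)[OF that(1)] that(2) by (cases "x = e \<kappa>") (auto simp: leads_def before_def)
  obtain q r where qr:
    "\<And>bk. bk \<in> slices d \<Longrightarrow> hdop_slice H bk = (\<Sum>\<kappa>\<in>K. q \<kappa> * hdop_slice (u \<kappa>) bk) + r bk"
    "\<And>\<kappa> a bk. \<kappa> \<in> K \<Longrightarrow> cps_nth (r bk) a \<noteq> 0 \<Longrightarrow> \<not> (snd (e \<kappa>) = bk \<and> fst (e \<kappa>) \<le> a)"
    "\<And>a bk. cps_nth (r bk) a \<noteq> 0 \<Longrightarrow> (a, bk) \<in> {x. lin_form L x \<le> c}"
    "\<And>\<kappa> a. \<kappa> \<in> K \<Longrightarrow> cps_nth (q \<kappa>) a \<noteq> 0 \<Longrightarrow> (a + fst (e \<kappa>), snd (e \<kappa>)) \<in> {x. lin_form L x \<le> c}"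
  proof (rule cps_division[where B = "slices d" and K = K and \<theta> = \<theta> and g = "\<lambda>\<kappa>. hdop_slice (u \<kappa>)"
        and f = "hdop_slice H" and ?a0.0 = "\<lambda>\<kappa>. fst (e \<kappa>)" and ?b0.0 = "\<lambda>\<kappa>. snd (e \<kappa>)" and \<kappa> = w
        and X = "{x. lin_form L x \<le> c}"])
    show "finite (slices d :: (('n + 'p \<Rightarrow> nat) \<times> nat) set)" by (rule finite_slices)
    show "finite K" by (rule K)
    show "0 < \<theta> i" for i by (rule \<theta>)
    show "snd (e \<kappa>) \<in> slices d" if "\<kappa> \<in> K" for \<kappa>
      using u(1,2)[OF that] in_slices[of "snd (e \<kappa>)" d "fst (e \<kappa>)"] by (auto simp: leads_def homogeneous_def)
    show "cps_nth (hdop_slice (u \<kappa>) (snd (e \<kappa>))) (fst (e \<kappa>)) = 1" if "\<kappa> \<in> K" for \<kappa>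
      using u(3)[OF that] by (cases "e \<kappa>") (simp add: hdop_coeff_slice)
    show "wsum \<theta> (fst (e \<kappa>)) + w (snd (e \<kappa>)) < wsum \<theta> a + w bk"
      if "\<kappa> \<in> K" "cps_nth (hdop_slice (u \<kappa>) bk) a \<noteq> 0" "(a, bk) \<noteq> (fst (e \<kappa>), snd (e \<kappa>))" for \<kappa> a bk
    proof -
      have x: "(a, bk) \<in> hdop_diagram (u \<kappa>)" "(a, bk) \<noteq> e \<kappa>" using that by (auto simp: mem)
      have "\<epsilon> * tie (e \<kappa>) - lin_form L (e \<kappa>) < \<epsilon> * tie (a, bk) - lin_form L (a, bk)"
      proof (cases "(a, bk) \<in> bad \<kappa>")
        case True
        then show ?thesis using sep[OF that(1) True] by (simp add: algebra_simps)
      next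
        case False
        then have "tie (e \<kappa>) < tie (a, bk)" using x by (auto simp: bad_def)
        then have "\<epsilon> * tie (e \<kappa>) < \<epsilon> * tie (a, bk)" using \<epsilon> by simp
        then show ?thesis using lead_le[OF that(1) x(1)] by linarith
      qed
      then show ?thesis using wt[of "e \<kappa>"] wt[of "(a, bk)"] by simp
    qed
    show "(a' + a, bk) \<in> {x. lin_form L x \<le> c}"
      if "\<kappa> \<in> K" "(a' + fst (e \<kappa>), snd (e \<kappa>)) \<in> {x. lin_form L x \<le> c}"
        "cps_nth (hdop_slice (u \<kappa>) bk) a \<noteq> 0" for \<kappa> a' a bk
      using that(2) lead_le[OF that(1), of "(a, bk)"] that(3) by (simp add: mem lin_a)
    show "(a, bk) \<in> {x. lin_form L x \<le> c}" if "cps_nth (hdop_slice H bk) a \<noteq> 0" for a bk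
      using H(2)[of "(a, bk)"] that by (simp add: diagram_iff hdop_coeff_slice')
  qed blast
  define R where "R = hdop_of_slices (slices d) r"
  have R: "hdop_slice R bk = (if bk \<in> slices d then r bk else 0)" for bk
    unfolding R_def by (rule hdop_slice_of_slices[OF finite_slices])
  have R_mem: "bk \<in> slices d \<and> cps_nth (r bk) a \<noteq> 0" if "(a, bk) \<in> hdop_diagram R" for a bk
    using that by (auto simp: diagram_iff hdop_coeff_slice' R cps_nth_0 split: if_splits)
  have out: "hdop_slice P bk = 0" if "homogeneous d P" "bk \<notin> slices d" for P :: "('n + 'p) hdop" and bk
  proof (rule cps_eqI)
    fix a
    have "(a, bk) \<notin> hdop_diagram P" using that in_slices[of bk d a] unfolding homogeneous_def by blast
    then show "cps_nth (hdop_slice P bk) a = cps_nth 0 a"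
      by (simp add: diagram_iff hdop_coeff_slice' cps_nth_0)
  qed
  show ?thesis
  proof (rule that[of q R])
    show "H = (\<Sum>\<kappa>\<in>K. hdop_const (q \<kappa>) * u \<kappa>) + R"
    proof (rule hdop_slice_eqI)
      fix bk
      show "hdop_slice H bk = hdop_slice ((\<Sum>\<kappa>\<in>K. hdop_const (q \<kappa>) * u \<kappa>) + R) bk"
        using qr(1)[of bk] out[OF H(1), of bk] out[OF u(1), of _ bk]
        by (cases "bk \<in> slices d") (auto simp: hdop_slice_simps hdop_slice_sum hdop_slice_const_mult R)
    qed
    show "homogeneous d R"
      unfolding homogeneous_def using R_mem in_slices by (metis prod.exhaust)
    show "lin_form L x \<le> c" if "x \<in> hdop_diagram R" for x
      using R_mem[of "fst x" "snd x"] that qr(3)[of "snd x" "fst x"] by simp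
    show "e \<kappa> + (a, 0, 0) \<notin> hdop_diagram R" if "\<kappa> \<in> K" for \<kappa> a
    proof
      assume "e \<kappa> + (a, 0, 0) \<in> hdop_diagram R"
      moreover have "e \<kappa> + (a, 0, 0) = (fst (e \<kappa>) + a, snd (e \<kappa>))" by (cases "e \<kappa>") simp
      ultimately have "cps_nth (r (snd (e \<kappa>))) (fst (e \<kappa>) + a) \<noteq> 0" using R_mem by simp
      then show False using qr(2)[OF that, of "snd (e \<kappa>)" "fst (e \<kappa>) + a"] by (auto simp: le_fun_def)
    qed
    show "lin_form L (e \<kappa> + (a, 0, 0)) \<le> c" if "\<kappa> \<in> K" "cps_nth (q \<kappa>) a \<noteq> 0" for \<kappa> a
    proof -
      have "e \<kappa> + (a, 0, 0) = (a + fst (e \<kappa>), snd (e \<kappa>))" by (cases "e \<kappa>") (simp add: add.commute)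
      then show ?thesis using qr(4)[OF that] by simp
    qed
  qed
qed

end

section \<open>Homogeneous components, orders and symbols\<close>

definition hdop_monom :: "'v::finite expo \<Rightarrow> 'v hdop" where
  "hdop_monom e = hdop_of_slices {snd e} (\<lambda>_. cps_monom (fst e) 1)"

lemma hdop_coeff_hdop_monom: "hdop_coeff (hdop_monom e) x = (if x = e then 1 else 0)"
  by (cases x; cases e)
     (auto simp: hdop_monom_def hdop_coeff_slice' hdop_slice_of_slices cps_nth_monom cps_nth_0)

lemma finite_diagram_deg: "finite (expo_deg ` hdop_diagram H)"
proof (rule finite_subset)
  let ?f = "hdop_expansion H"
  show "expo_deg ` hdop_diagram H
      \<subseteq> (\<lambda>(b, k). (\<Sum>i\<in>UNIV. b i) + k) ` (SIGMA b:Poly_Mapping.keys ?f. {..degree (Poly_Mapping.lookup ?f b)})"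
  proof (rule image_subsetI)
    fix e assume "e \<in> hdop_diagram H"
    moreover obtain a b k where e: "e = (a, b, k)" by (cases e)
    ultimately have nz: "poly.coeff (Poly_Mapping.lookup ?f b) k \<noteq> 0"
      by (auto simp: diagram_iff hdop_coeff_def cps_nth_0)
    then have "b \<in> Poly_Mapping.keys ?f" "k \<le> degree (Poly_Mapping.lookup ?f b)"
      by (auto simp: in_keys_iff intro: le_degree)
    then show "expo_deg e \<in> (\<lambda>(b, k). (\<Sum>i\<in>UNIV. b i) + k) ` (SIGMA b:Poly_Mapping.keys ?f. {..degree (Poly_Mapping.lookup ?f b)})"
      by (intro image_eqI[of _ _ "(b, k)"]) (auto simp: e expo_deg_simp)
  qed
qed auto

lemma restrict_deg_sum: "H = (\<Sum>d\<in>expo_deg ` hdop_diagram H. hdop_restrict {e. expo_deg e = d} H)"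
proof (rule hdop_eqI)
  fix e
  have "(\<Sum>d\<in>expo_deg ` hdop_diagram H. hdop_coeff (hdop_restrict {e. expo_deg e = d} H) e)
      = (\<Sum>d\<in>expo_deg ` hdop_diagram H. if d = expo_deg e then hdop_coeff H e else 0)"
    by (intro sum.cong refl) (auto simp: hdop_coeff_restrict)
  also have "\<dots> = hdop_coeff H e"
    using finite_diagram_deg[of H] by (auto simp: diagram_iff)
  finally show "hdop_coeff H e = hdop_coeff (\<Sum>d\<in>expo_deg ` hdop_diagram H. hdop_restrict {e. expo_deg e = d} H) e"
    by (simp add: hdop_coeff_sum)
qed

text \<open>Between exponents of equal degree the shift from Dickson's lemma has degree zero, so it
  involves only the power series variables.\<close>

lemma dickson_degree:
  assumes X: "\<And>x. x \<in> X \<Longrightarrow> expo_deg x = d"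
  obtains F where "finite F" "F \<subseteq> X" "\<And>x. x \<in> X \<Longrightarrow> \<exists>f\<in>F. \<exists>a. x = f + (a, 0, 0)"
proof -
  obtain F where F: "finite F" "F \<subseteq> X" "\<And>x. x \<in> X \<Longrightarrow> \<exists>f\<in>F. \<exists>s. x = f + s"
    by (rule dickson_expo) blast
  have "\<exists>f\<in>F. \<exists>a. x = f + (a, 0, 0)" if x: "x \<in> X" for x
  proof -
    obtain f s where fs: "f \<in> F" "x = f + s" using F(3) x by blast
    obtain a b k where s: "s = (a, b, k)" by (cases s)
    have "expo_deg f + expo_deg s = d"
      using X[OF x] expo_deg_sig[OF expo_sig_add] fs(2) by metis
    moreover have "expo_deg f = d" using F(2) fs(1) X by blast
    ultimately have "(\<Sum>i\<in>UNIV. b i) + k = 0" by (simp add: s expo_deg_simp)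
    then have "b = 0" "k = 0" by (auto simp: fun_eq_iff)
    then show ?thesis using fs s by blast
  qed
  then show ?thesis using F(1,2) by (intro that[of F])
qed

text \<open>With \<open>dickson_degree\<close> this confines the maximum of every \<open>L\<close>
  in \<open>U_V\<close> on a homogeneous operator to finitely many exponents that do not depend on
  \<open>L\<close>.\<close>

lemma lin_form_add_le:
  fixes e :: "('n::finite + 'p::finite) expo"
  assumes "L \<in> U_V"
  shows "lin_form L (e + (a, 0, 0)) \<le> lin_form L e"
proof -
  have "lin_form L (a, 0, 0) = - (\<Sum>j\<in>UNIV. L $ j * real (a (Inr j)))"
    by (simp add: lin_form_def V_form_def sum_negf)
  also have "\<dots> \<le> 0" using assms by (auto simp: U_V_def intro!: sum_nonneg)
  finally show ?thesis by (simp add: lin_form_add)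
qed

lemma hdop_ord_upper: "x \<in> hdop_diagram H \<Longrightarrow> ereal (lin_form L x) \<le> hdop_ord L H"
  unfolding hdop_ord_def ord_diagram_def by (rule SUP_upper)

lemma hdop_ord_attained:
  assumes "L \<in> U_V" "H \<noteq> 0"
  obtains e where "e \<in> hdop_diagram H" "hdop_ord L H = ereal (lin_form L e)"
    "\<And>x. x \<in> hdop_diagram H \<Longrightarrow> lin_form L x \<le> lin_form L e"
proof -
  obtain e where e: "e \<in> hdop_diagram H" "hdop_ord L H = ereal (lin_form L e)"
    using ord_diagram_attained[OF assms(1) _ finite_hdop_diagram, of H] assms(2)
    by (auto simp: hdop_ord_def diagram_eq_empty)
  moreover have "lin_form L x \<le> lin_form L e" if "x \<in> hdop_diagram H" for x
    using hdop_ord_upper[OF that, of L] e(2) by simp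
  ultimately show ?thesis by (rule that)
qed

lemma hdop_symbol_eq:
  assumes "e \<in> hdop_diagram H" "\<And>x. x \<in> hdop_diagram H \<Longrightarrow> lin_form L x \<le> lin_form L e"
  shows "hdop_symbol L H = hdop_restrict {x. lin_form L x = lin_form L e} H"
proof -
  have "hdop_ord L H = ereal (lin_form L e)"
  proof (rule antisym)
    show "hdop_ord L H \<le> ereal (lin_form L e)"
      unfolding hdop_ord_def ord_diagram_def using assms(2) by (intro SUP_least) simp
  qed (rule hdop_ord_upper[OF assms(1)])
  then show ?thesis by (simp add: hdop_symbol_def)
qed

lemma symbol_in_gr_ideal:
  fixes H :: "('n::finite + 'p::finite) hdop"
  assumes "H \<in> J"
  shows "hdop_symbol L H \<in> gr_ideal L J"
proof -
  have "(- 1) * (- 1) \<in> (gr_ring L :: ('n + 'p) hdop set)"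
    by (rule gr_ring_mult) (rule gr_ring_minus_one)+
  then have "1 * hdop_symbol L H \<in> gr_ideal L J"
    unfolding gr_ideal_def using assms by (intro left_ideal_gen_generator) auto
  then show ?thesis by simp
qed

section \<open>Leading exponents of a graded left ideal\<close>

locale graded_ideal = tie_break lam mu for lam mu :: "'n::finite + 'p::finite \<Rightarrow> real" +
  fixes J :: "('n + 'p) hdop set"
  assumes ideal: "left_ideal J"
    and graded: "H \<in> J \<Longrightarrow> hdop_restrict {e. expo_deg e = d} H \<in> J"
begin

text \<open>Homogeneous elements are taken because \<open>ex_leads\<close> provides a leading
  exponent within one degree. The leading coefficient 1 costs nothing by \<open>lead_setI\<close>
  and is what division requires.\<close>

definition lead_set :: "real^'p \<Rightarrow> ('n + 'p) expo set" where
  "lead_set L = {e. \<exists>H\<in>J. homogeneous (expo_deg e) H \<and> leads L H e \<and> hdop_coeff H e = 1}"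

lemma J_mult: "H \<in> J \<Longrightarrow> A * H \<in> J"
  using ideal by (simp add: left_ideal_def)

lemma J_diff: "H \<in> J \<Longrightarrow> H' \<in> J \<Longrightarrow> H - H' \<in> J"
  by (rule left_ideal_diff[OF ideal])

lemma leads_le: "leads L H e \<Longrightarrow> x \<in> hdop_diagram H \<Longrightarrow> lin_form L x \<le> lin_form L e"
  by (cases "x = e") (auto simp: leads_def before_def)

lemma symbol_leads:
  "leads L H e \<Longrightarrow> hdop_symbol L H = hdop_restrict {x. lin_form L x = lin_form L e} H"
  by (rule hdop_symbol_eq) (auto simp: leads_def intro: leads_le)

lemma lead_setI:
  assumes "H \<in> J" "homogeneous d H" "leads L H e"
  shows "e \<in> lead_set L"
proof -
  define z where "z = 1 / hdop_coeff H e"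
  define H' where "H' = hdop_const (cps_monom 0 z) * H"
  have e: "e \<in> hdop_diagram H" using assms(3) by (simp add: leads_def)
  then have z: "z \<noteq> 0" "z * hdop_coeff H e = 1" by (auto simp: z_def diagram_iff)
  have e0: "e + (0, 0, 0) = e" by (cases e) simp
  have "leads L H' e" "hdop_coeff H' e = 1"
    using leads_monom[OF assms(3) z(1), of 0] z(2) by (simp_all only: H'_def e0)
  moreover have "H' \<in> J" unfolding H'_def by (rule J_mult) (rule assms(1))
  moreover have "homogeneous (expo_deg e) H'"
  proof -
    have "hdop_diagram H' \<subseteq> hdop_diagram H"
    proof
      fix x assume x: "x \<in> hdop_diagram H'"
      obtain a bk where "x = (a, bk)" by (cases x)
      moreover have "a - 0 = a" for a :: "'n + 'p \<Rightarrow> nat" by (simp add: fun_eq_iff)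
      ultimately show "x \<in> hdop_diagram H"
        using x by (auto simp: H'_def diagram_iff hdop_coeff_monom_mult split: if_splits)
    qed
    then show ?thesis using assms(2) e by (auto simp: homogeneous_def)
  qed
  ultimately show ?thesis by (auto simp: lead_set_def)
qed

lemma lead_set_add:
  assumes "e \<in> lead_set L"
  shows "e + s \<in> lead_set L"
proof -
  obtain H where H: "H \<in> J" "homogeneous (expo_deg e) H" "leads L H e"
    using assms by (auto simp: lead_set_def)
  obtain A where A: "shifter s A" using ex_shifter by blast
  have "homogeneous (expo_deg s) A"
    using A unfolding homogeneous_def shifter_def expo_deg_def by metis
  then have "homogeneous (expo_deg s + expo_deg e) (A * H)" by (rule homogeneous_mult) (rule H(2))
  moreover have "leads L (A * H) (e + s)" using A H(3) unfolding shifter_def by blast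
  ultimately show ?thesis using J_mult[OF H(1)] by (rule lead_setI[rotated 1])
qed

lemma lead_set_degree_finite:
  obtains F where "finite F" "F \<subseteq> lead_set L" "\<And>x. x \<in> F \<Longrightarrow> expo_deg x = d"
    "\<And>x. x \<in> lead_set L \<Longrightarrow> expo_deg x = d \<Longrightarrow> \<exists>f\<in>F. \<exists>a. x = f + (a, 0, 0)"
proof -
  obtain F where F: "finite F" "F \<subseteq> {e \<in> lead_set L. expo_deg e = d}"
    "\<And>x. x \<in> {e \<in> lead_set L. expo_deg e = d} \<Longrightarrow> \<exists>f\<in>F. \<exists>a. x = f + (a, 0, 0)"
    by (rule dickson_degree[of "{e \<in> lead_set L. expo_deg e = d}" d]) auto
  then show ?thesis by (intro that[of F]) auto
qed

text \<open>Within one degree, shifts by the power series variables generate all leading exponents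
  from finitely many of them. Division by elements of \<open>J\<close> with these leading exponents
  therefore clears the whole of \<open>lead_set L\<close>.\<close>

lemma nf_exists:
  assumes L: "L \<in> U_V" and H: "homogeneous d H" "\<And>x. x \<in> hdop_diagram H \<Longrightarrow> lin_form L x \<le> c"
  shows "\<exists>R. homogeneous d R \<and> H - R \<in> J \<and> hdop_diagram R \<inter> lead_set L = {} \<and>
    (\<forall>x\<in>hdop_diagram R. lin_form L x \<le> c)"
proof -
  obtain F where F: "finite F" "F \<subseteq> lead_set L" "\<And>x. x \<in> F \<Longrightarrow> expo_deg x = d"
    "\<And>x. x \<in> lead_set L \<Longrightarrow> expo_deg x = d \<Longrightarrow> \<exists>f\<in>F. \<exists>a. x = f + (a, 0, 0)"
    by (rule lead_set_degree_finite[of L d]) blast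
  have "\<forall>f\<in>F. \<exists>u. u \<in> J \<and> homogeneous d u \<and> leads L u f \<and> hdop_coeff u f = 1"
    using F(2,3) unfolding lead_set_def by blast
  then obtain u where u: "\<And>f. f \<in> F \<Longrightarrow> u f \<in> J" "\<And>f. f \<in> F \<Longrightarrow> homogeneous d (u f)"
    "\<And>f. f \<in> F \<Longrightarrow> leads L (u f) f" "\<And>f. f \<in> F \<Longrightarrow> hdop_coeff (u f) f = 1"
    by metis
  obtain q R where qR: "H = (\<Sum>f\<in>F. hdop_const (q f) * u f) + R" "homogeneous d R"
    "\<And>x. x \<in> hdop_diagram R \<Longrightarrow> lin_form L x \<le> c"
    "\<And>f a. f \<in> F \<Longrightarrow> f + (a, 0, 0) \<notin> hdop_diagram R"
    by (rule hdop_division[of L F d u "\<lambda>f. f" H c, OF L F(1) u(2-4) H]) blast+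
  have "H - R \<in> J"
    using qR(1) left_ideal_sum[OF ideal, of F "\<lambda>f. hdop_const (q f) * u f"] J_mult u(1) by simp
  moreover have "x \<notin> lead_set L" if "x \<in> hdop_diagram R" for x
    using F(4)[of x] qR(2,4) that unfolding homogeneous_def by blast
  ultimately show ?thesis using qR(2,3) by blast
qed

text \<open>Applied to the difference of two remainders, this gives their uniqueness.\<close>

lemma nf_zero:
  assumes "L \<in> U_V" "R \<in> J" "homogeneous d R" "hdop_diagram R \<inter> lead_set L = {}"
  shows "R = 0"
proof (rule ccontr)
  assume "R \<noteq> 0"
  then obtain e where e: "leads L R e"
    using ex_leads[OF assms(1), of R d] assms(3) by (auto simp: homogeneous_def)
  then have "e \<in> lead_set L" "e \<in> hdop_diagram R"
    using lead_setI[OF assms(2,3)] by (auto simp: leads_def)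
  then show False using assms(4) by blast
qed

text \<open>Division of \<open>H\<close> by shifted generators leaves no remainder, and no product
  exceeds the order \<open>c\<close>. So the part of level \<open>c\<close> of each product is a
  level part of the cofactor times the symbol of the generator. \<open>c\<close> is merely an upper
  bound because a degree component of an operator can have smaller order than the operator.\<close>

lemma initial_part_generated:
  assumes L: "L \<in> U_V"
    and g: "\<And>e. e \<in> G \<Longrightarrow> g e \<in> J" "\<And>e. e \<in> G \<Longrightarrow> homogeneous (expo_deg e) (g e)"
      "\<And>e. e \<in> G \<Longrightarrow> leads L (g e) e" "\<And>e. e \<in> G \<Longrightarrow> hdop_coeff (g e) e = 1"
    and G: "\<And>x. x \<in> lead_set L \<Longrightarrow> \<exists>e\<in>G. \<exists>s. x = e + s"
    and H: "H \<in> J" "homogeneous d H" "\<And>x. x \<in> hdop_diagram H \<Longrightarrow> lin_form L x \<le> c"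
  shows "hdop_restrict {x. lin_form L x = c} H \<in> left_ideal_gen (gr_ring L) (hdop_symbol L ` g ` G)"
proof -
  obtain F where F: "finite F" "F \<subseteq> lead_set L" "\<And>x. x \<in> F \<Longrightarrow> expo_deg x = d"
    "\<And>x. x \<in> lead_set L \<Longrightarrow> expo_deg x = d \<Longrightarrow> \<exists>f\<in>F. \<exists>a. x = f + (a, 0, 0)"
    by (rule lead_set_degree_finite[of L d]) blast
  have "\<forall>f\<in>F. \<exists>e s A. e \<in> G \<and> f = e + s \<and> shifter s A"
    using F(2) G ex_shifter by blast
  then obtain e s A where esA: "\<And>f. f \<in> F \<Longrightarrow> e f \<in> G" "\<And>f. f \<in> F \<Longrightarrow> f = e f + s f"
      "\<And>f. f \<in> F \<Longrightarrow> shifter (s f) (A f)"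
    by metis
  define u where "u f = A f * g (e f)" for f
  have u: "u f \<in> J" "homogeneous d (u f)" "leads L (u f) f" "hdop_coeff (u f) f = 1" if f: "f \<in> F" for f
  proof -
    show "u f \<in> J" unfolding u_def by (intro J_mult g esA f)
    have "homogeneous (expo_deg (s f)) (A f)"
      using esA(3)[OF f] unfolding homogeneous_def shifter_def expo_deg_def by metis
    then have "homogeneous (expo_deg (s f) + expo_deg (e f)) (u f)"
      unfolding u_def by (rule homogeneous_mult) (intro g esA f)
    moreover have "expo_deg (s f) + expo_deg (e f) = d"
      using F(3)[OF f] esA(2)[OF f] expo_deg_sig[OF expo_sig_add] add.commute by metis
    ultimately show "homogeneous d (u f)" by simp
    show "leads L (u f) f" "hdop_coeff (u f) f = 1"
      using esA(2,3)[OF f] g(3,4)[OF esA(1)[OF f]] unfolding u_def shifter_def by metis+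
  qed
  obtain q R where qR: "H = (\<Sum>f\<in>F. hdop_const (q f) * u f) + R" "homogeneous d R"
    "\<And>f a. f \<in> F \<Longrightarrow> f + (a, 0, 0) \<notin> hdop_diagram R"
    "\<And>f a. f \<in> F \<Longrightarrow> cps_nth (q f) a \<noteq> 0 \<Longrightarrow> lin_form L (f + (a, 0, 0)) \<le> c"
    by (rule hdop_division[of L F d u "\<lambda>f. f" H c, OF L F(1) u(2-4) H(2,3)]) blast+
  have "(\<Sum>f\<in>F. hdop_const (q f) * u f) \<in> J"
    by (intro left_ideal_sum[OF ideal] J_mult u)
  then have "H - (\<Sum>f\<in>F. hdop_const (q f) * u f) \<in> J" using J_diff H(1) by blast
  then have "R \<in> J" using qR(1) by simp
  moreover have "hdop_diagram R \<inter> lead_set L = {}"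
    using F(4) qR(2,3) unfolding homogeneous_def by blast
  ultimately have "R = 0" using nf_zero[OF L _ qR(2)] by blast
  then have "hdop_restrict {x. lin_form L x = c} H
      = (\<Sum>f\<in>F. hdop_restrict {x. lin_form L x = c} ((hdop_const (q f) * A f) * g (e f)))"
    using qR(1) by (simp add: restrict_sum u_def mult.assoc)
  also have "\<dots> \<in> left_ideal_gen (gr_ring L) (hdop_symbol L ` g ` G)"
  proof (intro left_ideal_gen_sum gr_ring_closed)
    fix f assume f: "f \<in> F"
    define B where "B = hdop_const (q f) * A f"
    have B: "lin_form L x \<le> c - lin_form L (e f)" if x: "x \<in> hdop_diagram B" for x
    proof -
      obtain x1 x2 where x12: "x1 \<in> hdop_diagram (hdop_const (q f))" "x2 \<in> hdop_diagram (A f)"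
          "expo_sig x = expo_sig x1 + expo_sig x2"
        using diagram_mult x unfolding B_def by blast
      have "\<exists>a. x1 = (a, 0, 0) \<and> cps_nth (q f) a \<noteq> 0"
      proof -
        obtain a b k where x1: "x1 = (a, b, k)" by (cases x1)
        have "hdop_slice (hdop_const (q f) * 1) (b, k) = (if b = 0 \<and> k = 0 then q f else 0)"
        proof -
          have "hdop_slice 1 (b, k) = (if b = 0 \<and> k = 0 then 1 else (0 :: ('n + 'p) cps))"
            by (rule cps_eqI) (auto simp: hdop_coeff_one cps_nth_0 one_cps.rep_eq simp flip: hdop_coeff_slice')
          then show ?thesis by (simp only: hdop_slice_const_mult) auto
        qed
        then show ?thesis
          using x12(1) by (auto simp: x1 diagram_iff hdop_coeff_slice cps_nth_0 split: if_splits)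
      qed
      then obtain a where a: "x1 = (a, 0, 0)" "cps_nth (q f) a \<noteq> 0" by blast
      have "expo_sig x2 = expo_sig (s f)" using esA(3)[OF f] x12(2) by (simp add: shifter_def)
      then have "lin_form L x2 = lin_form L (s f)" by (simp add: lin_form_expo_sig)
      moreover have "lin_form L f = lin_form L (e f) + lin_form L (s f)"
        using esA(2)[OF f] lin_form_add by metis
      moreover have "lin_form L x = lin_form L x1 + lin_form L x2" by (rule lin_form_sig) (rule x12(3))
      ultimately show ?thesis using qR(4)[OF f a(2)] by (simp add: lin_form_add a(1))
    qed
    have "hdop_restrict {x. lin_form L x = c} (B * g (e f))
        = hdop_restrict {x. lin_form L x = c - lin_form L (e f)} B
          * hdop_restrict {x. lin_form L x = lin_form L (e f)} (g (e f))"
    proof (rule restrict_mult)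
      show "lin_form L x = lin_form L x1 + lin_form L x2" if "expo_sig x = expo_sig x1 + expo_sig x2"
        for x x1 x2 :: "('n + 'p) expo" using that by (rule lin_form_sig)
      show "lin_form L x1 + lin_form L x2 = c \<longleftrightarrow>
          x1 \<in> {x. lin_form L x = c - lin_form L (e f)} \<and> x2 \<in> {x. lin_form L x = lin_form L (e f)}"
        if "x1 \<in> hdop_diagram B" "x2 \<in> hdop_diagram (g (e f))" for x1 x2
        using B[OF that(1)] leads_le[OF g(3)[OF esA(1)[OF f]] that(2)] by auto
    qed
    also have "hdop_restrict {x. lin_form L x = lin_form L (e f)} (g (e f)) = hdop_symbol L (g (e f))"
      by (rule symbol_leads[symmetric]) (intro g esA f)
    also have "hdop_restrict {x. lin_form L x = c - lin_form L (e f)} B * hdop_symbol L (g (e f))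
        \<in> left_ideal_gen (gr_ring L) (hdop_symbol L ` g ` G)"
      using esA(1)[OF f] by (intro left_ideal_gen_generator restrict_in_gr_ring L) auto
    finally show "hdop_restrict {x. lin_form L x = c} (hdop_const (q f) * A f * g (e f))
        \<in> left_ideal_gen (gr_ring L) (hdop_symbol L ` g ` G)"
      unfolding B_def .
  qed
  finally show ?thesis .
qed

lemma gr_ideal_generated:
  assumes L: "L \<in> U_V"
    and g: "\<And>e. e \<in> G \<Longrightarrow> g e \<in> J" "\<And>e. e \<in> G \<Longrightarrow> homogeneous (expo_deg e) (g e)"
      "\<And>e. e \<in> G \<Longrightarrow> leads L (g e) e" "\<And>e. e \<in> G \<Longrightarrow> hdop_coeff (g e) e = 1"
    and G: "\<And>x. x \<in> lead_set L \<Longrightarrow> \<exists>e\<in>G. \<exists>s. x = e + s"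
  shows "gr_ideal L J = left_ideal_gen (gr_ring L) (hdop_symbol L ` g ` G)"
proof
  show "gr_ideal L J \<subseteq> left_ideal_gen (gr_ring L) (hdop_symbol L ` g ` G)"
    unfolding gr_ideal_def
  proof (rule left_ideal_gen_least)
    show "hdop_symbol L ` J \<subseteq> left_ideal_gen (gr_ring L) (hdop_symbol L ` g ` G)"
    proof (rule image_subsetI)
      fix H assume H: "H \<in> J"
      show "hdop_symbol L H \<in> left_ideal_gen (gr_ring L) (hdop_symbol L ` g ` G)"
      proof (cases "H = 0")
        case True
        then show ?thesis by (simp add: hdop_symbol_def restrict_0 left_ideal_gen_0)
      next
        case False
        then obtain e where e: "e \<in> hdop_diagram H"
          "\<And>x. x \<in> hdop_diagram H \<Longrightarrow> lin_form L x \<le> lin_form L e"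
          using hdop_ord_attained[OF L] by metis
        have "hdop_symbol L H = hdop_restrict {x. lin_form L x = lin_form L e} H"
          using e by (rule hdop_symbol_eq)
        also have "\<dots> = (\<Sum>d\<in>expo_deg ` hdop_diagram H. hdop_restrict {x. lin_form L x = lin_form L e}
            (hdop_restrict {x. expo_deg x = d} H))"
          by (subst restrict_deg_sum) (rule restrict_sum)
        also have "\<dots> \<in> left_ideal_gen (gr_ring L) (hdop_symbol L ` g ` G)"
        proof (intro left_ideal_gen_sum gr_ring_closed)
          fix d
          show "hdop_restrict {x. lin_form L x = lin_form L e} (hdop_restrict {x. expo_deg x = d} H)
              \<in> left_ideal_gen (gr_ring L) (hdop_symbol L ` g ` G)"
            by (rule initial_part_generated[OF L g G graded[OF H], where d = d])
               (use e(2) in \<open>auto simp: homogeneous_def diagram_restrict\<close>)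
        qed
        finally show ?thesis .
      qed
    qed
  qed (auto intro: gr_ring_closed)
  show "left_ideal_gen (gr_ring L) (hdop_symbol L ` g ` G) \<subseteq> gr_ideal L J"
    unfolding gr_ideal_def
  proof (rule left_ideal_gen_least)
    show "hdop_symbol L ` g ` G \<subseteq> left_ideal_gen (gr_ring L) (hdop_symbol L ` J)"
      using symbol_in_gr_ideal g(1) unfolding gr_ideal_def by blast
  qed (auto intro: gr_ring_closed)
qed

end

section \<open>Equivalent weights\<close>

context graded_ideal begin

text \<open>Each symbol in the sum for \<open>s\<close> lifts to an element of \<open>J\<close>. If
  only the level of its cofactor that reaches \<open>c\<close> is kept, the lifted sum has no term
  above \<open>c\<close> and the required part at \<open>c\<close>.\<close>

lemma gr_ideal_component:
  assumes L: "L \<in> U_V" and s: "s \<in> gr_ideal L J"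
  shows "\<exists>H\<in>J. homogeneous d H \<and> (\<forall>x\<in>hdop_diagram H. lin_form L x \<le> c) \<and>
    hdop_restrict {x. lin_form L x = c} H = hdop_restrict {x. lin_form L x = c \<and> expo_deg x = d} s"
proof -
  obtain F A where F: "finite F" "F \<subseteq> hdop_symbol L ` J" "s = (\<Sum>S\<in>F. A S * S)"
    using s unfolding gr_ideal_def left_ideal_gen_def by blast
  have "\<exists>H\<in>J. \<exists>c. (\<forall>x\<in>hdop_diagram H. lin_form L x \<le> c) \<and> S = hdop_restrict {x. lin_form L x = c} H"
    if S: "S \<in> F" for S
  proof -
    obtain H where H: "H \<in> J" "S = hdop_symbol L H" using F(2) S by blast
    show ?thesis
    proof (cases "H = 0")
      case True
      then have "hdop_diagram H = {}" "S = 0"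
        using H(2) by (auto simp: diagram_eq_empty hdop_symbol_def restrict_0)
      \<comment> \<open>The zero operator has no terms, so any level serves.\<close>
      then show ?thesis using H(1) True by (intro bexI[of _ H] exI[of _ 0]) (auto simp: restrict_0)
    next
      case False
      then obtain e where "e \<in> hdop_diagram H"
        "\<And>x. x \<in> hdop_diagram H \<Longrightarrow> lin_form L x \<le> lin_form L e"
        using hdop_ord_attained[OF L] by metis
      then show ?thesis using H hdop_symbol_eq[of e H L] by blast
    qed
  qed
  then obtain P r where P: "\<And>S. S \<in> F \<Longrightarrow> P S \<in> J"
    "\<And>S x. S \<in> F \<Longrightarrow> x \<in> hdop_diagram (P S) \<Longrightarrow> lin_form L x \<le> r S"
    "\<And>S. S \<in> F \<Longrightarrow> S = hdop_restrict {x. lin_form L x = r S} (P S)"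
    by metis
  define B where "B S = hdop_restrict {x. lin_form L x = c - r S} (A S)" for S
  define H where "H = hdop_restrict {x. expo_deg x = d} (\<Sum>S\<in>F. B S * P S)"
  have le: "lin_form L x \<le> c" if Sx: "S \<in> F" "x \<in> hdop_diagram (B S * P S)" for S x
  proof -
    obtain x1 x2 where "x1 \<in> hdop_diagram (B S)" "x2 \<in> hdop_diagram (P S)"
        and sig: "expo_sig x = expo_sig x1 + expo_sig x2"
      using diagram_mult[OF Sx(2)] by blast
    then have "lin_form L x1 = c - r S" "lin_form L x2 \<le> r S"
      using P(2)[OF Sx(1)] by (auto simp: B_def diagram_restrict)
    then show ?thesis using lin_form_sig[OF sig, of L] by simp
  qed
  have top: "hdop_restrict {x. lin_form L x = c} (B S * P S) = hdop_restrict {x. lin_form L x = c} (A S * S)"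
    if S: "S \<in> F" for S
  proof -
    have "hdop_restrict {x. lin_form L x = c} (B S * P S) = hdop_restrict UNIV (B S) * hdop_restrict {x. lin_form L x = r S} (P S)"
    proof (rule restrict_mult)
      show "lin_form L x = lin_form L x1 + lin_form L x2" if "expo_sig x = expo_sig x1 + expo_sig x2"
        for x x1 x2 :: "('n + 'p) expo" using that by (rule lin_form_sig)
    qed (auto simp: B_def diagram_restrict)
    also have "\<dots> = B S * S" using P(3)[OF S] restrict_id[of "B S" UNIV] by simp
    also have "\<dots> = hdop_restrict {x. lin_form L x = c - r S} (A S) * hdop_restrict UNIV S"
      using restrict_id[of S UNIV] by (simp add: B_def)
    also have "\<dots> = hdop_restrict {x. lin_form L x = c} (A S * S)"
    proof (rule restrict_mult[symmetric])
      show "lin_form L x = lin_form L x1 + lin_form L x2" if "expo_sig x = expo_sig x1 + expo_sig x2"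
        for x x1 x2 :: "('n + 'p) expo" using that by (rule lin_form_sig)
      show "lin_form L x1 + lin_form L x2 = c \<longleftrightarrow> x1 \<in> {x. lin_form L x = c - r S} \<and> x2 \<in> UNIV"
        if "x2 \<in> hdop_diagram S" for x1 x2
      proof -
        have "x2 \<in> hdop_diagram (hdop_restrict {x. lin_form L x = r S} (P S))"
          using that P(3)[OF S] by simp
        then show ?thesis by (auto simp: diagram_restrict)
      qed
    qed
    finally show ?thesis .
  qed
  show ?thesis
  proof (intro bexI[of _ H] conjI)
    show "H \<in> J" unfolding H_def by (intro graded left_ideal_sum[OF ideal] J_mult P)
    show "homogeneous d H" by (auto simp: homogeneous_def H_def diagram_restrict)
    show "\<forall>x\<in>hdop_diagram H. lin_form L x \<le> c"
      using diagram_sum[of "\<lambda>S. B S * P S" F] le by (force simp: H_def diagram_restrict)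
    have "hdop_restrict {x. lin_form L x = c} H
        = hdop_restrict {x. expo_deg x = d} (hdop_restrict {x. lin_form L x = c} (\<Sum>S\<in>F. B S * P S))"
      by (simp add: H_def restrict_restrict Int_commute)
    also have "hdop_restrict {x. lin_form L x = c} (\<Sum>S\<in>F. B S * P S) = hdop_restrict {x. lin_form L x = c} s"
      unfolding F(3) restrict_sum by (intro sum.cong refl top)
    also have "hdop_restrict {x. expo_deg x = d} (hdop_restrict {x. lin_form L x = c} s)
        = hdop_restrict {x. lin_form L x = c \<and> expo_deg x = d} s"
      unfolding restrict_restrict by (rule arg_cong[where f = "\<lambda>X. hdop_restrict X s"]) auto
    finally show "hdop_restrict {x. lin_form L x = c} H = hdop_restrict {x. lin_form L x = c \<and> expo_deg x = d} s" .
  qed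
qed

text \<open>Each component of \<open>s\<close> by \<open>L\<close>-value and degree lifts
  separately, so \<open>e\<close> is compared only with exponents in its own component. This permits
  elements \<open>s\<close> that are symbols for another weight, as in
  \<open>lead_set_subset\<close>.\<close>

lemma gr_ideal_lead:
  assumes L: "L \<in> U_V" and s: "s \<in> gr_ideal L J" and e: "e \<in> hdop_diagram s"
    and min: "\<And>x. x \<in> hdop_diagram s \<Longrightarrow> lin_form L x = lin_form L e \<Longrightarrow> expo_deg x = expo_deg e \<Longrightarrow> x \<noteq> e \<Longrightarrow> tie e < tie x"
  shows "e \<in> lead_set L"
proof -
  obtain H where H: "H \<in> J" "homogeneous (expo_deg e) H" "\<And>x. x \<in> hdop_diagram H \<Longrightarrow> lin_form L x \<le> lin_form L e"
    "hdop_restrict {x. lin_form L x = lin_form L e} H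
      = hdop_restrict {x. lin_form L x = lin_form L e \<and> expo_deg x = expo_deg e} s"
    using gr_ideal_component[OF L s, of "expo_deg e" "lin_form L e"] by blast
  have eq: "hdop_diagram H \<inter> {x. lin_form L x = lin_form L e}
      = hdop_diagram s \<inter> {x. lin_form L x = lin_form L e \<and> expo_deg x = expo_deg e}"
    using arg_cong[OF H(4), of hdop_diagram] by (simp only: diagram_restrict)
  have "leads L H e"
    unfolding leads_def before_def
  proof (intro conjI ballI impI)
    show "e \<in> hdop_diagram H" using eq e by blast
    fix x assume x: "x \<in> hdop_diagram H" "x \<noteq> e"
    show "lin_form L x < lin_form L e \<or> lin_form L x = lin_form L e \<and> tie e < tie x"
    proof (cases "lin_form L x = lin_form L e")
      case True
      then have "x \<in> hdop_diagram s \<inter> {x. lin_form L x = lin_form L e \<and> expo_deg x = expo_deg e}"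
        using x(1) eq by blast
      then show ?thesis using min[of x] x(2) by simp
    next
      case False
      then show ?thesis using H(3)[OF x(1)] by simp
    qed
  qed
  then show ?thesis by (rule lead_setI[OF H(1,2)])
qed

lemma gr_ideal_zero:
  assumes L: "L \<in> U_V" and s: "s \<in> gr_ideal L J" and avoid: "hdop_diagram s \<inter> lead_set L = {}"
  shows "s = 0"
proof (rule ccontr)
  assume "s \<noteq> 0"
  then obtain e0 where e0: "e0 \<in> hdop_diagram s" using diagram_eq_empty by blast
  define T where "T = {x \<in> hdop_diagram s. lin_form L x = lin_form L e0 \<and> expo_deg x = expo_deg e0}"
  have "\<exists>e\<in>T. \<forall>x\<in>T. x \<noteq> e \<longrightarrow> tie e < tie x"
    by (rule ex_min_tie[of e0 T "expo_deg e0"]) (use e0 in \<open>auto simp: T_def\<close>)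
  then obtain e where e: "e \<in> T" "\<And>x. x \<in> T \<Longrightarrow> x \<noteq> e \<Longrightarrow> tie e < tie x" by blast
  then have es: "e \<in> hdop_diagram s" by (simp add: T_def)
  have "e \<in> lead_set L"
    by (rule gr_ideal_lead[OF L s es]) (use e in \<open>auto simp: T_def\<close>)
  then show False using avoid es by blast
qed

lemma lead_set_subset:
  assumes L': "L' \<in> U_V" and eq: "gr_ideal L J = gr_ideal L' J"
  shows "lead_set L \<subseteq> lead_set L'"
proof
  fix e assume "e \<in> lead_set L"
  then obtain H where H: "H \<in> J" "homogeneous (expo_deg e) H" "leads L H e"
    by (auto simp: lead_set_def)
  have s: "hdop_symbol L H \<in> gr_ideal L' J" using symbol_in_gr_ideal[OF H(1)] eq by blast
  have dia: "hdop_diagram (hdop_symbol L H) = hdop_diagram H \<inter> {x. lin_form L x = lin_form L e}"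
    by (simp only: symbol_leads[OF H(3)] diagram_restrict)
  show "e \<in> lead_set L'"
    by (rule gr_ideal_lead[OF L' s]) (use H(3) in \<open>auto simp: dia leads_def before_def\<close>)
qed

lemma lead_set_eq:
  "L \<in> U_V \<Longrightarrow> L' \<in> U_V \<Longrightarrow> gr_ideal L J = gr_ideal L' J \<Longrightarrow> lead_set L = lead_set L'"
  using lead_set_subset by (metis subset_antisym)

text \<open>For \<open>e\<close> in the difference, the monomial of \<open>e\<close> minus its
  \<open>L'\<close>-remainder lies in \<open>J\<close> and avoids \<open>lead_set L\<close>, hence
  vanishes. Then \<open>e\<close> occurs in a remainder although it is a leading exponent for
  \<open>L'\<close>.\<close>

lemma lead_set_subset_eq:
  assumes L: "L \<in> U_V" and L': "L' \<in> U_V" and sub: "lead_set L \<subseteq> lead_set L'"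
  shows "lead_set L = lead_set L'"
proof (rule ccontr)
  assume "lead_set L \<noteq> lead_set L'"
  then obtain e where e: "e \<in> lead_set L'" "e \<notin> lead_set L" using sub by blast
  have dia: "hdop_diagram (hdop_monom e) = {e}" by (auto simp: diagram_iff hdop_coeff_hdop_monom split: if_splits)
  then obtain R where R: "homogeneous (expo_deg e) R" "hdop_monom e - R \<in> J" "hdop_diagram R \<inter> lead_set L' = {}"
    using nf_exists[OF L', of "expo_deg e" "hdop_monom e" "lin_form L' e"] by (auto simp: homogeneous_def)
  have "hdop_monom e - R = 0"
  proof (rule nf_zero[OF L R(2)])
    show "homogeneous (expo_deg e) (hdop_monom e - R)"
      by (rule homogeneous_diff[OF _ R(1)]) (simp add: homogeneous_def dia)
    show "hdop_diagram (hdop_monom e - R) \<inter> lead_set L = {}"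
    proof -
      have "hdop_diagram (hdop_monom e - R) \<subseteq> {e} \<union> hdop_diagram R"
        using diagram_diff[of "hdop_monom e" R] by (simp only: dia)
      then show ?thesis using R(3) e(2) sub by blast
    qed
  qed
  then have "e \<in> hdop_diagram R" using dia by simp
  then show False using R(3) e(1) by blast
qed

text \<open>The element is the monomial of \<open>e\<close> minus its remainder. The weight enters
  the properties of \<open>g\<close> through \<open>lead_set L\<close> alone, so the same
  \<open>g\<close> serves every weight with these leading exponents.\<close>

lemma reduced_exists:
  assumes L: "L \<in> U_V" and e: "e \<in> lead_set L"
  shows "\<exists>g\<in>J. homogeneous (expo_deg e) g \<and> hdop_coeff g e = 1 \<and> hdop_diagram g \<inter> lead_set L = {e}"
proof -
  have dia: "hdop_diagram (hdop_monom e) = {e}" by (auto simp: diagram_iff hdop_coeff_hdop_monom split: if_splits)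
  then obtain R where R: "homogeneous (expo_deg e) R" "hdop_monom e - R \<in> J" "hdop_diagram R \<inter> lead_set L = {}"
    using nf_exists[OF L, of "expo_deg e" "hdop_monom e" "lin_form L e"] by (auto simp: homogeneous_def)
  have "hdop_coeff R e = 0" using R(3) e by (auto simp: diagram_iff)
  then have c: "hdop_coeff (hdop_monom e - R) e = 1" by (simp add: hdop_coeff_simps hdop_coeff_hdop_monom)
  then have "e \<in> hdop_diagram (hdop_monom e - R)" by (simp add: diagram_iff)
  moreover have "hdop_diagram (hdop_monom e - R) \<subseteq> {e} \<union> hdop_diagram R"
    using diagram_diff[of "hdop_monom e" R] by (simp only: dia)
  ultimately have "hdop_diagram (hdop_monom e - R) \<inter> lead_set L = {e}"
    using R(3) e by blast
  moreover have "homogeneous (expo_deg e) (hdop_monom e - R)"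
    by (rule homogeneous_diff[OF _ R(1)]) (simp add: homogeneous_def dia)
  ultimately show ?thesis using R(2) c by blast
qed

lemma reduced_leads:
  assumes L: "L \<in> U_V" and g: "g \<in> J" "homogeneous d g" "hdop_diagram g \<inter> lead_set L = {e}"
  shows "leads L g e"
proof -
  have "g \<noteq> 0" using g(3) diagram_eq_empty[of g] by blast
  then obtain e' where e': "leads L g e'" using ex_leads[OF L, of g d] g(2) by (auto simp: homogeneous_def)
  then have "e' \<in> hdop_diagram g \<inter> lead_set L" using lead_setI[OF g(1,2)] by (auto simp: leads_def)
  then show ?thesis using g(3) e' by simp
qed

text \<open>If the graded ideals agree, then so do the leading exponents, and the difference of the
  two symbols of a reduced element has lost \<open>e\<close>, so it avoids them and vanishes.
  Conversely, equal symbols keep \<open>e\<close> leading; the sets of leading exponents are then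
  nested, hence equal, and the same elements generate both graded ideals.\<close>

theorem gr_ideal_eq_iff:
  assumes L0: "L0 \<in> U_V"
  obtains G g where "finite G" "\<And>e. e \<in> G \<Longrightarrow> leads L0 (g e) e"
    "\<And>e. e \<in> G \<Longrightarrow> homogeneous (expo_deg e) (g e)"
    "\<And>L. L \<in> U_V \<Longrightarrow> (gr_ring L :: ('n + 'p) hdop set) = gr_ring L0 \<Longrightarrow>
      gr_ideal L J = gr_ideal L0 J \<longleftrightarrow> (\<forall>e\<in>G. hdop_symbol L (g e) = hdop_symbol L0 (g e))"
proof -
  obtain G where G: "finite G" "G \<subseteq> lead_set L0" "\<And>x. x \<in> lead_set L0 \<Longrightarrow> \<exists>e\<in>G. \<exists>s. x = e + s"
    by (rule dickson_expo) blast
  have "\<forall>e\<in>G. \<exists>g\<in>J. homogeneous (expo_deg e) g \<and> hdop_coeff g e = 1 \<and> hdop_diagram g \<inter> lead_set L0 = {e}"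
    using reduced_exists[OF L0] G(2) by blast
  then obtain g where g: "\<And>e. e \<in> G \<Longrightarrow> g e \<in> J" "\<And>e. e \<in> G \<Longrightarrow> homogeneous (expo_deg e) (g e)"
    "\<And>e. e \<in> G \<Longrightarrow> hdop_coeff (g e) e = 1" "\<And>e. e \<in> G \<Longrightarrow> hdop_diagram (g e) \<inter> lead_set L0 = {e}"
    by metis
  have leads0: "leads L0 (g e) e" if "e \<in> G" for e
    by (rule reduced_leads[OF L0 g(1,2,4)]) (fact that)+
  have "gr_ideal L J = gr_ideal L0 J \<longleftrightarrow> (\<forall>e\<in>G. hdop_symbol L (g e) = hdop_symbol L0 (g e))"
    if L: "L \<in> U_V" and ring: "(gr_ring L :: ('n + 'p) hdop set) = gr_ring L0" for L
  proof
    assume eq: "gr_ideal L J = gr_ideal L0 J"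
    then have lead: "lead_set L = lead_set L0" by (rule lead_set_eq[OF L L0])
    show "\<forall>e\<in>G. hdop_symbol L (g e) = hdop_symbol L0 (g e)"
    proof
      fix e assume e: "e \<in> G"
      have leadsL: "leads L (g e) e"
        by (rule reduced_leads[OF L g(1,2)[OF e]]) (simp add: lead g(4)[OF e])
      have "hdop_symbol L (g e) - hdop_symbol L0 (g e) = 0"
      proof (rule gr_ideal_zero[OF L0])
        show "hdop_symbol L (g e) - hdop_symbol L0 (g e) \<in> gr_ideal L0 J"
          using symbol_in_gr_ideal[OF g(1)[OF e]] eq by (intro gr_ideal_diff) blast+
        have "x \<notin> lead_set L0" if x: "x \<in> hdop_diagram (hdop_symbol L (g e) - hdop_symbol L0 (g e))" for x
        proof
          assume "x \<in> lead_set L0"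
          moreover have "x \<in> hdop_diagram (g e)"
            using x by (auto simp: diagram_iff symbol_leads[OF leadsL] symbol_leads[OF leads0[OF e]]
                hdop_coeff_simps hdop_coeff_restrict split: if_splits)
          ultimately have "x = e" using g(4)[OF e] by blast
          then show False
            using x by (simp add: diagram_iff symbol_leads[OF leadsL] symbol_leads[OF leads0[OF e]]
                hdop_coeff_simps hdop_coeff_restrict)
        qed
        then show "hdop_diagram (hdop_symbol L (g e) - hdop_symbol L0 (g e)) \<inter> lead_set L0 = {}" by blast
      qed
      then show "hdop_symbol L (g e) = hdop_symbol L0 (g e)" by simp
    qed
  next
    assume sym: "\<forall>e\<in>G. hdop_symbol L (g e) = hdop_symbol L0 (g e)"
    have leadsL: "leads L (g e) e" if e: "e \<in> G" for e
    proof -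
      have "e \<in> hdop_diagram (g e)" using leads0[OF e] by (simp add: leads_def)
      then have "g e \<noteq> 0" using diagram_eq_empty[of "g e"] by blast
      then obtain m where m: "m \<in> hdop_diagram (g e)"
        "\<And>x. x \<in> hdop_diagram (g e) \<Longrightarrow> lin_form L x \<le> lin_form L m"
        using hdop_ord_attained[OF L] by metis
      have "hdop_diagram (hdop_symbol L (g e)) = hdop_diagram (hdop_symbol L0 (g e))"
        using sym e by simp
      then have dia: "hdop_diagram (g e) \<inter> {x. lin_form L x = lin_form L m}
          = hdop_diagram (g e) \<inter> {x. lin_form L0 x = lin_form L0 e}"
        by (simp only: hdop_symbol_eq[OF m] symbol_leads[OF leads0[OF e]] diagram_restrict)
      then have em: "lin_form L e = lin_form L m" using leads0[OF e] by (auto simp: leads_def)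
      show ?thesis
        unfolding leads_def before_def
      proof (intro conjI ballI impI)
        show "e \<in> hdop_diagram (g e)" by fact
        fix x assume x: "x \<in> hdop_diagram (g e)" "x \<noteq> e"
        show "lin_form L x < lin_form L e \<or> lin_form L x = lin_form L e \<and> tie e < tie x"
        proof (cases "lin_form L x = lin_form L e")
          case True
          then have "lin_form L0 x = lin_form L0 e" using dia x(1) em by auto
          then show ?thesis using True leads0[OF e] x by (auto simp: leads_def before_def)
        next
          case False
          then show ?thesis using m(2)[OF x(1)] em by simp
        qed
      qed
    qed
    have "lead_set L0 \<subseteq> lead_set L"
    proof
      fix x assume "x \<in> lead_set L0"
      then obtain e s where e: "e \<in> G" "x = e + s" using G(3) by blast
      have "e \<in> lead_set L" by (rule lead_setI) (use g leadsL e in blast)+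
      then show "x \<in> lead_set L" unfolding e(2) by (rule lead_set_add)
    qed
    then have "lead_set L = lead_set L0" using lead_set_subset_eq[OF L0 L] by simp
    then have gens: "\<And>x. x \<in> lead_set L \<Longrightarrow> \<exists>e\<in>G. \<exists>s. x = e + s" using G(3) by simp
    have "gr_ideal L J = left_ideal_gen (gr_ring L) (hdop_symbol L ` g ` G)"
      by (rule gr_ideal_generated[OF L g(1,2) leadsL g(3) gens])
    also have "\<dots> = left_ideal_gen (gr_ring L0) (hdop_symbol L0 ` g ` G)"
      using sym ring by (simp add: image_image)
    also have "\<dots> = gr_ideal L0 J"
      by (rule gr_ideal_generated[OF L0 g(1,2) leads0 g(3) G(3), symmetric])
    finally show "gr_ideal L J = gr_ideal L0 J" .
  qed
  then show ?thesis using G(1) leads0 g(2) by (intro that[of G g])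
qed

end

section \<open>Cones of the fan\<close>

lemma gr_ring_eq_iff:
  "(gr_ring L :: ('n::finite + 'p::finite) hdop set) = gr_ring L' \<longleftrightarrow> (\<forall>j. 0 < L $ j \<longleftrightarrow> 0 < L' $ j)"
proof
  assume eq: "(gr_ring L :: ('n + 'p) hdop set) = gr_ring L'"
  show "\<forall>j. 0 < L $ j \<longleftrightarrow> 0 < L' $ j"
  proof
    fix j
    \<comment> \<open>the geometric series in \<open>t\<^sub>j\<close>\<close>
    define f where "f a = (if \<forall>i. i \<noteq> Inr j \<longrightarrow> a i = 0 then 1 else (0 :: complex))" for a :: "'n + 'p \<Rightarrow> nat"
    have "conv_series f"
    proof (rule conv_series_powr_bound)
      show "norm (f a) * (1/2) powr wsum (\<lambda>_. 1) a \<le> 1" for a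
      proof -
        have "(1/2 :: real) powr wsum (\<lambda>_. 1) a \<le> (1/2) powr 0"
          by (rule powr_mono') (auto intro: wsum_nonneg)
        then show ?thesis by (simp add: f_def)
      qed
    qed simp
    then have f: "cps_nth (Abs_cps f) = f" by (simp add: Abs_cps_inverse)
    define P where "P = hdop_of_slices {(0, 0)} (\<lambda>_. Abs_cps f)"
    have P: "(a, b, k) \<in> hdop_diagram P \<longleftrightarrow> f a \<noteq> 0 \<and> b = 0 \<and> k = 0" for a b k
      by (auto simp: P_def diagram_iff hdop_coeff_slice hdop_slice_of_slices f cps_nth_0)
    have in_gr: "P \<in> gr_ring L \<longleftrightarrow> \<not> 0 < L $ j" for L :: "real^'p"
    proof
      assume PL: "P \<in> gr_ring L"
      show "\<not> 0 < L $ j"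
      proof
        assume "0 < L $ j"
        then obtain m where m: "\<And>e. e \<in> hdop_diagram P \<Longrightarrow> fst e (Inr j) \<le> m"
          using PL unfolding gr_ring_bound by blast
        have "((0 :: 'n + 'p \<Rightarrow> nat)(Inr j := Suc m), 0, 0) \<in> hdop_diagram P" by (simp add: P f_def)
        from m[OF this] show False by simp
      qed
    next
      assume nj: "\<not> 0 < L $ j"
      have "fst e (Inr i) \<le> 0" if "0 < L $ i" "e \<in> hdop_diagram P" for i e
        using that nj by (cases e; cases "i = j") (auto simp: P f_def split: if_splits)
      then show "P \<in> gr_ring L" unfolding gr_ring_bound by blast
    qed
    show "0 < L $ j \<longleftrightarrow> 0 < L' $ j" using in_gr[of L] in_gr[of L'] eq by blast
  qed
next
  assume "\<forall>j. 0 < L $ j \<longleftrightarrow> 0 < L' $ j"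
  then show "(gr_ring L :: ('n + 'p) hdop set) = gr_ring L'" by (simp add: gr_ring_def)
qed

text \<open>Infinitely many equations can occur in the application. They still cut out a subspace,
  whereas every inequality costs a half-space.\<close>

lemma polyhedron_closed_cone:
  fixes U V :: "'a::euclidean_space set"
  assumes "finite V"
  shows "polyhedron {L. (\<forall>u\<in>U. L \<bullet> u = 0) \<and> (\<forall>v\<in>V. 0 \<le> L \<bullet> v)}"
proof -
  have "subspace {L. \<forall>u\<in>U. L \<bullet> u = 0}"
    by (auto simp: subspace_def inner_add_left)
  then have "polyhedron {L. \<forall>u\<in>U. L \<bullet> u = 0}"
    by (intro affine_imp_polyhedron subspace_imp_affine)
  moreover have "polyhedron (\<Inter>((\<lambda>v. {L. 0 \<le> v \<bullet> L}) ` V))"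
    using assms by (intro polyhedron_Inter) (auto intro: polyhedron_halfspace_ge)
  moreover have "{L. (\<forall>u\<in>U. L \<bullet> u = 0) \<and> (\<forall>v\<in>V. 0 \<le> L \<bullet> v)}
      = {L. \<forall>u\<in>U. L \<bullet> u = 0} \<inter> \<Inter>((\<lambda>v. {L. 0 \<le> v \<bullet> L}) ` V)"
    by (auto simp: inner_commute)
  ultimately show ?thesis by simp
qed

text \<open>Adding a small positive multiple of \<open>L0\<close> preserves the equations and makes
  the weak inequalities strict.\<close>

lemma closure_open_cone:
  fixes U V :: "'a::euclidean_space set"
  assumes V: "finite V" and L0: "\<forall>u\<in>U. L0 \<bullet> u = 0" "\<forall>v\<in>V. 0 < L0 \<bullet> v"
  shows "closure {L. (\<forall>u\<in>U. L \<bullet> u = 0) \<and> (\<forall>v\<in>V. 0 < L \<bullet> v)} = {L. (\<forall>u\<in>U. L \<bullet> u = 0) \<and> (\<forall>v\<in>V. 0 \<le> L \<bullet> v)}"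
    (is "closure ?S = ?C")
proof
  have "closed ?C"
    by (rule polyhedron_imp_closed[OF polyhedron_closed_cone[OF V]])
  then show "closure ?S \<subseteq> ?C" by (intro closure_minimal) (auto intro: less_imp_le)
  show "?C \<subseteq> closure ?S"
  proof
    fix L assume L: "L \<in> ?C"
    show "L \<in> closure ?S"
      unfolding closure_approachable
    proof (intro allI impI)
      fix e :: real assume e: "0 < e"
      define t where "t = (e / 2) / (norm L0 + 1)"
      have pos: "0 < norm L0 + 1" using norm_ge_zero[of L0] by linarith
      have t: "0 < t" using e pos by (simp add: t_def)
      have "L + t *\<^sub>R L0 \<in> ?S"
        using L L0 t by (auto simp: inner_add_left intro!: add_nonneg_pos)
      moreover have "dist (L + t *\<^sub>R L0) L < e"
      proof -
        have "t * norm L0 \<le> t * (norm L0 + 1)" using t by simp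
        also have "\<dots> = e / 2"
          unfolding t_def using pos less_imp_neq nonzero_mult_div_cancel_right times_divide_eq_left by metis
        finally show ?thesis using e t by (simp add: dist_norm)
      qed
      ultimately show "\<exists>y\<in>?S. dist y L < e" by blast
    qed
  qed
qed

definition expo_vec :: "('n::finite + 'p::finite) expo \<Rightarrow> real^'p" where
  "expo_vec e = (\<chi> j. V_form j e)"

lemma lin_form_inner: "lin_form L e = L \<bullet> expo_vec e"
  by (simp add: lin_form_def expo_vec_def inner_vec_def)

lemma groebner_class:
  fixes J :: "('n::finite + 'p::finite) hdop set"
  assumes "\<sigma> \<in> V_groebner_fan J"
  obtains L0 where "L0 \<in> U_V"
    "\<sigma> = {L \<in> U_V. (gr_ring L :: ('n + 'p) hdop set) = gr_ring L0 \<and> gr_ideal L J = gr_ideal L0 J}"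
  using assms unfolding V_groebner_fan_def groebner_equiv_def
  by (elim quotientE) (rule that, auto)

text \<open>A ray contains at most one primitive vector, so finitely many faces leave finitely many
  generators.\<close>

lemma finite_skeleton_generators:
  assumes "finite {F. F face_of closure \<sigma>}"
  shows "finite (skeleton_generators \<sigma>)"
proof (rule finite_imageD)
  show "finite (ray ` skeleton_generators \<sigma>)"
    by (rule finite_subset[OF _ assms]) (auto simp: skeleton_generators_def)
  show "inj_on ray (skeleton_generators \<sigma>)"
  proof (rule inj_onI)
    fix L L' assume L: "L \<in> skeleton_generators \<sigma>" "L' \<in> skeleton_generators \<sigma>" "ray L = ray L'"
    have "L' \<in> ray L'" unfolding ray_def by (auto intro: exI[of _ 1])
    then obtain c where "L' = c *\<^sub>R L" "0 \<le> c" using L(3) unfolding ray_def by blast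
    then show "L = L'" using L(1,2) primitive_proportional by (metis (mono_tags) mem_Collect_eq skeleton_generators_def)
  qed
qed

context graded_ideal begin

text \<open>A symbol of a reduced element is unchanged exactly if \<open>L\<close> is constant on
  its exponents \<open>N0 e\<close> and strictly smaller on the remaining ones, \<open>N1 e\<close>.
  The latter can be infinitely many, but it suffices to test the minimal ones in \<open>M e\<close>,
  since multiplication by variables does not raise \<open>L\<close>.\<close>

theorem polyhedron_closure_cone:
  assumes \<sigma>: "\<sigma> \<in> V_groebner_fan J"
  shows "polyhedron (closure \<sigma>)"
proof -
  obtain L0 where L0: "L0 \<in> U_V"
    and \<sigma>_eq: "\<sigma> = {L \<in> U_V. (gr_ring L :: ('n + 'p) hdop set) = gr_ring L0 \<and> gr_ideal L J = gr_ideal L0 J}"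
    using groebner_class[OF \<sigma>] by blast
  obtain G g where G: "finite G" "\<And>e. e \<in> G \<Longrightarrow> leads L0 (g e) e" "\<And>e. e \<in> G \<Longrightarrow> homogeneous (expo_deg e) (g e)"
    "\<And>L. L \<in> U_V \<Longrightarrow> (gr_ring L :: ('n + 'p) hdop set) = gr_ring L0 \<Longrightarrow>
      gr_ideal L J = gr_ideal L0 J \<longleftrightarrow> (\<forall>e\<in>G. hdop_symbol L (g e) = hdop_symbol L0 (g e))"
    by (rule gr_ideal_eq_iff[OF L0]) blast
  define N0 where "N0 e = {x \<in> hdop_diagram (g e). lin_form L0 x = lin_form L0 e}" for e
  define N1 where "N1 e = {x \<in> hdop_diagram (g e). lin_form L0 x < lin_form L0 e}" for e
  have "\<exists>M. finite M \<and> M \<subseteq> N1 e \<and> (\<forall>x\<in>N1 e. \<exists>m\<in>M. \<exists>a. x = m + (a, 0, 0))" if "e \<in> G" for e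
    using dickson_degree[of "N1 e" "expo_deg e"] G(3)[OF that] unfolding homogeneous_def N1_def
    by (metis (no_types, lifting) mem_Collect_eq)
  then obtain M where M: "\<And>e. e \<in> G \<Longrightarrow> finite (M e)" "\<And>e. e \<in> G \<Longrightarrow> M e \<subseteq> N1 e"
    "\<And>e x. e \<in> G \<Longrightarrow> x \<in> N1 e \<Longrightarrow> \<exists>m\<in>M e. \<exists>a. x = m + (a, 0, 0)"
    by metis
  have symbol: "hdop_symbol L (g e) = hdop_symbol L0 (g e) \<longleftrightarrow>
      (\<forall>x\<in>N0 e. lin_form L x = lin_form L e) \<and> (\<forall>m\<in>M e. lin_form L m < lin_form L e)"
    if L: "L \<in> U_V" and e: "e \<in> G" for L e
  proof -
    have eg: "e \<in> hdop_diagram (g e)" using G(2)[OF e] by (simp add: leads_def)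
    have sym0: "hdop_symbol L0 (g e) = hdop_restrict {x. lin_form L0 x = lin_form L0 e} (g e)"
      by (rule symbol_leads[OF G(2)[OF e]])
    have split: "hdop_diagram (g e) = N0 e \<union> N1 e"
      using leads_le[OF G(2)[OF e]] by (force simp: N0_def N1_def)
    show ?thesis
    proof
      assume eq: "hdop_symbol L (g e) = hdop_symbol L0 (g e)"
      have "g e \<noteq> 0" using eg diagram_eq_empty[of "g e"] by blast
      then obtain m where m: "m \<in> hdop_diagram (g e)"
        "\<And>x. x \<in> hdop_diagram (g e) \<Longrightarrow> lin_form L x \<le> lin_form L m"
        using hdop_ord_attained[OF L] by metis
      have "hdop_diagram (g e) \<inter> {x. lin_form L x = lin_form L m}
          = hdop_diagram (g e) \<inter> {x. lin_form L0 x = lin_form L0 e}"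
        using arg_cong[OF eq, of hdop_diagram] by (simp only: hdop_symbol_eq[OF m] sym0 diagram_restrict)
      also have "\<dots> = N0 e" by (auto simp only: N0_def)
      finally have "hdop_diagram (g e) \<inter> {x. lin_form L x = lin_form L m} = N0 e" .
      then have mN0: "x \<in> N0 e \<longleftrightarrow> x \<in> hdop_diagram (g e) \<and> lin_form L x = lin_form L m" for x
        by blast
      have "e \<in> N0 e" using eg by (simp add: N0_def)
      then have em: "lin_form L e = lin_form L m" by (simp only: mN0)
      have N0: "lin_form L x = lin_form L e \<longleftrightarrow> x \<in> N0 e" if "x \<in> hdop_diagram (g e)" for x
        using that by (simp only: mN0 em simp_thms)
      show "(\<forall>x\<in>N0 e. lin_form L x = lin_form L e) \<and> (\<forall>m\<in>M e. lin_form L m < lin_form L e)"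
      proof (intro conjI ballI)
        show "lin_form L x = lin_form L e" if "x \<in> N0 e" for x using N0 that by (simp add: N0_def)
        show "lin_form L x < lin_form L e" if x: "x \<in> M e" for x
        proof -
          have "x \<in> N1 e" using M(2)[OF e] x by blast
          then have "x \<in> hdop_diagram (g e)" "x \<notin> N0 e" by (auto simp: N0_def N1_def)
          then show ?thesis using m(2) em N0 by fastforce
        qed
      qed
    next
      assume H: "(\<forall>x\<in>N0 e. lin_form L x = lin_form L e) \<and> (\<forall>m\<in>M e. lin_form L m < lin_form L e)"
      have less: "lin_form L x < lin_form L e" if "x \<in> N1 e" for x
        using M(3)[OF e that] H lin_form_add_le[OF L] by (metis le_less_trans)
      have "hdop_symbol L (g e) = hdop_restrict {x. lin_form L x = lin_form L e} (g e)"
        by (rule hdop_symbol_eq[OF eg]) (use split H less in \<open>force intro: less_imp_le\<close>)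
      also have "\<dots> = hdop_symbol L0 (g e)"
        unfolding sym0
      proof (rule hdop_eqI)
        fix x
        have "lin_form L x = lin_form L e \<longleftrightarrow> lin_form L0 x = lin_form L0 e" if "x \<in> hdop_diagram (g e)"
        proof (cases "x \<in> N0 e")
          case True
          moreover have "lin_form L0 x = lin_form L0 e" using True unfolding N0_def by blast
          ultimately show ?thesis using H by blast
        next
          case False
          then have "x \<in> N1 e" using that split by blast
          then show ?thesis using less by (fastforce simp: N1_def)
        qed
        then show "hdop_coeff (hdop_restrict {x. lin_form L x = lin_form L e} (g e)) x
            = hdop_coeff (hdop_restrict {x. lin_form L0 x = lin_form L0 e} (g e)) x"
          by (auto simp: hdop_coeff_restrict diagram_iff)
      qed
      finally show "hdop_symbol L (g e) = hdop_symbol L0 (g e)" .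
    qed
  qed
  \<comment> \<open>The unit vectors in \<open>U\<close> and \<open>V\<close> express that
    \<open>L\<close> has the same positive coordinates as \<open>L0\<close>, that is, the same
    graded ring.\<close>
  define U where "U = (\<lambda>j. axis j 1) ` {j. \<not> 0 < L0 $ j} \<union> (\<Union>e\<in>G. (\<lambda>x. expo_vec x - expo_vec e) ` N0 e)"
  define V where "V = (\<lambda>j. axis j 1) ` {j. 0 < L0 $ j} \<union> (\<Union>e\<in>G. (\<lambda>x. expo_vec e - expo_vec x) ` M e)"
  have V: "finite V" using G(1) M(1) by (auto simp: V_def)
  have "L \<in> \<sigma> \<longleftrightarrow> (\<forall>u\<in>U. L \<bullet> u = 0) \<and> (\<forall>v\<in>V. 0 < L \<bullet> v)" for L
  proof -
    have UV: "(\<forall>u\<in>U. L \<bullet> u = 0) \<and> (\<forall>v\<in>V. 0 < L \<bullet> v) \<longleftrightarrow>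
        (\<forall>j. \<not> 0 < L0 $ j \<longrightarrow> L $ j = 0) \<and> (\<forall>j. 0 < L0 $ j \<longrightarrow> 0 < L $ j) \<and>
        (\<forall>e\<in>G. (\<forall>x\<in>N0 e. lin_form L x = lin_form L e) \<and> (\<forall>m\<in>M e. lin_form L m < lin_form L e))"
      by (auto simp: U_def V_def ball_Un inner_axis lin_form_inner inner_diff_right)
    have pos: "L \<in> U_V \<and> (\<forall>j. 0 < L $ j \<longleftrightarrow> 0 < L0 $ j) \<longleftrightarrow>
        (\<forall>j. \<not> 0 < L0 $ j \<longrightarrow> L $ j = 0) \<and> (\<forall>j. 0 < L0 $ j \<longrightarrow> 0 < L $ j)"
      unfolding U_V_def by (fastforce simp: less_le)
    have "L \<in> \<sigma> \<longleftrightarrow> L \<in> U_V \<and> (\<forall>j. 0 < L $ j \<longleftrightarrow> 0 < L0 $ j) \<and> gr_ideal L J = gr_ideal L0 J"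
      by (simp add: \<sigma>_eq gr_ring_eq_iff)
    also have "\<dots> \<longleftrightarrow> L \<in> U_V \<and> (\<forall>j. 0 < L $ j \<longleftrightarrow> 0 < L0 $ j) \<and>
        (\<forall>e\<in>G. hdop_symbol L (g e) = hdop_symbol L0 (g e))"
      by (intro conj_cong refl G(4) gr_ring_eq_iff[THEN iffD2])
    also have "\<dots> \<longleftrightarrow> L \<in> U_V \<and> (\<forall>j. 0 < L $ j \<longleftrightarrow> 0 < L0 $ j) \<and>
        (\<forall>e\<in>G. (\<forall>x\<in>N0 e. lin_form L x = lin_form L e) \<and> (\<forall>m\<in>M e. lin_form L m < lin_form L e))"
      by (intro conj_cong refl ball_cong symbol)
    finally show ?thesis unfolding UV using pos by (simp only: conj_assoc[symmetric])
  qed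
  then have \<sigma>_UV: "\<sigma> = {L. (\<forall>u\<in>U. L \<bullet> u = 0) \<and> (\<forall>v\<in>V. 0 < L \<bullet> v)}" by blast
  have "L0 \<in> \<sigma>" using L0 by (simp add: \<sigma>_eq)
  then have "(\<forall>u\<in>U. L0 \<bullet> u = 0) \<and> (\<forall>v\<in>V. 0 < L0 \<bullet> v)" unfolding \<sigma>_UV by blast
  then have "closure \<sigma> = {L. (\<forall>u\<in>U. L \<bullet> u = 0) \<and> (\<forall>v\<in>V. 0 \<le> L \<bullet> v)}"
    unfolding \<sigma>_UV by (intro closure_open_cone[OF V]) auto
  then show ?thesis using polyhedron_closed_cone[OF V] by simp
qed

end

section \<open>Homogenization and dehomogenization\<close>

definition ore_map :: "('r::comm_ring_1 \<Rightarrow> 's::comm_ring_1) \<Rightarrow> (('v \<Rightarrow> nat) \<Rightarrow>\<^sub>0 'r) \<Rightarrow> (('v \<Rightarrow> nat) \<Rightarrow>\<^sub>0 's)" where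
  "ore_map \<phi> Q = (\<Sum>\<beta>\<in>Poly_Mapping.keys Q. Poly_Mapping.single \<beta> (\<phi> (Poly_Mapping.lookup Q \<beta>)))"

lemma lookup_ore_map:
  assumes "\<phi> 0 = 0"
  shows "Poly_Mapping.lookup (ore_map \<phi> Q) b = \<phi> (Poly_Mapping.lookup Q b)"
  using assms by (auto simp: ore_map_def lookup_sum lookup_single when_def in_keys_iff)

text \<open>Evaluation at \<open>z = 1\<close> takes \<open>zpoly_pd\<close> to
  \<open>cps_pd\<close>; this makes dehomogenization multiplicative.\<close>

lemma ore_map_mult:
  assumes "commuting_derivations \<delta>" "commuting_derivations \<delta>'"
    and \<phi>: "\<And>x y. \<phi> (x + y) = \<phi> x + \<phi> y" "\<And>x y. \<phi> (x * y) = \<phi> x * \<phi> y"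
      "\<And>i x. \<phi> (\<delta> i x) = \<delta>' i (\<phi> x)"
  shows "ore_map \<phi> (ore_mult \<delta> P Q) = ore_mult \<delta>' (ore_map \<phi> P) (ore_map \<phi> Q)"
proof -
  interpret A: commuting_derivations \<delta> by fact
  interpret B: commuting_derivations \<delta>' by fact
  have \<phi>0: "\<phi> 0 = 0" using additive_sum(1)[of \<phi>] \<phi>(1) by blast
  have add: "ore_map \<phi> (P + Q) = ore_map \<phi> P + ore_map \<phi> Q" for P Q
    by (rule poly_mapping_eqI) (simp add: lookup_ore_map \<phi>0 lookup_add \<phi>(1))
  have single: "ore_map \<phi> (Poly_Mapping.single \<beta> c) = Poly_Mapping.single \<beta> (\<phi> c)" for \<beta> c
    by (rule poly_mapping_eqI) (simp add: lookup_ore_map \<phi>0 lookup_single when_def)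
  have scale: "ore_map \<phi> (ore_scale c Q) = ore_scale (\<phi> c) (ore_map \<phi> Q)" for c Q
    by (rule poly_mapping_eqI) (simp add: lookup_ore_map \<phi>0 lookup_ore_scale \<phi>(2))
  have left: "ore_map \<phi> (ore_left \<delta> i Q) = ore_left \<delta>' i (ore_map \<phi> Q)" for i Q
    by (rule poly_mapping_eqI) (simp add: lookup_ore_map \<phi>0 A.lookup_ore_left B.lookup_ore_left \<phi>)
  have pow: "ore_map \<phi> (ore_left_pow \<delta> \<beta> Q) = ore_left_pow \<delta>' \<beta> (ore_map \<phi> Q)" for \<beta> Q
    by (rule A.multi_index_induct) (simp_all only: A.left_pow_0 B.left_pow_0 A.left_pow_Suc B.left_pow_Suc left)
  show ?thesis
    by (rule additive_eqI[where Q = P])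
       (simp_all only: add A.mult_add_left B.mult_add_left single A.mult_single B.mult_single scale pow)
qed

definition dehom :: "'v::finite hdop \<Rightarrow> 'v dop" where
  "dehom H = Abs_dop (ore_map (\<lambda>p. poly p 1) (hdop_expansion H))"

lemma poly_zpoly_pd: "poly (zpoly_pd i p) 1 = cps_pd i (poly p 1)"
proof -
  have "poly (map_poly (cps_pd i) p) 1 = cps_pd i (poly p 1)"
    by (induction p) (simp_all add: map_poly_pCons cps.\<delta>_0 cps_pd_add)
  then show ?thesis by (simp add: zpoly_pd_def)
qed

lemma lookup_dehom:
  "Poly_Mapping.lookup (dop_expansion (dehom H)) b = poly (Poly_Mapping.lookup (hdop_expansion H) b) 1"
  by (simp add: dehom_def Abs_dop_inverse lookup_ore_map)

lemma dop_eqI: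
  "(\<And>b. Poly_Mapping.lookup (dop_expansion P) b = Poly_Mapping.lookup (dop_expansion Q) b) \<Longrightarrow> P = Q"
  by (rule dop_expansion_inject[THEN iffD1], rule poly_mapping_eqI)

lemma dehom_add: "dehom (H + H') = dehom H + dehom H'"
  by (rule dop_eqI) (simp add: lookup_dehom plus_dop.rep_eq plus_hdop.rep_eq lookup_add)

lemma dehom_diff: "dehom (H - H') = dehom H - dehom H'"
  by (rule dop_eqI) (simp add: lookup_dehom minus_dop.rep_eq minus_hdop.rep_eq lookup_minus)

lemma dehom_sum: "dehom (\<Sum>x\<in>A. F x) = (\<Sum>x\<in>A. dehom (F x))"
  by (rule additive_sum(2)) (rule dehom_add)

lemma dehom_mult: "dehom (H * H') = dehom H * dehom H'"
proof -
  have "ore_map (\<lambda>p. poly p 1) (ore_mult zpoly_pd (hdop_expansion H) (hdop_expansion H'))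
      = ore_mult cps_pd (ore_map (\<lambda>p. poly p 1) (hdop_expansion H)) (ore_map (\<lambda>p. poly p 1) (hdop_expansion H'))"
    by (rule ore_map_mult) (simp_all add: poly_zpoly_pd zpoly.commuting_derivations_axioms cps.commuting_derivations_axioms)
  then show ?thesis by (simp add: dehom_def times_hdop.rep_eq times_dop.abs_eq)
qed

text \<open>Terms that differ only in the power of \<open>z\<close> may cancel, so a converse cannot
  be expected. Upper bounds on \<open>L\<close> survive because \<open>L\<close> ignores
  \<open>z\<close>.\<close>

lemma dop_diagram_dehom:
  assumes "(a, b, 0) \<in> dop_diagram (dehom H)"
  shows "\<exists>k. (a, b, k) \<in> hdop_diagram H"
proof -
  define p where "p = Poly_Mapping.lookup (hdop_expansion H) b"
  have "cps_nth (\<Sum>k\<le>degree p. poly.coeff p k) a \<noteq> 0"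
    using assms by (simp add: dop_diagram_def lookup_dehom poly_altdef p_def)
  then have "(\<Sum>k\<le>degree p. cps_nth (poly.coeff p k) a) \<noteq> 0"
    by (subst additive_sum(2)[where F = "\<lambda>f. cps_nth f a", symmetric]) (auto simp: cps_nth_add)
  then obtain k where "cps_nth (poly.coeff p k) a \<noteq> 0"
    by (rule sum.not_neutral_contains_not_neutral)
  then show ?thesis by (auto simp: diagram_iff hdop_coeff_def p_def)
qed

lemma dop_diagram_iff: "(a, b, k) \<in> dop_diagram P \<longleftrightarrow> k = 0 \<and> cps_nth (Poly_Mapping.lookup (dop_expansion P) b) a \<noteq> 0"
  by (auto simp: dop_diagram_def)

text \<open>Upper bounds avoid \<open>dop_degree\<close> at the zero operator, where it is the
  maximum of an empty set.\<close>

definition dop_bound :: "nat \<Rightarrow> 'v::finite dop \<Rightarrow> bool" where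
  "dop_bound d P \<longleftrightarrow> (\<forall>b\<in>Poly_Mapping.keys (dop_expansion P). (\<Sum>i\<in>UNIV. b i) \<le> d)"

lemma dop_bound_degree: "dop_bound (dop_degree P) P"
  by (auto simp: dop_bound_def dop_degree_def intro!: Max_ge)

lemma dop_bound_mono: "dop_bound d P \<Longrightarrow> d \<le> d' \<Longrightarrow> dop_bound d' P"
  by (auto simp: dop_bound_def)

lemma lookup_dop_diff: "Poly_Mapping.lookup (dop_expansion (P - Q)) b
    = Poly_Mapping.lookup (dop_expansion P) b - Poly_Mapping.lookup (dop_expansion Q) b"
  by (simp add: minus_dop.rep_eq lookup_minus)

lemma dop_bound_diff:
  assumes "dop_bound d P" "dop_bound d Q"
  shows "dop_bound d (P - Q)"
  unfolding dop_bound_def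
proof
  fix b assume "b \<in> Poly_Mapping.keys (dop_expansion (P - Q))"
  then have "b \<in> Poly_Mapping.keys (dop_expansion P) \<or> b \<in> Poly_Mapping.keys (dop_expansion Q)"
    by (auto simp: in_keys_iff lookup_dop_diff)
  then show "(\<Sum>i\<in>UNIV. b i) \<le> d" using assms by (auto simp: dop_bound_def)
qed

text \<open>
  Homogenization in a fixed degree \<open>d\<close>, which is additive; it agrees with \<open>homogenize\<close> up to a
  power of \<open>z\<close>.
\<close>

definition hom_in_degree :: "nat \<Rightarrow> 'v::finite dop \<Rightarrow> 'v hdop" where
  "hom_in_degree d P = hdop_of_slices (slices d) (\<lambda>(b, k). Poly_Mapping.lookup (dop_expansion P) b)"

lemma hdop_slice_hom:
  "hdop_slice (hom_in_degree d P) (b, k) =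
    (if (\<Sum>i\<in>UNIV. b i) + k = d then Poly_Mapping.lookup (dop_expansion P) b else 0)"
  unfolding hom_in_degree_def hdop_slice_of_slices[OF finite_slices] by (simp add: slices_def)

lemma hom_diff: "hom_in_degree d (P - Q) = hom_in_degree d P - hom_in_degree d Q"
  by (rule hdop_slice_eqI) (auto simp: hdop_slice_hom hdop_slice_simps lookup_dop_diff)

lemma homogeneous_hom: "homogeneous d (hom_in_degree d P)"
proof -
  have "expo_deg e = d" if "e \<in> hdop_diagram (hom_in_degree d P)" for e
    using that by (cases e) (auto simp: diagram_iff hdop_coeff_slice hdop_slice_hom cps_nth_0 expo_deg_simp split: if_splits)
  then show ?thesis by (simp add: homogeneous_def)
qed

lemma diagram_hom: "(a, b, k) \<in> hdop_diagram (hom_in_degree d P) \<Longrightarrow> (a, b, 0) \<in> dop_diagram P"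
  by (auto simp: diagram_iff hdop_coeff_slice hdop_slice_hom dop_diagram_iff cps_nth_0 split: if_splits)

lemma dehom_hom:
  assumes "dop_bound d P"
  shows "dehom (hom_in_degree d P) = P"
proof (rule dop_eqI)
  fix b
  define p where "p = Poly_Mapping.lookup (hdop_expansion (hom_in_degree d P)) b"
  define c where "c = Poly_Mapping.lookup (dop_expansion P) b"
  have coeff: "poly.coeff p k = (if (\<Sum>i\<in>UNIV. b i) + k = d then c else 0)" for k
    using hdop_slice_hom[of d P b k] by (simp add: hdop_slice_def p_def c_def)
  have "p = (if (\<Sum>i\<in>UNIV. b i) \<le> d then monom c (d - (\<Sum>i\<in>UNIV. b i)) else 0)"
    by (rule poly_eqI) (auto simp: coeff)
  moreover have "c = 0" if "\<not> (\<Sum>i\<in>UNIV. b i) \<le> d"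
    using that assms by (auto simp: dop_bound_def c_def in_keys_iff)
  ultimately show "Poly_Mapping.lookup (dop_expansion (dehom (hom_in_degree d P))) b
      = Poly_Mapping.lookup (dop_expansion P) b"
    by (auto simp: lookup_dehom p_def[symmetric] c_def[symmetric] poly_monom)
qed

lemma homogenize_eq_hom: "homogenize P = hom_in_degree (dop_degree P) P"
proof (rule hdop_slice_eqI)
  fix bk :: "('a \<Rightarrow> nat) \<times> nat"
  obtain b k where bk: "bk = (b, k)" by (cases bk)
  define c where "c = Poly_Mapping.lookup (dop_expansion P) b"
  have "Poly_Mapping.lookup (hdop_expansion (homogenize P)) b = monom c (dop_degree P - (\<Sum>i\<in>UNIV. b i))"
    by (simp add: homogenize_def Abs_hdop_inverse lookup_sum lookup_single when_def c_def in_keys_iff)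
  moreover have "(\<Sum>i\<in>UNIV. b i) \<le> dop_degree P" if "c \<noteq> 0"
    using that dop_bound_degree[of P] by (auto simp: dop_bound_def c_def in_keys_iff)
  ultimately show "hdop_slice (homogenize P) bk = hdop_slice (hom_in_degree (dop_degree P) P) bk"
    unfolding bk hdop_slice_hom by (cases "c = 0") (auto simp: hdop_slice_def c_def[symmetric])
qed

lemma hdop_slice_z_power:
  "hdop_slice (hdop_z ^ m * H) (b, k) = (if m \<le> k then hdop_slice H (b, k - m) else 0)"
proof (induction m arbitrary: k)
  case (Suc m)
  have "hdop_slice (hdop_z * (hdop_z ^ m * H)) (b, k) = (case k of 0 \<Rightarrow> 0 | Suc k' \<Rightarrow> hdop_slice (hdop_z ^ m * H) (b, k'))"
    by (rule cps_eqI) (auto simp: hdop_coeff_z_mult cps_nth_0 simp flip: hdop_coeff_slice split: nat.split)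
  then show ?case by (auto simp: Suc.IH mult.assoc split: nat.split)
qed simp

lemma hom_in_homogenized_ideal:
  assumes P: "P \<in> I" and d: "dop_bound d P"
  shows "hom_in_degree d P \<in> homogenized_ideal I"
\<comment> \<open>\<open>dop_degree P\<close> can be compared with \<open>d\<close> only for nonzero
  \<open>P\<close>.\<close>
proof (cases "P = 0")
  case True
  have "hom_in_degree d P = 0"
    by (rule hdop_slice_eqI) (auto simp: True hdop_slice_hom hdop_slice_simps zero_dop.rep_eq)
  then show ?thesis by (simp add: homogenized_ideal_def left_ideal_gen_0)
next
  case False
  then have "dop_expansion P \<noteq> 0" by (metis dop_expansion_inject zero_dop.rep_eq)
  then have le: "dop_degree P \<le> d"
    using d by (auto simp: dop_degree_def dop_bound_def)
  have "hom_in_degree d P = hdop_z ^ (d - dop_degree P) * homogenize P"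
  proof (rule hdop_slice_eqI)
    fix bk :: "('a \<Rightarrow> nat) \<times> nat"
    obtain b k where bk: "bk = (b, k)" by (cases bk)
    have "(\<Sum>i\<in>UNIV. b i) \<le> dop_degree P" if "Poly_Mapping.lookup (dop_expansion P) b \<noteq> 0"
      using that dop_bound_degree[of P] by (auto simp: dop_bound_def in_keys_iff)
    then show "hdop_slice (hom_in_degree d P) bk = hdop_slice (hdop_z ^ (d - dop_degree P) * homogenize P) bk"
      unfolding bk hdop_slice_z_power homogenize_eq_hom hdop_slice_hom using le
      by (cases "Poly_Mapping.lookup (dop_expansion P) b = 0") auto
  qed
  then show ?thesis
    unfolding homogenized_ideal_def using P by (auto intro: left_ideal_gen_generator)
qed

lemma dehom_homogenized_ideal:
  assumes I: "left_ideal I" and H: "H \<in> homogenized_ideal I"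
  shows "dehom H \<in> I"
proof -
  obtain F A where F: "finite F" "F \<subseteq> homogenize ` I" "H = (\<Sum>P\<in>F. A P * P)"
    using H unfolding homogenized_ideal_def left_ideal_gen_def by blast
  have "dehom (A P * P) \<in> I" if P: "P \<in> F" for P
  proof -
    obtain Q where "Q \<in> I" "P = homogenize Q" using F(2) P by blast
    then show ?thesis
      using I by (simp add: dehom_mult homogenize_eq_hom dehom_hom[OF dop_bound_degree] left_ideal_def)
  qed
  then show ?thesis unfolding F(3) dehom_sum by (rule left_ideal_sum[OF I])
qed

lemma graded_homogenized_ideal:
  assumes "H \<in> homogenized_ideal I"
  shows "hdop_restrict {e. expo_deg e = d} H \<in> homogenized_ideal I"
proof -
  obtain F A where F: "finite F" "F \<subseteq> homogenize ` I" "H = (\<Sum>P\<in>F. A P * P)"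
    using assms unfolding homogenized_ideal_def left_ideal_gen_def by blast
  have "hdop_restrict {e. expo_deg e = d} (A P * P) \<in> homogenized_ideal I" if P: "P \<in> F" for P
  proof -
    obtain Q where Q: "Q \<in> I" "P = homogenize Q" using F(2) P by blast
    \<comment> \<open>The degree of the cofactor is fixed by a sum, as
      \<open>d - dop_degree Q\<close> would be truncated if \<open>Q\<close> has degree above
      \<open>d\<close>.\<close>
    have "hdop_restrict {e. expo_deg e = d} (A P * P)
        = hdop_restrict {e. expo_deg e + dop_degree Q = d} (A P) * hdop_restrict UNIV P"
    proof (rule restrict_mult)
      show "expo_deg e = expo_deg e1 + expo_deg e2" if "expo_sig e = expo_sig e1 + expo_sig e2"
        for e e1 e2 :: "'a expo" using that by (rule expo_deg_sig)
      show "expo_deg e1 + expo_deg e2 = d \<longleftrightarrow> e1 \<in> {e. expo_deg e + dop_degree Q = d} \<and> e2 \<in> UNIV"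
        if "e2 \<in> hdop_diagram P" for e1 e2
        using that homogeneous_hom[of "dop_degree Q" Q] by (simp add: Q(2) homogenize_eq_hom homogeneous_def)
    qed
    also have "hdop_restrict UNIV P = P" by (rule restrict_id) simp
    finally show ?thesis
      unfolding homogenized_ideal_def using F(2) P by (auto intro: left_ideal_gen_generator)
  qed
  then show ?thesis
    unfolding F(3) restrict_sum homogenized_ideal_def
    by (intro left_ideal_sum[OF left_ideal_gen_UNIV]) simp
qed

section \<open>Common remainders\<close>

context graded_ideal begin

text \<open>For \<open>L\<close> in the cone, \<open>R\<close> is the \<open>L\<close>-remainder of
  every \<open>H'\<close> in the class of \<open>H\<close> and so inherits the order bound of
  \<open>H'\<close>. Hence each weight may come with a representative of its own.\<close>

theorem common_remainder:
  assumes \<sigma>: "\<sigma> \<in> V_groebner_fan J" and H: "homogeneous d H"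
  obtains R where "homogeneous d R" "H - R \<in> J"
    "\<And>H' L x. homogeneous d H' \<Longrightarrow> H - H' \<in> J \<Longrightarrow> L \<in> closure \<sigma> \<Longrightarrow> x \<in> hdop_diagram R \<Longrightarrow>
      \<exists>y\<in>hdop_diagram H'. lin_form L x \<le> lin_form L y"
proof -
  obtain L0 where L0: "L0 \<in> U_V"
    and \<sigma>_eq: "\<sigma> = {L \<in> U_V. (gr_ring L :: ('n + 'p) hdop set) = gr_ring L0 \<and> gr_ideal L J = gr_ideal L0 J}"
    using groebner_class[OF \<sigma>] by blast
  have lead: "lead_set L = lead_set L0" if "L \<in> \<sigma>" for L
    using that L0 by (intro lead_set_eq) (auto simp: \<sigma>_eq)
  have "\<exists>c. \<forall>x\<in>hdop_diagram H. lin_form L0 x \<le> c"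
  proof (cases "H = 0")
    case True
    then have "hdop_diagram H = {}" by (simp add: diagram_eq_empty)
    then show ?thesis by simp
  next
    case False
    then show ?thesis using hdop_ord_attained[OF L0] by metis
  qed
  then obtain c where c: "\<And>x. x \<in> hdop_diagram H \<Longrightarrow> lin_form L0 x \<le> c" by blast
  obtain R where R: "homogeneous d R" "H - R \<in> J" "hdop_diagram R \<inter> lead_set L0 = {}"
    using nf_exists[OF L0 H c] by blast
  \<comment> \<open>all weights in the cone give this remainder, since they have the same leading exponents\<close>
  have le: "lin_form L x \<le> c"
    if L: "L \<in> \<sigma>" and H': "homogeneous d H'" "H - H' \<in> J" "\<And>y. y \<in> hdop_diagram H' \<Longrightarrow> lin_form L y \<le> c"
      and x: "x \<in> hdop_diagram R" for L H' c x
  proof -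
    have LU: "L \<in> U_V" using L by (simp add: \<sigma>_eq)
    obtain R' where R': "homogeneous d R'" "H' - R' \<in> J" "hdop_diagram R' \<inter> lead_set L = {}"
      "\<And>y. y \<in> hdop_diagram R' \<Longrightarrow> lin_form L y \<le> c"
      using nf_exists[OF LU H'(1,3)] by blast
    have "R - R' = 0"
    proof (rule nf_zero[OF L0])
      have "(H - H') + (H' - R') \<in> J" using ideal H'(2) R'(2) unfolding left_ideal_def by blast
      then have "((H - H') + (H' - R')) - (H - R) \<in> J" by (rule J_diff) (rule R(2))
      then show "R - R' \<in> J" by simp
      show "homogeneous d (R - R')" by (rule homogeneous_diff[OF R(1) R'(1)])
      show "hdop_diagram (R - R') \<inter> lead_set L0 = {}"
        using diagram_diff[of R R'] R(3) R'(3) lead[OF L] by blast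
    qed
    then show ?thesis using R'(4) x by simp
  qed
  have "\<exists>y\<in>hdop_diagram H'. lin_form L x \<le> lin_form L y"
    if H': "homogeneous d H'" "H - H' \<in> J" and L: "L \<in> closure \<sigma>" and x: "x \<in> hdop_diagram R" for H' L x
  proof -
    have "\<And>y. y \<in> hdop_diagram H' \<Longrightarrow> expo_deg y = d" using H'(1) by (simp add: homogeneous_def)
    then obtain M where M: "finite M" "M \<subseteq> hdop_diagram H'"
      "\<And>y. y \<in> hdop_diagram H' \<Longrightarrow> \<exists>m\<in>M. \<exists>a. y = m + (a, 0, 0)"
      by (rule dickson_degree[of "hdop_diagram H'" d]) auto
    \<comment> \<open>On the cone the maximum over \<open>H'\<close> is reached in the finite set
      \<open>M\<close>. So \<open>T\<close>, a finite union of closed sets, contains the cone and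
      therefore its closure.\<close>
    define T where "T = (\<Union>m\<in>M. {L. L \<bullet> (expo_vec m - expo_vec x) \<ge> 0})"
    have "closed T"
      unfolding T_def using M(1)
      by (intro closed_UN ballI closed_Collect_le continuous_intros)
    moreover have "\<sigma> \<subseteq> T"
    proof
      fix L' assume L': "L' \<in> \<sigma>"
      then have LU: "L' \<in> U_V" by (simp add: \<sigma>_eq)
      have "H' \<noteq> 0"
      proof
        assume "H' = 0"
        then have "hdop_diagram H' = {}" by (simp add: diagram_eq_empty)
        \<comment> \<open>Without exponents in \<open>H'\<close> every bound is admissible, even one
          below the value at \<open>x\<close>.\<close>
        then have "lin_form L' x \<le> lin_form L' x - 1" by (intro le[OF L' H' _ x]) auto
        then show False by simp
      qed
      then obtain y where y: "y \<in> hdop_diagram H'" "\<And>z. z \<in> hdop_diagram H' \<Longrightarrow> lin_form L' z \<le> lin_form L' y"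
        using hdop_ord_attained[OF LU] by metis
      obtain m a where m: "m \<in> M" "y = m + (a, 0, 0)" using M(3)[OF y(1)] by blast
      have "lin_form L' x \<le> lin_form L' y" by (rule le[OF L' H' y(2) x])
      also have "\<dots> \<le> lin_form L' m" unfolding m(2) by (rule lin_form_add_le[OF LU])
      finally show "L' \<in> T" using m(1) by (auto simp: T_def lin_form_inner inner_diff_right)
    qed
    ultimately have "L \<in> T" using L closure_minimal by blast
    then obtain m where "m \<in> M" "lin_form L x \<le> lin_form L m"
      by (auto simp: T_def lin_form_inner inner_diff_right)
    then show ?thesis using M(2) by blast
  qed
  then show ?thesis by (rule that[OF R(1,2)])
qed

end

section \<open>Filtrations of the quotient module\<close>

lemma residue_class_eq_iff:
  assumes I: "left_ideal I"
  shows "residue_class I P = residue_class I Q \<longleftrightarrow> P - Q \<in> I"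
proof
  assume "residue_class I P = residue_class I Q"
  moreover have "P \<in> residue_class I P"
    using I by (auto simp: residue_class_def left_ideal_def intro!: exI[of _ 0])
  ultimately obtain R where "P = Q + R" "R \<in> I" by (auto simp: residue_class_def)
  then show "P - Q \<in> I" by simp
next
  have sub: "residue_class I P \<subseteq> residue_class I Q" if PQ: "P - Q \<in> I" for P Q
  proof
    fix X assume "X \<in> residue_class I P"
    then obtain R where R: "X = P + R" "R \<in> I" by (auto simp: residue_class_def)
    have "(P - Q) + R \<in> I" using I PQ R(2) by (auto simp: left_ideal_def)
    then show "X \<in> residue_class I Q"
      unfolding residue_class_def R(1) by (intro CollectI exI[of _ "(P - Q) + R"]) simp
  qed
  assume PQ: "P - Q \<in> I"
  have "0 \<in> I" using I by (simp add: left_ideal_def)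
  from left_ideal_diff[OF I this PQ] have "Q - P \<in> I" by simp
  then show "residue_class I P = residue_class I Q" using sub PQ by blast
qed

lemma dop_ord_le_iff: "dop_ord L P \<le> ereal c \<longleftrightarrow> (\<forall>e\<in>dop_diagram P. lin_form L e \<le> c)"
  by (simp add: dop_ord_def ord_diagram_def SUP_le_iff)

lemma lin_form_no_z: "lin_form L (a, b, k) = lin_form L (a, b, k')"
  by (simp add: lin_form_def V_form_def)

lemma lin_form_axis: "lin_form (axis j 1) e = V_form j e"
proof -
  have "lin_form (axis j 1) e = (\<Sum>i\<in>UNIV. if i = j then V_form i e else 0)"
    unfolding lin_form_def by (intro sum.cong refl) (auto simp: axis_def)
  then show ?thesis by simp
qed

lemma dop_diagram_sum: "dop_diagram (\<Sum>k\<in>F. Q k) \<subseteq> (\<Union>k\<in>F. dop_diagram (Q k))"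
proof
  fix e assume e: "e \<in> dop_diagram (\<Sum>k\<in>F. Q k)"
  obtain a b k where [simp]: "e = (a, b, k)" by (cases e)
  define nth where "nth P = cps_nth (Poly_Mapping.lookup (dop_expansion P) b) a" for P :: "'a dop"
  have "nth (\<Sum>k\<in>F. Q k) = (\<Sum>k\<in>F. nth (Q k))"
    by (rule additive_sum(2)) (simp add: nth_def plus_dop.rep_eq lookup_add cps_nth_add)
  then have "(\<Sum>k\<in>F. nth (Q k)) \<noteq> 0" using e by (simp add: dop_diagram_iff nth_def)
  then obtain x where "x \<in> F" "nth (Q x) \<noteq> 0" by (rule sum.not_neutral_contains_not_neutral)
  then show "e \<in> (\<Union>k\<in>F. dop_diagram (Q k))" using e by (auto simp: dop_diagram_iff nth_def)
qed

text \<open>The terms of \<open>R\<close> are sorted by a minimal exponent \<open>m\<close> below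
  them. Multiplication by variables does not raise any \<open>V\<^sub>j\<close>, so the terms above
  \<open>m\<close> lie in the step of the filtration given by the vector of all
  \<open>V\<^sub>j(m)\<close>, and \<open>L\<close> of this vector is \<open>lin_form L m\<close>.
  Dickson's lemma makes the sum finite.\<close>

lemma V_filtration_decompose:
  fixes R :: "('n::finite + 'p::finite) hdop"
  assumes R: "homogeneous d R" and S: "S \<subseteq> U_V"
    and le: "\<And>L x. L \<in> S \<Longrightarrow> x \<in> hdop_diagram R \<Longrightarrow> lin_form L x \<le> lin_form_at L w"
  shows "residue_class I (dehom R)
    \<in> module_sum I {w'. \<forall>L\<in>S. lin_form_at L w' \<le> lin_form_at L w} (V_filtration I)"
proof -
  have "\<And>x. x \<in> hdop_diagram R \<Longrightarrow> expo_deg x = d" using R by (simp add: homogeneous_def)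
  then obtain M where M: "finite M" "M \<subseteq> hdop_diagram R"
    "\<And>x. x \<in> hdop_diagram R \<Longrightarrow> \<exists>m\<in>M. \<exists>a. x = m + (a, 0, 0)"
    by (rule dickson_degree[of "hdop_diagram R" d]) auto
  define wv :: "('n + 'p) expo \<Rightarrow> int^'p" where
    "wv = (\<lambda>(a, b, k). \<chi> j. int (b (Inr j)) - int (a (Inr j)))"
  have wv: "real_of_int (wv e $ j) = V_form j e" for e j
    by (cases e) (simp add: wv_def V_form_def)
  have "\<forall>x. \<exists>m. x \<in> hdop_diagram R \<longrightarrow> m \<in> M \<and> (\<exists>a. x = m + (a, 0, 0))" using M(3) by blast
  then obtain ch where ch: "\<And>x. x \<in> hdop_diagram R \<Longrightarrow> ch x \<in> M \<and> (\<exists>a. x = ch x + (a, 0, 0))" by metis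
  \<comment> \<open>Grouping by the vector and not by the exponent matches
    \<open>module_sum\<close>, where each index carries one summand.\<close>
  define piece where "piece w' = hdop_restrict {x. wv (ch x) = w'} R" for w'
  have "R = (\<Sum>w'\<in>wv ` M. piece w')"
  proof (rule hdop_eqI)
    fix e
    have "(\<Sum>w'\<in>wv ` M. hdop_coeff (piece w') e) = (\<Sum>w'\<in>wv ` M. if w' = wv (ch e) then hdop_coeff R e else 0)"
      by (intro sum.cong refl) (auto simp: piece_def hdop_coeff_restrict)
    also have "\<dots> = hdop_coeff R e" using M(1) ch[of e] by (auto simp: diagram_iff)
    finally show "hdop_coeff R e = hdop_coeff (\<Sum>w'\<in>wv ` M. piece w') e" by (simp add: hdop_coeff_sum)
  qed
  then have eq: "dehom R = (\<Sum>w'\<in>wv ` M. dehom (piece w'))" using dehom_sum by metis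
  have "residue_class I (dehom (piece w')) \<in> V_filtration I w'" for w'
    unfolding V_filtration_def
  proof (rule imageI, intro CollectI allI, unfold dop_ord_le_iff, rule ballI)
    fix j e assume e: "e \<in> dop_diagram (dehom (piece w'))"
    obtain a b where ab: "e = (a, b, 0)" using e by (auto simp: dop_diagram_def)
    obtain k where "(a, b, k) \<in> hdop_diagram (piece w')" using dop_diagram_dehom e ab by blast
    then have x: "(a, b, k) \<in> hdop_diagram R" "wv (ch (a, b, k)) = w'"
      by (auto simp: piece_def diagram_restrict)
    obtain a' where a': "(a, b, k) = ch (a, b, k) + (a', 0, 0)" using ch[OF x(1)] by blast
    obtain c b' k' where c: "ch (a, b, k) = (c, b', k')" by (metis prod.exhaust)
    have "V_form j (ch (a, b, k) + (a', 0, 0)) \<le> V_form j (ch (a, b, k))" by (simp add: c V_form_def)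
    then have "V_form j (a, b, k) \<le> V_form j (ch (a, b, k))" using a' by metis
    then show "lin_form (axis j 1) e \<le> real_of_int (w' $ j)"
      using x(2) wv[of "ch (a, b, k)" j] by (simp add: lin_form_axis ab V_form_def)
  qed
  moreover have "wv ` M \<subseteq> {w'. \<forall>L\<in>S. lin_form_at L w' \<le> lin_form_at L w}"
  proof (intro image_subsetI CollectI ballI)
    fix m L assume "m \<in> M" "L \<in> S"
    then have "lin_form L m \<le> lin_form_at L w" using le M(2) by blast
    then show "lin_form_at L (wv m) \<le> lin_form_at L w" by (simp add: lin_form_at_def lin_form_def wv)
  qed
  ultimately show ?thesis
    unfolding module_sum_def eq using M(1)
    by (intro CollectI exI[of _ "wv ` M"] exI[of _ "\<lambda>w'. dehom (piece w')"]) auto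
qed

text \<open>This is the easy inclusion: the coefficients of \<open>L\<close> are nonnegative, so
  bounds on all \<open>V\<^sub>j\<close> combine to a bound on \<open>L\<close>.\<close>

lemma cone_filtration_subset:
  fixes I :: "('n::finite + 'p::finite) dop set"
  assumes I: "left_ideal I" and S: "S \<subseteq> U_V" and L: "L \<in> S"
  shows "module_sum I {w'. \<forall>L\<in>S. lin_form_at L w' \<le> lin_form_at L w} (V_filtration I)
    \<subseteq> VL_filtration I L (lin_form_at L w)"
proof
  fix X assume "X \<in> module_sum I {w'. \<forall>L\<in>S. lin_form_at L w' \<le> lin_form_at L w} (V_filtration I)"
  then obtain F P where F: "finite F" "\<And>k. k \<in> F \<Longrightarrow> lin_form_at L k \<le> lin_form_at L w"
    "X = residue_class I (\<Sum>k\<in>F. P k)" "\<And>k. k \<in> F \<Longrightarrow> residue_class I (P k) \<in> V_filtration I k"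
    unfolding module_sum_def using L by blast
  have "\<exists>Q. P k - Q \<in> I \<and> (\<forall>j. \<forall>e\<in>dop_diagram Q. V_form j e \<le> real_of_int (k $ j))" if "k \<in> F" for k
    using F(4)[OF that] unfolding V_filtration_def
    by (auto simp: residue_class_eq_iff[OF I] dop_ord_le_iff lin_form_axis)
  then obtain Q where Q: "\<And>k. k \<in> F \<Longrightarrow> P k - Q k \<in> I"
    "\<And>k j e. k \<in> F \<Longrightarrow> e \<in> dop_diagram (Q k) \<Longrightarrow> V_form j e \<le> real_of_int (k $ j)"
    by metis
  have "(\<Sum>k\<in>F. P k) - (\<Sum>k\<in>F. Q k) \<in> I"
    using left_ideal_sum[OF I, of F "\<lambda>k. P k - Q k"] Q(1) by (simp add: sum_subtractf)
  then have "X = residue_class I (\<Sum>k\<in>F. Q k)" using F(3) by (simp add: residue_class_eq_iff[OF I])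
  moreover have "dop_ord L (\<Sum>k\<in>F. Q k) \<le> ereal (lin_form_at L w)"
    unfolding dop_ord_le_iff
  proof
    fix e assume "e \<in> dop_diagram (\<Sum>k\<in>F. Q k)"
    then obtain k where k: "k \<in> F" "e \<in> dop_diagram (Q k)" using dop_diagram_sum by blast
    have "lin_form L e \<le> lin_form_at L k"
      unfolding lin_form_def lin_form_at_def using S L Q(2)[OF k]
      by (intro sum_mono mult_left_mono) (auto simp: U_V_def)
    then show "lin_form L e \<le> lin_form_at L w" using F(2)[OF k(1)] by linarith
  qed
  ultimately show "X \<in> VL_filtration I L (lin_form_at L w)" unfolding VL_filtration_def by blast
qed

text \<open>The argument also covers \<open>\<sigma> = {0}\<close>: without generators the remainder
  of \<open>P\<close> has no bound to satisfy, and the intersection is the whole quotient.\<close>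

theorem theorem1:
  fixes I :: "('n::finite + 'p::finite) dop set" and \<sigma> :: "(real^'p) set" and w :: "int^'p"
  assumes "left_ideal I" and "\<sigma> \<in> V_groebner_fan (homogenized_ideal I)"
  shows "cone_filtration I \<sigma> w =
    quotient_module I \<inter> (\<Inter>L\<in>skeleton_generators \<sigma>. VL_filtration I L (lin_form_at L w))"
proof -
  note I = assms(1)
  obtain lam mu :: "'n + 'p \<Rightarrow> real" where "\<And>i. 0 < lam i" "\<And>i. lam i < mu i"
    "\<And>a b a' b'. wsum lam a - wsum mu b = wsum lam a' - wsum mu b' \<Longrightarrow> a = a' \<and> b = b'"
    by (rule ex_tie_weights) blast
  then interpret graded_ideal lam mu "homogenized_ideal I"
    by unfold_locales
       (auto simp: homogenized_ideal_def left_ideal_gen_UNIV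
          intro: graded_homogenized_ideal[unfolded homogenized_ideal_def])
  define S where "S = skeleton_generators \<sigma>"
  have S_closure: "S \<subseteq> closure \<sigma>"
  proof
    fix L assume "L \<in> S"
    then have "ray L \<subseteq> closure \<sigma>" by (auto simp: S_def skeleton_generators_def dest: face_of_imp_subset)
    moreover have "L \<in> ray L" unfolding ray_def by (auto intro: exI[of _ 1])
    ultimately show "L \<in> closure \<sigma>" by blast
  qed
  have "\<sigma> \<subseteq> U_V" using groebner_class[OF assms(2)] by blast
  then have S_UV: "S \<subseteq> U_V" using S_closure closure_minimal[OF _ closed_U_V] by blast
  have S_fin: "finite S"
    unfolding S_def
    by (intro finite_skeleton_generators finite_polyhedron_faces polyhedron_closure_cone assms(2))
  have "X \<in> cone_filtration I \<sigma> w"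
    if X: "X \<in> quotient_module I" "\<And>L. L \<in> S \<Longrightarrow> X \<in> VL_filtration I L (lin_form_at L w)" for X
  proof -
    obtain P where P: "X = residue_class I P" using X(1) by (auto simp: quotient_module_def)
    have "\<forall>L\<in>S. \<exists>Q. P - Q \<in> I \<and> (\<forall>e\<in>dop_diagram Q. lin_form L e \<le> lin_form_at L w)"
      using X(2) by (fastforce simp: VL_filtration_def P residue_class_eq_iff[OF I] dop_ord_le_iff)
    then obtain Q where Q: "\<And>L. L \<in> S \<Longrightarrow> P - Q L \<in> I"
      "\<And>L e. L \<in> S \<Longrightarrow> e \<in> dop_diagram (Q L) \<Longrightarrow> lin_form L e \<le> lin_form_at L w"
      by metis
    define d where "d = Max (insert (dop_degree P) ((\<lambda>L. dop_degree (Q L)) ` S))"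
    have dP: "dop_bound d P" and dQ: "\<And>L. L \<in> S \<Longrightarrow> dop_bound d (Q L)"
      unfolding d_def using S_fin by (auto intro!: dop_bound_mono[OF dop_bound_degree] Max_ge)
    obtain R where R: "homogeneous d R" "hom_in_degree d P - R \<in> homogenized_ideal I"
      "\<And>H' L x. homogeneous d H' \<Longrightarrow> hom_in_degree d P - H' \<in> homogenized_ideal I \<Longrightarrow> L \<in> closure \<sigma> \<Longrightarrow>
        x \<in> hdop_diagram R \<Longrightarrow> \<exists>y\<in>hdop_diagram H'. lin_form L x \<le> lin_form L y"
      using common_remainder[OF assms(2) homogeneous_hom[of d P]] by blast
    have "P - dehom R \<in> I"
      using dehom_homogenized_ideal[OF I R(2)] by (simp add: dehom_diff dehom_hom[OF dP])
    then have "X = residue_class I (dehom R)" by (simp add: P residue_class_eq_iff[OF I])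
    moreover have "lin_form L x \<le> lin_form_at L w" if L: "L \<in> S" and x: "x \<in> hdop_diagram R" for L x
    proof -
      \<comment> \<open>In a common degree the difference of homogenizations is the homogenization
        of \<open>P - Q L\<close>, an element of \<open>I\<close>; \<open>homogenize\<close> itself
        is not additive.\<close>
      have "hom_in_degree d P - hom_in_degree d (Q L) \<in> homogenized_ideal I"
        unfolding hom_diff[symmetric] by (intro hom_in_homogenized_ideal Q(1) L dop_bound_diff dP dQ)
      then obtain y where y: "y \<in> hdop_diagram (hom_in_degree d (Q L))" "lin_form L x \<le> lin_form L y"
        using R(3)[OF homogeneous_hom _ _ x] L S_closure by blast
      obtain a b k where abk: "y = (a, b, k)" by (cases y)
      have "(a, b, 0) \<in> dop_diagram (Q L)" using diagram_hom y(1) abk by blast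
      then show ?thesis using Q(2)[OF L] y(2) lin_form_no_z[of L a b k 0] abk by fastforce
    qed
    ultimately show ?thesis
      unfolding cone_filtration_def S_def[symmetric] using V_filtration_decompose[OF R(1) S_UV] by simp
  qed
  moreover have "cone_filtration I \<sigma> w \<subseteq> VL_filtration I L (lin_form_at L w)" if "L \<in> S" for L
    unfolding cone_filtration_def S_def[symmetric] by (rule cone_filtration_subset[OF I S_UV that])
  moreover have "cone_filtration I \<sigma> w \<subseteq> quotient_module I"
    by (auto simp: cone_filtration_def module_sum_def quotient_module_def)
  ultimately show ?thesis unfolding S_def[symmetric] by blast
qed

end
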